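(* Let $n,m$ be positive integers and let $\alpha>0$. There are constants $N\in\mathbb{N}$ and $L\ge 1$, depending only on $\alpha$, $n$ and $m$, such that the following holds. Let $Q_0=[0,1]^{n+m}$ and let $f\colon Q_0\to X$ be a $1$-Lipschitz mapping into a metric space $X$. Then there is a decomposition of $Q_0$ into Borel sets $$Q_0=F_1\cup F_2\cup\dots\cup F_N\cup G$$ such that: (1) for each $i\in\{1,\dots,N\}$ there is an $L$-bi-Lipschitz map $\phi_i\colon F_i\to Q_0$ such that the map $$(x,y)\mapsto\bigl(f(\phi_i^{-1}(x,y)),\,y\bigr)$$ is $L$-bi-Lipschitz on $\phi_i(F_i)$, as a map into $X\times\mathbb{R}^m$; and (2) $\mathcal{H}^{n,m}_\infty(f,G)<\alpha$.
   Context: Points of $\mathbb{R}^{n+m}=\mathbb{R}^n\times\mathbb{R}^m$ (Euclidean metric) are written $(x,y)$ with $x\in\mathbb{R}^n$, $y\in\mathbb{R}^m$. $X\times\mathbb{R}^m$ carries the maximum of the two coordinate distances. A map is $L$-bi-Lipschitz if it distorts distances by a factor in $[L^{-1},L]$. Hausdorff content: $\mathcal{H}^k_\infty(A)=\inf\sum_B\operatorname{diam}(B)^k$, the infimum being over all covers of $A$ by closed balls. Mapping content: dyadic cubes are closed, and $\operatorname{side}(Q)$ is the side length of $Q$. For $E\subseteq Q_0$, $$\mathcal{H}^{n,m}_\infty(f,E)=\inf\sum_i \mathcal{H}^n_\infty(f(Q_i))\operatorname{side}(Q_i)^m,$$ the infimum being over all coverings $\{Q_i\}$ of $E$ by dyadic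 cubes in $Q_0$ with pairwise disjoint interiors. *)

theory Defs
  imports "HOL-Analysis.Analysis"
begin

text \<open>
  Target spaces are elements of the type \<^typ>\<open>'x metric\<close>. The extended diameter is used so that
  contents are plain infima of \<^typ>\<open>ennreal\<close>-valued sums (the infimum over no cover is infinite).
\<close>

definition ediam :: "'x metric \<Rightarrow> 'x set \<Rightarrow> ennreal" where
  "ediam X B = (SUP x\<in>B. SUP y\<in>B. ennreal (mdist X x y))"

text \<open>
  Covers are countable: an uncountable cover by singletons would consist of sets of diameter 0.
  The balls are balls of the ambient space, centred anywhere in it.
\<close>

definition closed_balls :: "'x metric \<Rightarrow> 'x set set" where
  "closed_balls X = {mcball_of X x r | x r. x \<in> mspace X \<and> 0 < r}"

definition hausdorff_content :: "'x metric \<Rightarrow> nat \<Rightarrow> 'x set \<Rightarrow> ennreal" where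
  "hausdorff_content X k A =
     (INF \<B>\<in>{\<B>. \<B> \<subseteq> closed_balls X \<and> countable \<B> \<and> A \<subseteq> \<Union>\<B>}.
        \<Sum>\<^sub>\<infinity>B\<in>\<B>. ediam X B ^ k)"

definition unit_cube :: "'e::euclidean_space set" where
  "unit_cube = cbox 0 One"

definition dyadic_cubes :: "'e::euclidean_space set set" where
  "dyadic_cubes =
     {cbox ((2 powi k) *\<^sub>R c) ((2 powi k) *\<^sub>R (c + One)) | k c. \<forall>b\<in>Basis. c \<bullet> b \<in> \<int>}"

definition side :: "'e::euclidean_space set \<Rightarrow> real" where
  "side Q = (THE s. 0 \<le> s \<and> (\<exists>a. Q = cbox a (a + s *\<^sub>R One)))"

lemma side_cbox:
  fixes a :: "'e::euclidean_space"
  assumes "0 \<le> s"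
  shows "side (cbox a (a + s *\<^sub>R One)) = s"
  unfolding side_def
proof (rule the_equality)
  fix t assume t: "0 \<le> t \<and> (\<exists>b. cbox a (a + s *\<^sub>R One) = cbox b (b + t *\<^sub>R One))"
  then obtain b where b: "cbox a (a + s *\<^sub>R One) = cbox b (b + t *\<^sub>R One)" by blast
  have "cbox a (a + s *\<^sub>R One) \<noteq> {}"
    using assms by (simp add: box_ne_empty inner_simps)
  with b have "a = b \<and> a + s *\<^sub>R One = b + t *\<^sub>R One"
    by (metis eq_cbox)
  then have "s *\<^sub>R (One::'e) = t *\<^sub>R One" by (metis add_left_cancel)
  moreover obtain v :: 'e where "v \<in> Basis" using nonempty_Basis by blast
  ultimately show "t = s" by (metis inner_scaleR_left inner_sum_Basis mult.right_neutral)
qed (use assms in auto)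

definition mapping_content ::
  "'x metric \<Rightarrow> ((real^'n) \<times> (real^'m) \<Rightarrow> 'x) \<Rightarrow> ((real^'n) \<times> (real^'m)) set \<Rightarrow> ennreal" where
  "mapping_content X f E =
     (INF \<Q>\<in>{\<Q>. \<Q> \<subseteq> dyadic_cubes \<and> (\<forall>Q\<in>\<Q>. Q \<subseteq> unit_cube) \<and>
                   pairwise (\<lambda>Q R. interior Q \<inter> interior R = {}) \<Q> \<and> E \<subseteq> \<Union>\<Q>}.
        \<Sum>\<^sub>\<infinity>Q\<in>\<Q>. hausdorff_content X CARD('n) (f ` Q) * ennreal (side Q) ^ CARD('m))"

definition bilipschitz_on ::
  "real \<Rightarrow> 'a set \<Rightarrow> ('a \<Rightarrow> 'a \<Rightarrow> real) \<Rightarrow> ('b \<Rightarrow> 'b \<Rightarrow> real) \<Rightarrow> ('a \<Rightarrow> 'b) \<Rightarrow> bool" where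
  "bilipschitz_on L S d d' g \<longleftrightarrow>
     (\<forall>p\<in>S. \<forall>q\<in>S. d p q / L \<le> d' (g p) (g q) \<and> d' (g p) (g q) \<le> L * d p q)"

definition max_dist ::
  "('a \<Rightarrow> 'a \<Rightarrow> real) \<Rightarrow> ('b \<Rightarrow> 'b \<Rightarrow> real) \<Rightarrow> 'a \<times> 'b \<Rightarrow> 'a \<times> 'b \<Rightarrow> real" where
  "max_dist d d' p q = max (d (fst p) (fst q)) (d' (snd p) (snd q))"

definition one_lipschitz_on :: "'a::metric_space set \<Rightarrow> 'x metric \<Rightarrow> ('a \<Rightarrow> 'x) \<Rightarrow> bool" where
  "one_lipschitz_on S X f \<longleftrightarrow>
     f ` S \<subseteq> mspace X \<and> (\<forall>p\<in>S. \<forall>q\<in>S. mdist X (f p) (f q) \<le> dist p q)"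

text \<open>
  A decomposition is a partition; pieces may be empty. The type \<^typ>\<open>(real^'n) \<times> (real^'m)\<close> carries
  the Euclidean metric of dimension \<open>CARD('n) + CARD('m)\<close>.
\<close>

definition has_decomposition ::
  "real \<Rightarrow> nat \<Rightarrow> real \<Rightarrow> 'x metric \<Rightarrow> ((real^'n) \<times> (real^'m) \<Rightarrow> 'x) \<Rightarrow> bool" where
  "has_decomposition \<alpha> N L X f \<longleftrightarrow>
     (\<exists>(F :: nat \<Rightarrow> ((real^'n) \<times> (real^'m)) set) G.
        unit_cube = (\<Union>i\<in>{1..N}. F i) \<union> G \<and>
        disjoint_family_on F {1..N} \<and> (\<forall>i\<in>{1..N}. F i \<inter> G = {}) \<and>
        (\<forall>i\<in>{1..N}. F i \<in> sets borel) \<and> G \<in> sets borel \<and>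
        (\<forall>i\<in>{1..N}. \<exists>\<phi> :: (real^'n) \<times> (real^'m) \<Rightarrow> (real^'n) \<times> (real^'m).
           \<phi> ` F i \<subseteq> unit_cube \<and>
           bilipschitz_on L (F i) dist dist \<phi> \<and>
           bilipschitz_on L (\<phi> ` F i) dist (max_dist (mdist X) dist)
             (\<lambda>(x, y). (f (inv_into (F i) \<phi> (x, y)), y))) \<and>
        mapping_content X f G < ennreal \<alpha>)"

text \<open>
  A quantifier over all metric spaces cannot occur below an existential quantifier in HOL, since a
  type variable is always quantified outermost. To have constants that do not depend on the type
  of the points of the target space, one asserts that constants exist for all target spaces with
  points in \<^typ>\<open>real\<close>, and that any such constants also serve for all target spaces with points in
  an arbitrary type \<open>'x\<close>. Since the first assertion does not mention \<open>'x\<close>, a single choice of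
  constants serves for every type.
\<close>

end

theory Submission
  imports Defs
begin

text \<open>
  Let \<open>r\<close> be the pseudometric pulled back by \<open>f\<close>. At scale \<open>2\<^sup>-\<^sup>k\<close> it is compared with its difference
  quotients \<open>2\<^sup>k r x (x + 2\<^sup>-\<^sup>k v)\<close>. An energy estimate shows that most points meet boundedly many
  scales at which these quotients change between consecutive scales; at the other (flat) scales a
  compactness argument gives a dichotomy for the dyadic cell \<open>Q\<close>: either \<open>f(Q)\<close> has small content, or
  \<open>r\<close> is bounded below along a coordinate subspace \<open>S\<close> of dimension \<open>n\<close>. Cells of the first kind go
  into \<open>G\<close>. At the others \<open>S\<close> is kept as long as it serves; to lose it, some difference quotient must
  fall by a definite amount. Along a line the difference quotients over dyadic intervals form a
  bounded submartingale, so by Doob's inequality this happens boundedly often off a set of small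
  measure, which also goes into \<open>G\<close>.

  Every remaining point thus has boundedly many breaks. Coloring the breaks by level and position
  splits the remaining points into boundedly many pieces, on each of which points with a break
  at the same level are either very close or far apart. On one piece the isometries that turn the
  current \<open>S\<close> into the first factor, centered at the break cells, fit together to a bi-Lipschitz map
  \<open>\<phi>\<close>: at every scale \<open>r\<close> controls the directions in \<open>S\<close>, and the second component of \<open>\<phi>\<close> the others.
\<close>

subsection \<open>Seminorms as limits of metrics\<close>

text \<open>The energy estimate alone does not bound the number of breaks: at flat scales a
  difference quotient may drift down by amounts too small to show at any single scale, and over many
  scales the drift destroys all steepness. Doob's argument counts falls from one threshold to a
  lower one, whatever the number of scales a fall takes. It works with base points that are ends of
  dyadic intervals on a line, whereas steepness concerns a whole cell; flatness bridges the two,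
  since at a flat scale a quotient hardly depends on its base point. The pieces meet another
  obstacle: close points on different sides of a cell wall may have unrelated break histories.
  Removing thin strips along the walls of break cells costs little measure. With the coloring, the
  histories of two points of a piece then agree down to the scale of their distance, or at least one
  of the points keeps the common state down to it. Isometries are switched at centers taken
  \<open>J\<close> levels below the break cell, so that the distortion carries a factor
  \<open>2^-J\<close>.\<close>

lemma cluster_point_bounded_functions:
  fixes g :: "nat \<Rightarrow> 'a \<Rightarrow> real" and B :: "'a \<Rightarrow> real"
  assumes bd: "\<And>j x. 0 \<le> g j x \<and> g j x \<le> B x"
  obtains h where "\<And>F e n. finite F \<Longrightarrow> e > 0 \<Longrightarrow> \<exists>j\<ge>n. \<forall>x\<in>F. \<bar>g j x - h x\<bar> < e"
proof -
  \<comment> \<open>The index type may be uncountable, so a pointwise convergent subsequence need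
    not exist. Tychonoff's theorem still gives a cluster point, and only finitely many arguments are
    ever tested at a time.\<close>
  let ?U = "PiE UNIV (\<lambda>x. {0..B x})"
  have "compactin (product_topology (\<lambda>i::'a. euclidean::real topology) UNIV) ?U"
    unfolding compactin_PiE by (auto simp: compactin_euclidean_iff)
  then have cU: "compact ?U"
    by (simp add: euclidean_product_topology compactin_euclidean_iff)
  have ne: "filtermap g sequentially \<noteq> bot"
    by (simp add: filtermap_bot_iff)
  have ev: "eventually (\<lambda>x. x \<in> ?U) (filtermap g sequentially)"
    using bd by (simp add: eventually_filtermap PiE_iff)
  from cU[unfolded compact_filter, rule_format, OF ne ev]
  obtain h where h: "inf (nhds h) (filtermap g sequentially) \<noteq> bot" by blast
  show thesis
  proof
    fix F :: "'a set" and e :: real and n :: nat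
    assume F: "finite F" and e: "e > 0"
    have "open {f. \<forall>i\<in>F. f (id i) \<in> ball (h i) e}"
      by (rule product_topology_basis'[OF F]) auto
    then have 1: "eventually (\<lambda>f. \<forall>i\<in>F. f i \<in> ball (h i) e) (nhds h)"
      using e by (auto simp: eventually_nhds intro!: exI[of _ "{f. \<forall>i\<in>F. f i \<in> ball (h i) e}"])
    show "\<exists>j\<ge>n. \<forall>x\<in>F. \<bar>g j x - h x\<bar> < e"
    proof (rule ccontr)
      assume neg: "\<not> ?thesis"
      have "eventually (\<lambda>f. \<not> (\<forall>i\<in>F. f i \<in> ball (h i) e)) (filtermap g sequentially)"
        unfolding eventually_filtermap eventually_sequentially
      proof (intro exI[of _ n] allI impI)
        fix j assume "j \<ge> n"
        with neg obtain x where "x \<in> F" "\<not> \<bar>g j x - h x\<bar> < e" by blast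
        then show "\<not> (\<forall>i\<in>F. g j i \<in> ball (h i) e)"
          by (auto simp: dist_real_def abs_minus_commute)
      qed
      with 1 have "eventually (\<lambda>f. False) (inf (nhds h) (filtermap g sequentially))"
        unfolding eventually_inf by blast
      with h show False by (simp add: eventually_False)
    qed
  qed
qed

section \<open>Pseudometrics and seminorms dominated by the Euclidean norm\<close>

definition pm :: "('e::euclidean_space \<Rightarrow> 'e \<Rightarrow> real) \<Rightarrow> bool" where
  "pm r \<longleftrightarrow> (\<forall>x y. 0 \<le> r x y) \<and> (\<forall>x y. r x y = r y x) \<and>
     (\<forall>x y z. r x z \<le> r x y + r y z) \<and> (\<forall>x y. r x y \<le> dist x y)"

lemma pm_nonneg: "pm r \<Longrightarrow> 0 \<le> r x y"
  and pm_sym: "pm r \<Longrightarrow> r x y = r y x"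
  and pm_triangle: "pm r \<Longrightarrow> r x z \<le> r x y + r y z"
  and pm_le_dist: "pm r \<Longrightarrow> r x y \<le> dist x y"
  unfolding pm_def by blast+

lemma pm_refl: "pm r \<Longrightarrow> r x x = 0"
  using pm_nonneg[of r x x] pm_le_dist[of r x x] by simp

lemma pm_lip:
  assumes "pm r" shows "\<bar>r x y - r x' y'\<bar> \<le> dist x x' + dist y y'"
  using pm_triangle[OF assms, of x y x'] pm_triangle[OF assms, of x' y y'] pm_triangle[OF assms, of x' y' x]
    pm_triangle[OF assms, of x y' y] pm_le_dist[OF assms, of x x'] pm_le_dist[OF assms, of y y']
    pm_sym[OF assms, of x x'] pm_sym[OF assms, of y y']
  by (simp add: abs_le_iff)

definition seminorm :: "('e::euclidean_space \<Rightarrow> real) \<Rightarrow> bool" where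
  "seminorm N \<longleftrightarrow> (\<forall>x y. N (x + y) \<le> N x + N y) \<and> (\<forall>a x. N (a *\<^sub>R x) = \<bar>a\<bar> * N x) \<and>
     (\<forall>x. 0 \<le> N x \<and> N x \<le> norm x)"

lemma seminorm_triangle: "seminorm N \<Longrightarrow> N (x + y) \<le> N x + N y"
  and seminorm_scale: "seminorm N \<Longrightarrow> N (a *\<^sub>R x) = \<bar>a\<bar> * N x"
  and seminorm_nonneg: "seminorm N \<Longrightarrow> 0 \<le> N x"
  and seminorm_le: "seminorm N \<Longrightarrow> N x \<le> norm x"
  unfolding seminorm_def by blast+

lemma seminorm_minus: "seminorm N \<Longrightarrow> N (- x) = N x"
  using seminorm_scale[of N "-1" x] by simp

lemma seminorm_lip: "seminorm N \<Longrightarrow> \<bar>N x - N y\<bar> \<le> norm (x - y)"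
  using seminorm_triangle[of N "x - y" y] seminorm_triangle[of N "y - x" x]
    seminorm_le[of N "x - y"] seminorm_le[of N "y - x"]
  by (simp add: norm_minus_commute abs_le_iff)

text \<open>Subadditivity gives \<open>N (j x) \<le> j N x\<close> for natural \<open>j\<close>. A
  strict inequality for some \<open>j \<le> 2^k\<close> would, after adding the other
  \<open>2^k - j\<close> copies of \<open>x\<close>, contradict the exact doubling. For a real
  factor \<open>a\<close>, compare \<open>q a x\<close> with an integer multiple of \<open>x\<close>
  at bounded error and divide by a large \<open>q\<close>.\<close>

lemma additive_homogeneous_bounded:
  fixes N :: "'e::euclidean_space \<Rightarrow> real"
  assumes sub: "\<And>x y. N (x + y) \<le> N x + N y" and two: "\<And>x. N (2 *\<^sub>R x) = 2 * N x"
    and bd: "\<And>x. 0 \<le> N x \<and> N x \<le> norm x" and neg: "\<And>x. N (- x) = N x"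
  shows "seminorm N"
proof -
  have N0: "N 0 = 0" using bd[of 0] by simp
  have lip: "\<bar>N x - N y\<bar> \<le> norm (x - y)" for x y
    using sub[of "x - y" y] sub[of "y - x" x] bd[of "x - y"] bd[of "y - x"]
    by (simp add: norm_minus_commute abs_le_iff)
  have two_pow: "N ((2 ^ k) *\<^sub>R x) = 2 ^ k * N x" for k x
  proof (induction k)
    case (Suc k)
    then show ?case using two[of "(2 ^ k) *\<^sub>R x"] by simp
  qed simp
  have nat_le: "N (real j *\<^sub>R x) \<le> real j * N x" for j x
  proof (induction j)
    case (Suc j)
    have "N (real (Suc j) *\<^sub>R x) \<le> N (real j *\<^sub>R x) + N x"
      using sub[of "real j *\<^sub>R x" x] by (simp add: algebra_simps)
    with Suc show ?case by (simp add: algebra_simps)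
  qed (simp add: N0)
  have nat_eq: "N (real j *\<^sub>R x) = real j * N x" for j x
  proof -
    obtain k where k: "j \<le> 2 ^ k" using less_exp[of j] less_imp_le by blast
    have "2 ^ k * N x = N ((2 ^ k) *\<^sub>R x)" by (simp add: two_pow)
    also have "\<dots> = N (real j *\<^sub>R x + real (2 ^ k - j) *\<^sub>R x)"
      using k by (simp add: scaleR_add_left[symmetric] of_nat_diff)
    also have "\<dots> \<le> N (real j *\<^sub>R x) + real (2 ^ k - j) * N x"
      using sub nat_le[of "2^k - j" x] by (smt (verit))
    finally show ?thesis using nat_le[of j x] k by (simp add: of_nat_diff algebra_simps)
  qed
  have pos: "N (a *\<^sub>R x) = a * N x" if "a \<ge> 0" for a x
  proof (rule ccontr)
    assume ne: "\<not> ?thesis"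
    define e where "e = \<bar>N (a *\<^sub>R x) - a * N x\<bar>"
    have e: "e > 0" using ne by (simp add: e_def)
    have nx: "2 * norm x \<ge> 0" by simp
    obtain q :: nat where q: "2 * norm x / e < real q" using reals_Archimedean2 by blast
    have q0: "real q > 0" using q e nx by (smt (verit) divide_nonneg_pos)
    define j where "j = nat \<lfloor>real q * a\<rfloor>"
    have "real j \<le> real q * a" "real q * a < real j + 1"
      using that unfolding j_def by (auto simp: of_nat_nat)
    then have ja: "\<bar>real q * a - real j\<bar> \<le> 1" by linarith
    have "real q * N (a *\<^sub>R x) = N ((real q * a) *\<^sub>R x)"
      using nat_eq[of q "a *\<^sub>R x"] by simp
    moreover have "\<bar>N ((real q * a) *\<^sub>R x) - real j * N x\<bar> \<le> norm x"
    proof -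
      have "\<bar>N ((real q * a) *\<^sub>R x) - N (real j *\<^sub>R x)\<bar> \<le> norm ((real q * a - real j) *\<^sub>R x)"
        using lip[of "(real q * a) *\<^sub>R x" "real j *\<^sub>R x"] by (simp add: scaleR_diff_left)
      also have "\<dots> \<le> 1 * norm x" unfolding norm_scaleR using ja by (intro mult_right_mono) auto
      finally show ?thesis by (simp add: nat_eq)
    qed
    moreover have "\<bar>(real j - real q * a) * N x\<bar> \<le> norm x"
    proof -
      have "\<bar>(real j - real q * a) * N x\<bar> = \<bar>real q * a - real j\<bar> * N x"
        using bd[of x] by (simp add: abs_mult abs_minus_commute)
      also have "\<dots> \<le> 1 * norm x" using ja bd[of x] by (intro mult_mono) auto
      finally show ?thesis by simp
    qed
    ultimately have "\<bar>real q * N (a *\<^sub>R x) - real q * (a * N x)\<bar> \<le> 2 * norm x"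
      by (simp add: algebra_simps)
    moreover have "\<bar>real q * N (a *\<^sub>R x) - real q * (a * N x)\<bar> = real q * e"
      using q0 unfolding e_def by (simp add: abs_mult flip: right_diff_distrib)
    ultimately have "real q * e \<le> 2 * norm x" by simp
    with q e show False by (simp add: pos_divide_less_eq)
  qed
  have "N (a *\<^sub>R x) = \<bar>a\<bar> * N x" for a x
    using pos[of "\<bar>a\<bar>" x] neg[of "a *\<^sub>R x"] by (cases "a \<ge> 0") auto
  with sub bd show ?thesis unfolding seminorm_def by blast
qed

text \<open>Doubling makes \<open>\<rho> x (x + v)\<close> equal to \<open>2\<^sup>-\<^sup>j \<rho> x (x + 2\<^sup>j v)\<close>, which for large \<open>j\<close> hardly
  depends on \<open>x\<close>; so \<open>\<rho>\<close> is translation invariant.\<close>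

lemma pm_doubling_seminorm:
  assumes r: "pm r" and dbl: "\<And>x v. r x (x + 2 *\<^sub>R v) = 2 * r x (x + v)"
  obtains N where "seminorm N" "\<And>x y. r x y = N (y - x)"
proof -
  have pw: "r x (x + (2 ^ k) *\<^sub>R v) = 2 ^ k * r x (x + v)" for x v k
  proof (induction k)
    case (Suc k)
    then show ?case using dbl[of x "(2 ^ k) *\<^sub>R v"] by simp
  qed simp
  have inv: "r x (x + v) = r y (y + v)" for x y v
  proof (rule ccontr)
    assume ne: "\<not> ?thesis"
    define e where "e = \<bar>r x (x + v) - r y (y + v)\<bar>"
    have e: "e > 0" using ne by (simp add: e_def)
    obtain k :: nat where k: "2 * dist x y / e < 2 ^ k"
      using real_arch_pow[of 2] by auto
    have "\<bar>r x (x + (2 ^ k) *\<^sub>R v) - r y (y + (2 ^ k) *\<^sub>R v)\<bar> \<le> dist x y + dist x y"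
      using pm_lip[OF r, of x "x + (2 ^ k) *\<^sub>R v" y "y + (2 ^ k) *\<^sub>R v"] by simp
    moreover have "\<bar>r x (x + (2 ^ k) *\<^sub>R v) - r y (y + (2 ^ k) *\<^sub>R v)\<bar> = 2 ^ k * e"
      unfolding pw e_def by (simp add: abs_mult flip: right_diff_distrib)
    ultimately show False using k e by (simp add: pos_divide_less_eq)
  qed
  define N where "N v = r 0 v" for v
  have rN: "r x y = N (y - x)" for x y
    using inv[of x "y - x" 0] by (simp add: N_def)
  have "seminorm N"
  proof (rule additive_homogeneous_bounded)
    show "N (x + y) \<le> N x + N y" for x y
      using pm_triangle[OF r, of 0 "x + y" x] rN[of x "x + y"] by (simp add: N_def)
    show "N (2 *\<^sub>R x) = 2 * N x" for x using dbl[of 0 x] by (simp add: N_def)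
    show "0 \<le> N x \<and> N x \<le> norm x" for x
      using pm_nonneg[OF r, of 0 x] pm_le_dist[OF r, of 0 x] by (simp add: N_def)
    show "N (- x) = N x" for x
      using rN[of x 0] pm_sym[OF r, of x 0] by (simp add: N_def)
  qed
  with rN show thesis using that by blast
qed

section \<open>Kernels of seminorms and coordinate subspaces\<close>

lemma subspace_seminorm_kernel: "seminorm N \<Longrightarrow> subspace {x. N x = 0}"
proof -
  assume N: "seminorm N"
  show ?thesis
    unfolding subspace_def
  proof (intro conjI ballI allI)
    show "0 \<in> {x. N x = 0}" using seminorm_scale[OF N, of 0 0] by simp
    show "x + y \<in> {x. N x = 0}" if "x \<in> {x. N x = 0}" "y \<in> {x. N x = 0}" for x y
      using that seminorm_triangle[OF N, of x y] seminorm_nonneg[OF N, of "x + y"] by simp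
    show "c *\<^sub>R x \<in> {x. N x = 0}" if "x \<in> {x. N x = 0}" for c x
      using that seminorm_scale[OF N, of c x] by simp
  qed
qed

text \<open>Steinitz exchange: extend a basis of \<open>Z\<close> by coordinate vectors to a basis
  of the space. The added vectors are independent modulo \<open>Z\<close>, and there are at least
  \<open>n\<close> of them.\<close>

lemma exists_basis_transversal:
  fixes Z :: "'e::euclidean_space set"
  assumes Z: "subspace Z" and d: "dim Z + n \<le> DIM('e)"
  obtains S where "S \<subseteq> Basis" "card S = n" "span S \<inter> Z = {0}"
proof -
  obtain B where B: "B \<subseteq> Z" "independent B" "span B = Z" "card B = dim Z"
    by (metis Z basis_exists span_subspace)
  obtain C where C: "B \<subseteq> C" "C \<subseteq> B \<union> Basis" "independent C" "B \<union> Basis \<subseteq> span C"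
    using maximal_independent_subset_extend[OF _ B(2), of "B \<union> Basis"] by blast
  have finC: "finite C" using C(3) independent_imp_finite by blast
  have "span C = UNIV" using C(4)
    by (metis le_supE span_Basis span_mono span_span top.extremum_unique)
  then have "card C = DIM('e)" using C(3)
    by (metis dim_UNIV dim_span_eq_card_independent)
  then have "n \<le> card (C - B)"
    using d B(4) C(1) finC by (simp add: card_Diff_subset finite_subset)
  then obtain S where S: "S \<subseteq> C - B" "card S = n"
    by (meson obtain_subset_with_card_n)
  have "span S \<inter> span B = {0}"
  proof -
    have "x = 0" if xS: "x \<in> span S" and xB: "x \<in> span B" for x
    proof -
      have "finite S" "finite B" using S C finC finite_subset by (blast, metis C(1) finC finite_subset)
      obtain u where u: "x = (\<Sum>s\<in>S. u s *\<^sub>R s)"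
        using xS unfolding span_finite[OF \<open>finite S\<close>] by blast
      obtain v where v: "x = (\<Sum>b\<in>B. v b *\<^sub>R b)"
        using xB unfolding span_finite[OF \<open>finite B\<close>] by blast
      define w where "w c = (if c \<in> S then u c else if c \<in> B then - v c else 0)" for c
      have disj: "S \<inter> B = {}" using S by blast
      have "(\<Sum>c\<in>S \<union> B. w c *\<^sub>R c) = (\<Sum>c\<in>S. w c *\<^sub>R c) + (\<Sum>c\<in>B. w c *\<^sub>R c)"
        using disj \<open>finite S\<close> \<open>finite B\<close> by (rule_tac sum.union_disjoint) auto
      also have "(\<Sum>c\<in>S. w c *\<^sub>R c) = x" unfolding u by (rule sum.cong) (auto simp: w_def)
      also have "(\<Sum>c\<in>B. w c *\<^sub>R c) = - x"
        unfolding v sum_negf[symmetric] using disj by (intro sum.cong) (auto simp: w_def)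
      finally have s0: "(\<Sum>c\<in>S \<union> B. w c *\<^sub>R c) = 0" by simp
      have "independent (S \<union> B)" using C(1,3) S independent_mono by blast
      then have "w c = 0" if "c \<in> S \<union> B" for c
        using independentD[OF _ _ order_refl s0 that] \<open>finite S\<close> \<open>finite B\<close> by blast
      then have "u c = 0" if "c \<in> S" for c using that unfolding w_def by (metis UnI1)
      then show ?thesis using u by simp
    qed
    then show ?thesis by (auto simp: span_zero)
  qed
  moreover have "S \<subseteq> Basis" using S C(2) by blast
  ultimately show thesis using that S(2) B(3) by blast
qed

lemma norm_cube_le: "x \<in> cbox 0 One \<Longrightarrow> norm x \<le> real DIM('e)" for x :: "'e::euclidean_space"
proof -
  assume x: "x \<in> cbox 0 One"
  have "norm x \<le> (\<Sum>b\<in>Basis. \<bar>x \<bullet> b\<bar>)" by (rule norm_le_l1)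
  also have "\<dots> \<le> (\<Sum>b\<in>(Basis::'e set). 1)"
    using x by (intro sum_mono) (auto simp: mem_box)
  finally show ?thesis by simp
qed

text \<open>Modulo its kernel the seminorm lives on a space of dimension less than \<open>n\<close>.
  There a grid of mesh \<open>1/q\<close> has \<open>O(q^(n-1))\<close> points, while the
  \<open>n\<close>-th power of the covering radius is \<open>O(q^-n)\<close>, so the product tends
  to 0. The factor 8 is 2 times 4: the cover is later used with radius \<open>4 * s\<close>, and
  balls are counted with their diameters.\<close>

lemma seminorm_degenerate_cover:
  fixes N :: "'e::euclidean_space \<Rightarrow> real"
  assumes N: "seminorm N" and rk: "DIM('e) < dim {x. N x = 0} + n" and al: "\<alpha> > 0"
  obtains Y s where "finite Y" "s > 0" "real (card Y) * (8 * s) ^ n \<le> \<alpha>"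
    "\<And>x. x \<in> cbox 0 One \<Longrightarrow> \<exists>y\<in>Y. N (x - y) \<le> s"
proof -
  let ?Z = "{x. N x = 0}"
  define d where "d = DIM('e)"
  have d1: "d \<ge> 1" by (simp add: d_def Suc_leI)
  define Zo where "Zo = {y. \<forall>x\<in>?Z. orthogonal x y}"
  have dimZo: "dim Zo + dim ?Z = d"
    using dim_subspace_orthogonal_to_vectors[OF subspace_seminorm_kernel[OF N] subspace_UNIV]
    by (simp add: Zo_def d_def)
  have subZo: "subspace Zo"
    unfolding Zo_def by (rule subspace_orthogonal_to_vectors)
  obtain B where B: "B \<subseteq> Zo" "pairwise orthogonal B" "\<And>x. x \<in> B \<Longrightarrow> norm x = 1"
     "independent B" "card B = dim Zo" "span B = Zo"
    using orthonormal_basis_subspace[OF subZo] by metis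
  have finB: "finite B" using B(4) independent_imp_finite by blast
  have cB: "card B < n" "card B \<le> d" using B(5) dimZo rk by (auto simp: d_def)
  \<comment> \<open>Splitting \<open>x\<close> along the kernel and its orthogonal complement shows
    that the coordinates with respect to \<open>B\<close> are all that \<open>N\<close>
    sees.\<close>
  have proj: "N (x - (\<Sum>b\<in>B. (x \<bullet> b) *\<^sub>R b)) = 0" for x
  proof -
    obtain y z where yz: "y \<in> span ?Z" "\<And>w. w \<in> span ?Z \<Longrightarrow> orthogonal z w" "x = y + z"
      using orthogonal_subspace_decomp_exists[of ?Z x] by metis
    have spZ: "span ?Z = ?Z" using subspace_seminorm_kernel[OF N] by (simp add: span_eq_iff)
    have "z \<in> Zo" using yz(2) spZ by (auto simp: Zo_def orthogonal_commute)
    then have "z \<in> span B" by (simp add: B(6))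
    then obtain u where u: "z = (\<Sum>b\<in>B. u b *\<^sub>R b)" using finB by (auto simp: span_finite)
    have "z \<bullet> b = u b" if "b \<in> B" for b
    proof -
      have "z \<bullet> b = (\<Sum>c\<in>B. u c * (c \<bullet> b))" unfolding u by (simp add: inner_sum_left)
      also have "\<dots> = (\<Sum>c\<in>B. if c = b then u b else 0)"
        using B(2,3) that
        by (intro sum.cong) (auto simp: pairwise_def orthogonal_def norm_eq_1)
      finally show ?thesis using that finB by simp
    qed
    moreover have "y \<bullet> b = 0" if "b \<in> B" for b
      using that B(1) yz(1) spZ by (auto simp: Zo_def orthogonal_def)
    ultimately have "(\<Sum>b\<in>B. (x \<bullet> b) *\<^sub>R b) = z"
      unfolding u by (intro sum.cong) (auto simp: yz(3) inner_add_left u[symmetric])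
    then show ?thesis using yz spZ by simp
  qed
  obtain q :: nat where q: "(3 * real d) ^ n * (8 * real d) ^ n / \<alpha> < real q"
    using reals_Archimedean2 by blast
  have q0: "real q > 0" using q al by (smt (verit) divide_nonneg_pos of_nat_0_le_iff zero_le_power mult_nonneg_nonneg)
  then have q1: "real q \<ge> 1" by simp
  \<comment> \<open>Rounding moves each of at most \<open>d\<close> coordinates by at most
    \<open>1/q\<close>. The range \<open>R\<close> suffices because points of the unit cube have
    norm at most \<open>d\<close>.\<close>
  define s where "s = real d / real q"
  define R where "R = int (d * q)"
  define Y where "Y = (\<lambda>i. \<Sum>b\<in>B. (real_of_int (i b) / real q) *\<^sub>R b) ` (PiE B (\<lambda>_. {-R..R}))"
  have finP: "finite (PiE B (\<lambda>_. {-R..R}))" using finB by (simp add: finite_PiE)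
  have "card Y \<le> card (PiE B (\<lambda>_. {-R..R}))" unfolding Y_def by (rule card_image_le[OF finP])
  also have "\<dots> = (2 * d * q + 1) ^ card B"
    using finB by (simp add: card_PiE R_def nat_add_distrib mult.assoc nat_mult_distrib)
  also have "\<dots> \<le> (3 * d * q) ^ card B"
    using d1 q1 by (intro power_mono) (auto simp: Suc_le_eq)
  also have "\<dots> \<le> (3 * d * q) ^ (n - 1)"
    using d1 q1 cB by (intro power_increasing) auto
  finally have cY: "real (card Y) \<le> (3 * real d * real q) ^ (n - 1)"
    by (metis (mono_tags, opaque_lifting) of_nat_le_iff of_nat_mult of_nat_numeral of_nat_power)
  have "real (card Y) * (8 * s) ^ n \<le> (3 * real d * real q) ^ (n - 1) * (8 * s) ^ n"
    using cY by (intro mult_right_mono) (auto simp: s_def)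
  also have "\<dots> = (3 * real d) ^ (n - 1) * (8 * real d) ^ n / real q"
  proof -
    have "real q ^ n = real q ^ (n - 1) * real q"
      using cB by (metis Suc_diff_1 gr_implies_not0 neq0_conv power_Suc2)
    then show ?thesis using q0 by (simp add: s_def power_mult_distrib power_divide)
  qed
  also have "\<dots> \<le> (3 * real d) ^ n * (8 * real d) ^ n / real q"
    using d1 q0 by (intro divide_right_mono mult_right_mono power_increasing) auto
  also have "\<dots> \<le> \<alpha>" using q al q0 by (simp add: divide_le_eq divide_less_eq mult.commute less_imp_le)
  finally have card: "real (card Y) * (8 * s) ^ n \<le> \<alpha>" .
  have cover: "\<exists>y\<in>Y. N (x - y) \<le> s" if x: "x \<in> cbox 0 One" for x :: 'e
  proof -
    define i where "i = restrict (\<lambda>b. \<lfloor>real q * (x \<bullet> b)\<rfloor>) B"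
    have nx: "norm x \<le> real d" unfolding d_def by (rule norm_cube_le[OF x])
    have xb: "\<bar>x \<bullet> b\<bar> \<le> real d" if "b \<in> B" for b
      using Cauchy_Schwarz_ineq2[of x b] B(3)[OF that] nx by simp
    have "i \<in> PiE B (\<lambda>_. {-R..R})"
    proof (rule PiE_I)
      fix b assume b: "b \<in> B"
      have "\<bar>real q * (x \<bullet> b)\<bar> \<le> real q * real d"
        using xb[OF b] by (simp add: abs_mult mult_left_mono)
      then have "\<bar>real q * (x \<bullet> b)\<bar> \<le> real_of_int R" by (simp add: R_def mult.commute)
      then have "- R \<le> \<lfloor>real q * (x \<bullet> b)\<rfloor>" "\<lfloor>real q * (x \<bullet> b)\<rfloor> \<le> R" 
        by (auto simp: le_floor_iff floor_le_iff abs_le_iff)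
      then show "i b \<in> {-R..R}" using b by (simp add: i_def)
    qed (simp add: i_def)
    then have yY: "(\<Sum>b\<in>B. (real_of_int (i b) / real q) *\<^sub>R b) \<in> Y" (is "?y \<in> Y")
      unfolding Y_def by blast
    have "N (x - ?y) \<le> N (x - (\<Sum>b\<in>B. (x \<bullet> b) *\<^sub>R b)) + N ((\<Sum>b\<in>B. (x \<bullet> b) *\<^sub>R b) - ?y)"
      using seminorm_triangle[OF N, of "x - (\<Sum>b\<in>B. (x \<bullet> b) *\<^sub>R b)" "(\<Sum>b\<in>B. (x \<bullet> b) *\<^sub>R b) - ?y"] by simp
    also have "\<dots> \<le> norm ((\<Sum>b\<in>B. (x \<bullet> b) *\<^sub>R b) - ?y)" using proj seminorm_le[OF N] by simp
    also have "(\<Sum>b\<in>B. (x \<bullet> b) *\<^sub>R b) - ?y = (\<Sum>b\<in>B. (x \<bullet> b - real_of_int (i b) / real q) *\<^sub>R b)"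
      by (simp add: sum_subtractf scaleR_diff_left)
    also have "norm \<dots> \<le> (\<Sum>b\<in>B. 1 / real q)"
    proof (rule sum_norm_le)
      fix b assume b: "b \<in> B"
      have "\<bar>real q * (x \<bullet> b) - real_of_int (i b)\<bar> \<le> 1" using b unfolding i_def by (simp; linarith)
      moreover have "x \<bullet> b - real_of_int (i b) / real q = (real q * (x \<bullet> b) - real_of_int (i b)) / real q"
        using q0 by (simp add: field_simps)
      ultimately have "\<bar>x \<bullet> b - real_of_int (i b) / real q\<bar> \<le> 1 / real q"
        using q0 by (simp add: divide_right_mono)
      then show "norm ((x \<bullet> b - real_of_int (i b) / real q) *\<^sub>R b) \<le> 1 / real q"
        using B(3)[OF b] by simp
    qed
    also have "\<dots> \<le> s" using cB q0 by (simp add: s_def divide_right_mono)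
    finally show ?thesis using yY by blast
  qed
  show thesis
    using that[of Y s] finP card cover d1 q0 by (auto simp: Y_def s_def)
qed

section \<open>Flat scales and the dichotomy for dyadic cells\<close>

definition cell :: "nat \<Rightarrow> 'e::euclidean_space \<Rightarrow> 'e set" where
  "cell k c = cbox c (c + (1/2)^k *\<^sub>R One)"

definition dq :: "('e::euclidean_space \<Rightarrow> 'e \<Rightarrow> real) \<Rightarrow> nat \<Rightarrow> 'e \<Rightarrow> 'e \<Rightarrow> real" where
  "dq r k x v = 2 ^ k * r x (x + (1/2)^k *\<^sub>R v)"

text \<open>Base points and vectors range over a window of radius \<open>j\<close> in units of the
  cell side. One parameter controls both the window and the error, so that flatness with
  \<open>j\<close> tending to infinity becomes exact doubling in the limit.\<close>

definition flat :: "nat \<Rightarrow> ('e::euclidean_space \<Rightarrow> 'e \<Rightarrow> real) \<Rightarrow> nat \<Rightarrow> 'e \<Rightarrow> bool" where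
  "flat j r k c \<longleftrightarrow> (\<forall>w v. norm w \<le> real j \<and> norm v \<le> real j \<longrightarrow>
     \<bar>dq r k (c + (1/2)^k *\<^sub>R w) v - dq r (Suc k) (c + (1/2)^k *\<^sub>R w) v\<bar> \<le> 1 / real j)"

text \<open>The form in which small content is carried: \<open>2 * s\<close> bounds the diameter of
  the covering balls in units of the side, so the image of the cell has \<open>n\<close>-dimensional
  content at most \<alpha> times the \<open>n\<close>-th power of the side.\<close>

definition thin :: "real \<Rightarrow> nat \<Rightarrow> ('e::euclidean_space \<Rightarrow> 'e \<Rightarrow> real) \<Rightarrow> nat \<Rightarrow> 'e \<Rightarrow> bool" where
  "thin \<alpha> n r k c \<longleftrightarrow> (\<exists>Y s. finite Y \<and> s > 0 \<and> real (card Y) * (2 * s) ^ n \<le> \<alpha> \<and>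
     (\<forall>x\<in>cell k c. \<exists>y\<in>Y. r x y \<le> s * (1/2)^k))"

text \<open>Two points are compared at the level where their distance is between \<open>d\<close>
  and \<open>2 d\<close> cell sides, \<open>d\<close> being the dimension. Their difference then has
  either a component in \<open>span S\<close> of length at least \<open>d / 2\<close>, which lies in
  the annulus, or a component of that length in the other coordinates.\<close>

definition annulus :: "'e::euclidean_space set \<Rightarrow> 'e set" where
  "annulus S = {v \<in> span S. real DIM('e) / 2 \<le> norm v \<and> norm v \<le> 2 * real DIM('e)}"

definition steep :: "real \<Rightarrow> 'e::euclidean_space set \<Rightarrow> ('e \<Rightarrow> 'e \<Rightarrow> real) \<Rightarrow> nat \<Rightarrow> 'e \<Rightarrow> bool" where
  "steep e S r k c \<longleftrightarrow> (\<forall>x\<in>cell k c. \<forall>v\<in>annulus S. e \<le> dq r k x v)"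

text \<open>The blow-up at \<open>c\<close> that turns the cell of level \<open>k\<close> into the
  unit cube. It removes scale and position, so that compactness can be applied.\<close>

definition rescale :: "nat \<Rightarrow> 'e::euclidean_space \<Rightarrow> ('e \<Rightarrow> 'e \<Rightarrow> real) \<Rightarrow> 'e \<Rightarrow> 'e \<Rightarrow> real" where
  "rescale k c r x y = 2 ^ k * r (c + (1/2)^k *\<^sub>R x) (c + (1/2)^k *\<^sub>R y)"

lemma pm_rescale: "pm r \<Longrightarrow> pm (rescale k c r)"
proof -
  assume r: "pm r"
  have d: "dist (c + (1/2)^k *\<^sub>R x) (c + (1/2)^k *\<^sub>R y) = (1/2)^k * dist x y" for x y
    by (simp add: dist_norm scaleR_diff_right[symmetric])
  show ?thesis
    unfolding pm_def rescale_def
  proof (intro conjI allI)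
    fix x y z
    show "0 \<le> 2 ^ k * r (c + (1/2)^k *\<^sub>R x) (c + (1/2)^k *\<^sub>R y)" using pm_nonneg[OF r] by simp
    show "2 ^ k * r (c + (1/2)^k *\<^sub>R x) (c + (1/2)^k *\<^sub>R y) = 2 ^ k * r (c + (1/2)^k *\<^sub>R y) (c + (1/2)^k *\<^sub>R x)"
      using pm_sym[OF r] by simp
    show "2 ^ k * r (c + (1/2)^k *\<^sub>R x) (c + (1/2)^k *\<^sub>R z) \<le> 2 ^ k * r (c + (1/2)^k *\<^sub>R x) (c + (1/2)^k *\<^sub>R y) +
        2 ^ k * r (c + (1/2)^k *\<^sub>R y) (c + (1/2)^k *\<^sub>R z)"
      using pm_triangle[OF r] by (simp add: distrib_left[symmetric])
    have "2 ^ k * r (c + (1/2)^k *\<^sub>R x) (c + (1/2)^k *\<^sub>R y) \<le> 2 ^ k * ((1/2)^k * dist x y)"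
      using pm_le_dist[OF r, of "c + (1/2)^k *\<^sub>R x" "c + (1/2)^k *\<^sub>R y"] d by (intro mult_left_mono) auto
    then show "2 ^ k * r (c + (1/2)^k *\<^sub>R x) (c + (1/2)^k *\<^sub>R y) \<le> dist x y"
      by (simp add: power_one_over)
  qed
qed

lemma dq_rescale: "dq r k (c + (1/2)^k *\<^sub>R w) v = rescale k c r w (w + v)"
  by (simp add: dq_def rescale_def algebra_simps)

lemma dq_Suc_rescale: "dq r (Suc k) (c + (1/2)^k *\<^sub>R w) v = 2 * rescale k c r w (w + (1/2) *\<^sub>R v)"
  by (simp add: dq_def rescale_def algebra_simps)

lemma flat_rescale:
  "flat j r k c \<longleftrightarrow> (\<forall>w v. norm w \<le> real j \<and> norm v \<le> real j \<longrightarrow>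
     \<bar>rescale k c r w (w + v) - 2 * rescale k c r w (w + (1/2) *\<^sub>R v)\<bar> \<le> 1 / real j)"
  unfolding flat_def dq_rescale dq_Suc_rescale ..

lemma flat_mono:
  assumes "flat j r k c" "i \<le> j" "0 < i" shows "flat i r k c"
proof -
  have "1 / real j \<le> 1 / real i" using assms by (intro divide_left_mono) auto
  moreover have "real i \<le> real j" using assms by simp
  ultimately show ?thesis using assms(1) unfolding flat_def by (meson order_trans)
qed

lemma mem_cell_rescale: "x \<in> cell k c \<longleftrightarrow> 2 ^ k *\<^sub>R (x - c) \<in> cbox 0 One"
proof -
  have "x \<bullet> b \<le> c \<bullet> b + (1/2)^k \<longleftrightarrow> 2 ^ k * (x \<bullet> b - c \<bullet> b) \<le> 1" for b
  proof -
    have "x \<bullet> b \<le> c \<bullet> b + (1/2)^k \<longleftrightarrow> x \<bullet> b - c \<bullet> b \<le> 1 / 2^k" by (auto simp: power_one_over)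
    also have "\<dots> \<longleftrightarrow> 2 ^ k * (x \<bullet> b - c \<bullet> b) \<le> 1" by (simp add: pos_le_divide_eq mult.commute)
    finally show ?thesis .
  qed
  moreover have "c \<bullet> b \<le> x \<bullet> b \<longleftrightarrow> 0 \<le> 2 ^ k * (x \<bullet> b - c \<bullet> b)" for b
    by (metis diff_ge_0_iff_ge mult_le_cancel_left_pos mult_zero_right zero_less_numeral zero_less_power)
  ultimately show ?thesis
    unfolding cell_def mem_box by (simp add: inner_simps)
qed

lemma rescale_inverse: "c + (1/2)^k *\<^sub>R (2 ^ k *\<^sub>R (x - c)) = (x::'a::real_vector)"
proof -
  have eq: "(1/2::real)^k * 2^k = 1" by (simp add: power_one_over)
  show ?thesis unfolding scaleR_scaleR eq by simp
qed

lemma compact_finite_net: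
  fixes A :: "'a::metric_space set"
  assumes "compact A" "e > 0"
  obtains F where "finite F" "F \<subseteq> A" "\<And>x. x \<in> A \<Longrightarrow> \<exists>y\<in>F. dist x y < e"
proof -
  obtain F where F: "finite F" "F \<subseteq> A" "A \<subseteq> (\<Union>x\<in>F. ball x e)"
    using seq_compact_imp_totally_bounded[OF assms(1)[unfolded compact_eq_seq_compact_metric], rule_format, OF assms(2)]
    by metis
  show thesis
  proof (rule that[OF F(1,2)])
    fix x assume "x \<in> A"
    then obtain y where "y \<in> F" "x \<in> ball y e" using F(3) by blast
    then show "\<exists>y\<in>F. dist x y < e" by (auto simp: dist_commute)
  qed
qed

lemma compact_annulus: "compact (annulus S)"
proof -
  have "annulus S = span S \<inter> (cball 0 (2 * real DIM('a)) - ball 0 (real DIM('a) / 2))"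
    by (auto simp: annulus_def)
  then show ?thesis by (auto intro!: closed_Int_compact compact_diff closed_subspace)
qed

text \<open>Each axiom of a pseudometric involves finitely many values and so passes to a cluster
  point. The windows exhaust the space while the errors tend to 0, so the limit doubles exactly and
  is a seminorm.\<close>

lemma limit_rescaled_pm:
  fixes \<rho> :: "nat \<Rightarrow> 'e::euclidean_space \<Rightarrow> 'e \<Rightarrow> real"
  assumes pm: "\<And>j. pm (\<rho> j)"
    and fl: "\<And>j w v. norm w \<le> real (Suc j) \<Longrightarrow> norm v \<le> real (Suc j) \<Longrightarrow>
      \<bar>\<rho> j w (w + v) - 2 * \<rho> j w (w + (1/2) *\<^sub>R v)\<bar> \<le> 1 / real (Suc j)"
  shows "\<exists>N. seminorm N \<and> (\<forall>F e n. finite F \<longrightarrow> e > 0 \<longrightarrow>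
    (\<exists>j\<ge>n. \<forall>(x, y)\<in>F. \<bar>\<rho> j x y - N (y - x)\<bar> < e))"
proof -
  have "0 \<le> case_prod (\<rho> j) z \<and> case_prod (\<rho> j) z \<le> dist (fst z) (snd z)" for j z
    using pm_nonneg[OF pm] pm_le_dist[OF pm] by (auto split: prod.split)
  then obtain h where h: "\<And>F e n. finite F \<Longrightarrow> e > 0 \<Longrightarrow> \<exists>j\<ge>n. \<forall>z\<in>F. \<bar>case_prod (\<rho> j) z - h z\<bar> < e"
    using cluster_point_bounded_functions[of "\<lambda>j. case_prod (\<rho> j)" "\<lambda>z. dist (fst z) (snd z)"] by metis
  define r where "r = curry h"
  have cl: "\<exists>j\<ge>n. \<forall>(x, y)\<in>F. \<bar>\<rho> j x y - r x y\<bar> < e" if "finite F" "e > 0" for F e n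
    using h[OF that, of n] by (auto simp: r_def split: prod.splits)
  have pmr: "pm r"
    unfolding pm_def
  proof (intro conjI allI)
    fix x y z :: 'e
    show "0 \<le> r x y"
    proof (rule field_le_epsilon)
      fix e :: real assume "e > 0"
      with cl[of "{(x, y)}" e 0] obtain j where "\<bar>\<rho> j x y - r x y\<bar> < e" by auto
      with pm_nonneg[OF pm, of j x y] show "0 \<le> r x y + e" by linarith
    qed
    show "r x y \<le> dist x y"
    proof (rule field_le_epsilon)
      fix e :: real assume "e > 0"
      with cl[of "{(x, y)}" e 0] obtain j where "\<bar>\<rho> j x y - r x y\<bar> < e" by auto
      with pm_le_dist[OF pm, of j x y] show "r x y \<le> dist x y + e" by linarith
    qed
    show "r x z \<le> r x y + r y z"
    proof (rule field_le_epsilon)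
      fix e :: real assume "e > 0"
      with cl[of "{(x, z), (x, y), (y, z)}" "e/3" 0] obtain j where
        "\<bar>\<rho> j x z - r x z\<bar> < e/3" "\<bar>\<rho> j x y - r x y\<bar> < e/3" "\<bar>\<rho> j y z - r y z\<bar> < e/3" by auto
      with pm_triangle[OF pm, of j x z y] show "r x z \<le> r x y + r y z + e" by linarith
    qed
    have le: "r x y \<le> r y x" for x y
    proof (rule field_le_epsilon)
      fix e :: real assume "e > 0"
      with cl[of "{(x, y), (y, x)}" "e/2" 0] obtain j where
        "\<bar>\<rho> j x y - r x y\<bar> < e/2" "\<bar>\<rho> j y x - r y x\<bar> < e/2" by auto
      with pm_sym[OF pm, of j x y] show "r x y \<le> r y x + e" by linarith
    qed
    show "r x y = r y x" using le[of x y] le[of y x] by simp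
  qed
  have dbl: "r x (x + 2 *\<^sub>R v) = 2 * r x (x + v)" for x v
  proof -
    have "\<bar>r x (x + 2 *\<^sub>R v) - 2 * r x (x + v)\<bar> \<le> 0"
    proof (rule field_le_epsilon)
      fix e :: real assume e: "e > 0"
      \<comment> \<open>Beyond \<open>n\<close> the window contains \<open>x\<close> and
        \<open>2 v\<close>, and the error is at most \<open>e / 4\<close>.\<close>
      obtain n :: nat where n: "norm x + norm (2 *\<^sub>R v) + 4 / e < real n" using reals_Archimedean2 by blast
      obtain j where j: "j \<ge> n" "\<bar>\<rho> j x (x + 2 *\<^sub>R v) - r x (x + 2 *\<^sub>R v)\<bar> < e/4" "\<bar>\<rho> j x (x + v) - r x (x + v)\<bar> < e/4"
        using cl[of "{(x, x + 2 *\<^sub>R v), (x, x + v)}" "e/4" n] e by auto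
      have "4 / e > 0" using e by simp
      then have b: "norm x \<le> real (Suc j)" "norm (2 *\<^sub>R v) \<le> real (Suc j)" "4 / e < real (Suc j)"
        using n j(1) norm_ge_zero[of x] norm_ge_zero[of "2 *\<^sub>R v"] by linarith+
      have "\<bar>\<rho> j x (x + 2 *\<^sub>R v) - 2 * \<rho> j x (x + v)\<bar> \<le> 1 / real (Suc j)"
        using fl[OF b(1,2)] by simp
      also have "1 / real (Suc j) \<le> e / 4" using b(3) e by (simp add: field_simps)
      finally show "\<bar>r x (x + 2 *\<^sub>R v) - 2 * r x (x + v)\<bar> \<le> 0 + e" using j(2,3) by linarith
    qed
    then show ?thesis by simp
  qed
  obtain N where N: "seminorm N" "\<And>x y. r x y = N (y - x)"
    using pm_doubling_seminorm[OF pmr dbl] by blast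
  show ?thesis using N(1) cl unfolding N(2) by blast
qed

text \<open>By compactness: along a sequence of counterexamples the rescaled metrics accumulate at a
  seminorm, which either is positive on a coordinate subspace of dimension \<open>n\<close> or has rank
  less than \<open>n\<close>.\<close>

proposition flat_thick_steep:
  fixes n :: nat
  assumes al: "\<alpha> > 0"
  obtains j where "j > 0" "\<And>r k (c::'e::euclidean_space). \<lbrakk>pm r; flat j r k c; \<not> thin \<alpha> n r k c\<rbrakk> \<Longrightarrow>
     \<exists>S\<subseteq>Basis. card S = n \<and> steep (1 / real j) S r k c"
proof (rule ccontr)
  assume neg: "\<not> thesis"
  have "\<exists>r k. \<exists>c::'e. pm r \<and> flat (Suc j) r k c \<and> \<not> thin \<alpha> n r k c \<and>
      \<not> (\<exists>S\<subseteq>Basis. card S = n \<and> steep (1 / real (Suc j)) S r k c)" for j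
    using neg that[of "Suc j"] by blast
  then obtain R K and C :: "nat \<Rightarrow> 'e" where ex:
    "\<And>j. pm (R j)" "\<And>j. flat (Suc j) (R j) (K j) (C j)" "\<And>j. \<not> thin \<alpha> n (R j) (K j) (C j)"
    "\<And>j S. S \<subseteq> Basis \<Longrightarrow> card S = n \<Longrightarrow> \<not> steep (1 / real (Suc j)) S (R j) (K j) (C j)"
    by metis
  define \<rho> where "\<rho> j = rescale (K j) (C j) (R j)" for j
  have pm: "pm (\<rho> j)" for j unfolding \<rho>_def by (rule pm_rescale[OF ex(1)])
  have fl: "\<bar>\<rho> j w (w + v) - 2 * \<rho> j w (w + (1/2) *\<^sub>R v)\<bar> \<le> 1 / real (Suc j)"
    if "norm w \<le> real (Suc j)" "norm v \<le> real (Suc j)" for j w v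
    using ex(2)[of j] that unfolding flat_rescale \<rho>_def by blast
  have "\<exists>N. seminorm N \<and> (\<forall>F e n. finite F \<longrightarrow> e > 0 \<longrightarrow>
    (\<exists>j\<ge>n. \<forall>(x, y)\<in>F. \<bar>\<rho> j x y - N (y - x)\<bar> < e))"
    by (rule limit_rescaled_pm) (fact pm, fact fl)
  then obtain N where N: "seminorm N" and cl': "\<forall>F e n. finite F \<longrightarrow> e > 0 \<longrightarrow>
    (\<exists>j\<ge>n. \<forall>(x, y)\<in>F. \<bar>\<rho> j x y - N (y - x)\<bar> < e)" by blast
  note cl = cl'[rule_format]
  show False
  proof (cases "dim {x. N x = 0} + n \<le> DIM('e)")
    case True
    obtain S :: "'e set" where S: "S \<subseteq> Basis" "card S = n" "span S \<inter> {x. N x = 0} = {0}"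
      using exists_basis_transversal[OF subspace_seminorm_kernel[OF N] True] by metis
    have contN: "continuous_on UNIV N"
      unfolding continuous_on_iff
    proof (intro ballI allI impI)
      fix x e assume "(e::real) > 0"
      then show "\<exists>d>0. \<forall>x'\<in>UNIV. dist x' x < d \<longrightarrow> dist (N x') (N x) < e"
        using seminorm_lip[OF N] by (intro exI[of _ e]) (metis dist_norm dist_real_def le_less_trans)
    qed
    obtain c where c: "c > 0" "\<And>v. v \<in> annulus S \<Longrightarrow> c \<le> N v"
    proof (cases "annulus S = {}")
      case True
      \<comment> \<open>This is the case \<open>n = 0\<close>.\<close>
      then show thesis using that[of 1] by auto
    next
      case False
      obtain v0 where v0: "v0 \<in> annulus S" "\<And>v. v \<in> annulus S \<Longrightarrow> N v0 \<le> N v"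
        using continuous_attains_inf[OF compact_annulus False continuous_on_subset[OF contN]] by blast
      have "v0 \<noteq> 0" using v0(1) by (auto simp: annulus_def)
      then have "N v0 \<noteq> 0" using S(3) v0(1) by (auto simp: annulus_def)
      then show thesis using that[of "N v0"] v0(2) seminorm_nonneg[OF N, of v0] by simp
    qed
    \<comment> \<open>Moving base point and vector to the nets costs at most \<open>3 e\<close>, the
      cluster point another \<open>e\<close>; at least \<open>c / 2\<close> remains.\<close>
    define e where "e = c / 8"
    have e: "e > 0" using c by (simp add: e_def)
    obtain X where X: "finite X" "X \<subseteq> cbox 0 (One::'e)" "\<And>x. x \<in> cbox 0 One \<Longrightarrow> \<exists>y\<in>X. dist x y < e"
      using compact_finite_net[OF compact_cbox e] by metis
    obtain A where A: "finite A" "A \<subseteq> annulus S" "\<And>x. x \<in> annulus S \<Longrightarrow> \<exists>y\<in>A. dist x y < e"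
      using compact_finite_net[OF compact_annulus e] by metis
    obtain m :: nat where m: "2 / c < real m" using reals_Archimedean2 by blast
    have "finite ((\<lambda>(x, v). (x, x + v)) ` (X \<times> A))" using X A by simp
    from cl[OF this e, of m] obtain j where j: "j \<ge> m"
      "\<And>x v. x \<in> X \<Longrightarrow> v \<in> A \<Longrightarrow> \<bar>\<rho> j x (x + v) - N v\<bar> < e" by force
    have "steep (1 / real (Suc j)) S (R j) (K j) (C j)"
      unfolding steep_def
    proof (intro ballI)
      fix z v assume z: "z \<in> cell (K j) (C j)" and v: "v \<in> annulus S"
      define x where "x = 2 ^ K j *\<^sub>R (z - C j)"
      have xc: "x \<in> cbox 0 One" using z by (simp add: mem_cell_rescale x_def)
      have zx: "z = C j + (1/2) ^ K j *\<^sub>R x" unfolding x_def by (rule rescale_inverse[symmetric])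
      obtain x' where x': "x' \<in> X" "dist x x' < e" using X(3)[OF xc] by blast
      obtain v' where v': "v' \<in> A" "dist v v' < e" using A(3)[OF v] by blast
      have "dist (x + v) (x' + v') \<le> dist x x' + dist v v'" by (rule dist_triangle_add)
      then have "\<bar>\<rho> j x (x + v) - \<rho> j x' (x' + v')\<bar> \<le> 3 * e"
        using pm_lip[OF pm, of j x "x + v" x' "x' + v'"] x' v' by linarith
      moreover have "c \<le> N v'" using v' A c by blast
      moreover have "\<bar>\<rho> j x' (x' + v') - N v'\<bar> < e" using j x' v' by blast
      ultimately have "c / 2 \<le> \<rho> j x (x + v)" unfolding e_def by linarith
      moreover have "1 / real (Suc j) \<le> c / 2"
      proof -
        have "2 / c < real (Suc j)" using m j(1) by linarith
        then show ?thesis using c(1) by (simp add: field_simps)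
      qed
      ultimately show "1 / real (Suc j) \<le> dq (R j) (K j) z v"
        unfolding zx dq_rescale \<rho>_def by linarith
    qed
    then show False using ex(4) S by blast
  next
    case False
    then have rk: "DIM('e) < dim {x. N x = 0} + n" by simp
    obtain Y s where Y: "finite Y" "s > 0" "real (card Y) * (8 * s) ^ n \<le> \<alpha>"
      "\<And>x. x \<in> cbox 0 One \<Longrightarrow> \<exists>y\<in>Y. N (x - y) \<le> s"
      using seminorm_degenerate_cover[OF N rk al] by metis
    obtain X where X: "finite X" "X \<subseteq> cbox 0 (One::'e)" "\<And>x. x \<in> cbox 0 One \<Longrightarrow> \<exists>y\<in>X. dist x y < s"
      using compact_finite_net[OF compact_cbox Y(2)] by metis
    have "finite (X \<times> Y)" using X Y by simp
    from cl[OF this Y(2), of 0] obtain j where j: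
      "\<And>x y. x \<in> X \<Longrightarrow> y \<in> Y \<Longrightarrow> \<bar>\<rho> j x y - N (y - x)\<bar> < s" by force
    define Y' where "Y' = (\<lambda>y. C j + (1/2) ^ K j *\<^sub>R y) ` Y"
    have "thin \<alpha> n (R j) (K j) (C j)"
      unfolding thin_def
    proof (intro exI conjI ballI)
      show "finite Y'" using Y by (simp add: Y'_def)
      \<comment> \<open>The cover for \<open>N\<close>, the cluster point and the net
        \<open>X\<close> contribute \<open>s\<close> each, which fits into
        \<open>4 * s\<close>.\<close>
      show "4 * s > 0" using Y by simp
      have "real (card Y') * (2 * (4 * s)) ^ n \<le> real (card Y) * (8 * s) ^ n"
        using Y(1,2) card_image_le[of Y] by (simp add: Y'_def mult_right_mono)
      then show "real (card Y') * (2 * (4 * s)) ^ n \<le> \<alpha>" using Y(3) by linarith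
      fix z assume z: "z \<in> cell (K j) (C j)"
      define x where "x = 2 ^ K j *\<^sub>R (z - C j)"
      have xc: "x \<in> cbox 0 One" using z by (simp add: mem_cell_rescale x_def)
      have zx: "z = C j + (1/2) ^ K j *\<^sub>R x" unfolding x_def by (rule rescale_inverse[symmetric])
      obtain x' where x': "x' \<in> X" "dist x x' < s" using X(3)[OF xc] by blast
      obtain y where y: "y \<in> Y" "N (x' - y) \<le> s" using Y(4) x'(1) X(2) by blast
      have "\<rho> j x y \<le> \<rho> j x' y + s" using pm_lip[OF pm, of j x y x' y] x'(2) by simp
      also have "\<rho> j x' y \<le> N (y - x') + s" using j[OF x'(1) y(1)] by linarith
      also have "N (y - x') = N (x' - y)" using seminorm_minus[OF N, of "x' - y"] by simp
      finally have "\<rho> j x y \<le> 4 * s" using y(2) Y(2) by linarith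
      then have "R j z (C j + (1/2) ^ K j *\<^sub>R y) \<le> 4 * s * (1/2) ^ K j"
        unfolding \<rho>_def rescale_def zx by (simp add: power_one_over field_simps)
      then show "\<exists>y\<in>Y'. R j z y \<le> 4 * s * (1/2) ^ K j" using y(1) by (auto simp: Y'_def)
    qed
    then show False using ex(3) by blast
  qed
qed

text \<open>Doubling the vector \<open>J\<close> times replaces the quotient along \<open>v\<close>
  by \<open>2^-J\<close> times the one along \<open>2^J v\<close>; the errors from flatness form a
  geometric series bounded by \<open>1/j\<close>. For the long vector a shift of the base point
  costs at most twice the shift, and division by \<open>2^J\<close> makes this small.\<close>

lemma flat_translation_insensitive:
  assumes r: "pm r" and fl: "flat j r k c" and v: "2 ^ J * norm v \<le> real j"
    and w: "norm w \<le> real j" "norm w' \<le> real j"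
  shows "\<bar>dq r k (c + (1/2)^k *\<^sub>R w) v - dq r k (c + (1/2)^k *\<^sub>R w') v\<bar> \<le> 2 / real j + 2 * norm (w - w') / 2 ^ J"
proof -
  define \<rho> where "\<rho> = rescale k c r"
  have pm: "pm \<rho>" using pm_rescale[OF r] by (simp add: \<rho>_def)
  have step: "\<bar>\<rho> w (w + v) - \<rho> w (w + (2 ^ i) *\<^sub>R v) / 2 ^ i\<bar> \<le> 1 / real j * (1 - 1 / 2 ^ i)"
    if "i \<le> J" "norm w \<le> real j" for i w
    using that
  proof (induction i)
    case (Suc i)
    have "2 ^ Suc i * norm v \<le> 2 ^ J * norm v" using Suc.prems by (intro mult_right_mono power_increasing) auto
    then have "norm ((2 ^ Suc i) *\<^sub>R v) \<le> real j" using v by simp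
    then have "\<bar>\<rho> w (w + (2 ^ Suc i) *\<^sub>R v) - 2 * \<rho> w (w + (2 ^ i) *\<^sub>R v)\<bar> \<le> 1 / real j"
      using fl Suc.prems unfolding flat_rescale \<rho>_def by fastforce
    then have "\<bar>\<rho> w (w + (2 ^ Suc i) *\<^sub>R v) - 2 * \<rho> w (w + (2 ^ i) *\<^sub>R v)\<bar> / 2 ^ Suc i \<le> 1 / real j / 2 ^ Suc i"
      by (rule divide_right_mono) simp
    moreover have "\<bar>\<rho> w (w + (2 ^ Suc i) *\<^sub>R v) - 2 * \<rho> w (w + (2 ^ i) *\<^sub>R v)\<bar> / 2 ^ Suc i =
       \<bar>\<rho> w (w + (2 ^ i) *\<^sub>R v) / 2 ^ i - \<rho> w (w + (2 ^ Suc i) *\<^sub>R v) / 2 ^ Suc i\<bar>"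
    proof -
      have "\<bar>\<rho> w (w + (2 ^ Suc i) *\<^sub>R v) - 2 * \<rho> w (w + (2 ^ i) *\<^sub>R v)\<bar> / 2 ^ Suc i =
        \<bar>(\<rho> w (w + (2 ^ Suc i) *\<^sub>R v) - 2 * \<rho> w (w + (2 ^ i) *\<^sub>R v)) / 2 ^ Suc i\<bar>" by (simp add: abs_divide)
      also have "(\<rho> w (w + (2 ^ Suc i) *\<^sub>R v) - 2 * \<rho> w (w + (2 ^ i) *\<^sub>R v)) / 2 ^ Suc i =
        \<rho> w (w + (2 ^ Suc i) *\<^sub>R v) / 2 ^ Suc i - \<rho> w (w + (2 ^ i) *\<^sub>R v) / 2 ^ i"
        by (simp add: diff_divide_distrib)
      finally show ?thesis by (simp add: abs_minus_commute)
    qed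
    moreover have "1 / real j * (1 - 1 / 2 ^ Suc i) = 1 / real j * (1 - 1 / 2 ^ i) + 1 / real j / 2 ^ Suc i"
      by (cases "j = 0") (simp_all add: field_simps)
    ultimately show ?case using Suc by linarith
  qed simp
  have step': "\<bar>\<rho> w (w + v) - \<rho> w (w + (2 ^ J) *\<^sub>R v) / 2 ^ J\<bar> \<le> 1 / real j" if "norm w \<le> real j" for w
  proof -
    have "1 / real j * (1 - 1 / 2 ^ J) \<le> 1 / real j * 1" by (intro mult_left_mono) auto
    then show ?thesis using step[OF order_refl that] by linarith
  qed
  have "\<bar>\<rho> w (w + (2 ^ J) *\<^sub>R v) - \<rho> w' (w' + (2 ^ J) *\<^sub>R v)\<bar> \<le> 2 * norm (w - w')"
    using pm_lip[OF pm, of w "w + (2 ^ J) *\<^sub>R v" w' "w' + (2 ^ J) *\<^sub>R v"] by (simp add: dist_norm)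
  then have "\<bar>\<rho> w (w + (2 ^ J) *\<^sub>R v) - \<rho> w' (w' + (2 ^ J) *\<^sub>R v)\<bar> / 2 ^ J \<le> 2 * norm (w - w') / 2 ^ J"
    by (rule divide_right_mono) simp
  moreover have "\<bar>\<rho> w (w + (2 ^ J) *\<^sub>R v) - \<rho> w' (w' + (2 ^ J) *\<^sub>R v)\<bar> / 2 ^ J =
    \<bar>\<rho> w (w + (2 ^ J) *\<^sub>R v) / 2 ^ J - \<rho> w' (w' + (2 ^ J) *\<^sub>R v) / 2 ^ J\<bar>"
    by (simp add: diff_divide_distrib[symmetric] abs_divide)
  ultimately have "\<bar>\<rho> w (w + v) - \<rho> w' (w' + v)\<bar> \<le> 2 / real j + 2 * norm (w - w') / 2 ^ J"
    using step'[OF w(1)] step'[OF w(2)] by linarith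
  then show ?thesis unfolding dq_rescale \<rho>_def .
qed

subsection \<open>Energy of difference quotients\<close>

text \<open>A dyadic cell is represented by its lower corner, computed from any point of the
  half-open cell. Properties of cells thus become predicates of \<open>corner k p\<close>.\<close>

definition corner :: "nat \<Rightarrow> 'e::euclidean_space \<Rightarrow> 'e" where
  "corner k p = (\<Sum>b\<in>Basis. (real_of_int \<lfloor>2 ^ k * (p \<bullet> b)\<rfloor> / 2 ^ k) *\<^sub>R b)"

text \<open>Half-open, as the cells given by \<open>corner\<close> are, so that it is a disjoint
  union of them at every level. The missing faces have measure zero.\<close>

definition half_cube :: "'e::euclidean_space set" where
  "half_cube = {p. \<forall>b\<in>Basis. 0 \<le> p \<bullet> b \<and> p \<bullet> b < 1}"

lemma corner_inner: "b \<in> Basis \<Longrightarrow> corner k p \<bullet> b = real_of_int \<lfloor>2 ^ k * (p \<bullet> b)\<rfloor> / 2 ^ k"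
  unfolding corner_def by simp

lemma corner_eq_iff: "corner k p = corner k q \<longleftrightarrow> (\<forall>b\<in>Basis. \<lfloor>2 ^ k * (p \<bullet> b)\<rfloor> = \<lfloor>2 ^ k * (q \<bullet> b)\<rfloor>)"
proof -
  have "corner k p = corner k q \<longleftrightarrow> (\<forall>b\<in>Basis. corner k p \<bullet> b = corner k q \<bullet> b)"
    by (auto intro: euclidean_eqI)
  then show ?thesis by (simp add: corner_inner)
qed

lemma floor_dyadic_div: "\<lfloor>2 ^ k * x\<rfloor> = \<lfloor>2 ^ (k + i) * x\<rfloor> div 2 ^ i" for x :: real
proof -
  have "\<lfloor>2 ^ (k + i) * x / real_of_int (2 ^ i)\<rfloor> = \<lfloor>2 ^ (k + i) * x\<rfloor> div 2 ^ i"
    by (rule floor_divide_real_eq_div) simp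
  then show ?thesis by (simp add: power_add)
qed

lemma corner_eq_mono: "corner (k + i) p = corner (k + i) q \<Longrightarrow> corner k p = corner k q"
  unfolding corner_eq_iff by (metis floor_dyadic_div)

lemma measurable_floor_dyadic [measurable]: "(\<lambda>p::'e::euclidean_space. \<lfloor>2 ^ k * (p \<bullet> b)\<rfloor>) \<in> measurable borel (count_space UNIV)"
  by measurable

lemma measurable_corner [measurable]: "corner k \<in> borel_measurable borel"
  unfolding corner_def by measurable

lemma countable_range_corner: "countable (range (corner k :: 'e::euclidean_space \<Rightarrow> 'e))"
proof -
  have "range (corner k :: 'e \<Rightarrow> 'e) \<subseteq>
      (\<lambda>i. \<Sum>b\<in>Basis. (real_of_int (i b) / 2 ^ k) *\<^sub>R b) ` PiE Basis (\<lambda>_. UNIV)"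
  proof
    fix c :: 'e assume "c \<in> range (corner k)"
    then obtain p where p: "c = corner k p" by blast
    then show "c \<in> (\<lambda>i. \<Sum>b\<in>Basis. (real_of_int (i b) / 2 ^ k) *\<^sub>R b) ` PiE Basis (\<lambda>_. UNIV)"
      by (intro image_eqI[of _ _ "restrict (\<lambda>b. \<lfloor>2 ^ k * (p \<bullet> b)\<rfloor>) Basis"]) (auto simp: corner_def)
  qed
  moreover have "countable (PiE (Basis::'e set) (\<lambda>_. UNIV :: int set))" by (intro countable_PiE) auto
  ultimately show ?thesis by (rule countable_subset[OF _ countable_image])
qed

text \<open>The corner takes countably many values, so an arbitrary predicate of it defines a
  countable union of half-open cells. Flatness, breaks and counts enter only through the corner,
  which settles their measurability.\<close>

lemma measurable_corner_pred: "{p. P (corner k p)} \<in> sets borel"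
proof -
  have "{p. P (corner k p)} = (\<Union>c\<in>range (corner k) \<inter> Collect P. corner k -` {c})" by auto
  also have "\<dots> \<in> sets borel"
  proof (rule sets.countable_UN'')
    show "countable (range (corner k :: 'a \<Rightarrow> 'a) \<inter> Collect P)"
      by (rule countable_Int1[OF countable_range_corner])
    show "corner k -` {c} \<in> sets borel" if "c \<in> range (corner k) \<inter> Collect P" for c :: 'a
      using measurable_sets[OF measurable_corner, of "{c}" k] by simp
  qed
  finally show ?thesis .
qed

lemma half_cube_borel [measurable]: "half_cube \<in> sets borel"
proof -
  have "half_cube = (\<Inter>b\<in>Basis. {p::'a. 0 \<le> p \<bullet> b} \<inter> {p. p \<bullet> b < 1})" by (auto simp: half_cube_def)
  also have "\<dots> \<in> sets borel" by (intro sets.finite_INT) auto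
  finally show ?thesis .
qed

lemma half_cube_subset_cbox: "half_cube \<subseteq> cbox 0 One"
  by (auto simp: half_cube_def mem_box less_imp_le)

lemma corner_offset_mem: "2 ^ k *\<^sub>R (p - corner k p) \<in> cbox 0 One"
  unfolding mem_box
proof (intro ballI)
  fix b :: 'a assume b: "b \<in> Basis"
  have "2 ^ k *\<^sub>R (p - corner k p) \<bullet> b = 2 ^ k * (p \<bullet> b) - real_of_int \<lfloor>2 ^ k * (p \<bullet> b)\<rfloor>"
    using b by (simp add: inner_simps corner_inner algebra_simps)
  then show "0 \<bullet> b \<le> 2 ^ k *\<^sub>R (p - corner k p) \<bullet> b \<and> 2 ^ k *\<^sub>R (p - corner k p) \<bullet> b \<le> One \<bullet> b"
    using b by (simp; linarith)
qed

lemma mem_cell_corner: "p \<in> cell k (corner k p)"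
  using corner_offset_mem by (simp add: mem_cell_rescale)

lemma norm_corner_offset: "norm (p - corner k p) \<le> real DIM('e) * (1/2)^k" for p :: "'e::euclidean_space"
proof -
  have "norm (2 ^ k *\<^sub>R (p - corner k p)) \<le> real DIM('e)"
    by (rule norm_cube_le[OF corner_offset_mem])
  then show ?thesis by (simp add: power_one_over pos_le_divide_eq mult.commute)
qed

lemma nn_integral_lborel_translate:
  fixes f :: "'e::euclidean_space \<Rightarrow> ennreal"
  assumes [measurable]: "f \<in> borel_measurable borel"
  shows "(\<integral>\<^sup>+x. f (x + c) \<partial>lborel) = (\<integral>\<^sup>+x. f x \<partial>lborel)"
proof -
  have "(\<integral>\<^sup>+x. f x \<partial>lborel) = (\<integral>\<^sup>+x. f x \<partial>(distr lborel borel ((+) c)))"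
    by (simp add: lborel_distr_plus)
  also have "\<dots> = (\<integral>\<^sup>+x. f (c + x) \<partial>lborel)" by (rule nn_integral_distr) auto
  finally show ?thesis by (simp add: add.commute)
qed

lemma continuous_on_pm:
  fixes f g :: "'a::metric_space \<Rightarrow> 'e::euclidean_space"
  assumes "pm r" "continuous_on A f" "continuous_on A g"
  shows "continuous_on A (\<lambda>x. r (f x) (g x))"
  unfolding continuous_on_iff
proof (intro ballI allI impI)
  fix x and e :: real assume x: "x \<in> A" and e: "e > 0"
  obtain d1 where d1: "d1 > 0" "\<And>y. y \<in> A \<Longrightarrow> dist y x < d1 \<Longrightarrow> dist (f y) (f x) < e/2"
    using assms(2) x e unfolding continuous_on_iff by (meson half_gt_zero)
  obtain d2 where d2: "d2 > 0" "\<And>y. y \<in> A \<Longrightarrow> dist y x < d2 \<Longrightarrow> dist (g y) (g x) < e/2"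
    using assms(3) x e unfolding continuous_on_iff by (meson half_gt_zero)
  have "dist (r (f y) (g y)) (r (f x) (g x)) < e" if "y \<in> A" "dist y x < min d1 d2" for y
    using pm_lip[OF assms(1), of "f y" "g y" "f x" "g x"] d1(2)[of y] d2(2)[of y] that
    by (simp add: dist_real_def)
  then show "\<exists>d>0. \<forall>y\<in>A. dist y x < d \<longrightarrow> dist (r (f y) (g y)) (r (f x) (g x)) < e"
    using d1(1) d2(1) by (intro exI[of _ "min d1 d2"]) auto
qed

lemma measurable_pm_pair:
  assumes "pm r" shows "(\<lambda>z::'e::euclidean_space \<times> 'e. r (fst z) (snd z)) \<in> borel_measurable borel"
  by (intro borel_measurable_continuous_onI continuous_on_pm[OF assms] continuous_intros)

lemma measurable_pm:
  assumes "pm r" and [measurable]: "f \<in> borel_measurable M" "g \<in> borel_measurable M"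
  shows "(\<lambda>x. r (f x) (g x)) \<in> borel_measurable M"
proof -
  have "(\<lambda>x. (f x, g x)) \<in> borel_measurable M" by measurable
  from measurable_compose[OF this measurable_pm_pair[OF assms(1)]] show ?thesis by simp
qed

lemma measurable_dq:
  assumes "pm r" and [measurable]: "f \<in> borel_measurable M"
  shows "(\<lambda>x. dq r k (f x) v) \<in> borel_measurable M"
  unfolding dq_def by (intro borel_measurable_times borel_measurable_const measurable_pm[OF assms(1)]) measurable

lemma dq_nonneg: "pm r \<Longrightarrow> 0 \<le> dq r k x v"
  by (simp add: dq_def pm_nonneg)

lemma dq_le_norm: "pm r \<Longrightarrow> dq r k x v \<le> norm v"
proof -
  assume r: "pm r"
  have "dq r k x v \<le> 2 ^ k * ((1/2) ^ k * norm v)"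
    unfolding dq_def using pm_le_dist[OF r, of x "x + (1/2) ^ k *\<^sub>R v"] by (intro mult_left_mono) (auto simp: dist_norm)
  then show ?thesis by (simp add: power_one_over)
qed

lemma dq_lip:
  assumes r: "pm r"
  shows "\<bar>dq r k x v - dq r k x' v'\<bar> \<le> 2 * (2 ^ k * norm (x - x')) + norm (v - v')"
proof -
  have "x + (1/2) ^ k *\<^sub>R v - (x' + (1/2) ^ k *\<^sub>R v') = (x - x') + (1/2) ^ k *\<^sub>R (v - v')"
    by (simp add: algebra_simps)
  then have "dist (x + (1/2) ^ k *\<^sub>R v) (x' + (1/2) ^ k *\<^sub>R v') \<le> norm (x - x') + norm ((1/2) ^ k *\<^sub>R (v - v'))"
    unfolding dist_norm by (metis norm_triangle_ineq)
  then have "dist (x + (1/2) ^ k *\<^sub>R v) (x' + (1/2) ^ k *\<^sub>R v') \<le> norm (x - x') + (1/2) ^ k * norm (v - v')"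
    by simp
  then have "\<bar>r x (x + (1/2) ^ k *\<^sub>R v) - r x' (x' + (1/2) ^ k *\<^sub>R v')\<bar> \<le> 2 * norm (x - x') + (1/2) ^ k * norm (v - v')"
    using pm_lip[OF r, of x "x + (1/2) ^ k *\<^sub>R v" x' "x' + (1/2) ^ k *\<^sub>R v'"] by (simp add: dist_norm)
  then have "2 ^ k * \<bar>r x (x + (1/2) ^ k *\<^sub>R v) - r x' (x' + (1/2) ^ k *\<^sub>R v')\<bar> \<le>
      2 ^ k * (2 * norm (x - x') + (1/2) ^ k * norm (v - v'))"
    by (intro mult_left_mono) auto
  also have "\<dots> = 2 * (2 ^ k * norm (x - x')) + norm (v - v')"
    by (simp add: power_one_over field_simps)
  finally show ?thesis
    unfolding dq_def by (simp add: abs_mult flip: right_diff_distrib)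
qed

text \<open>The triangle inequality at the midpoint. Both the energy estimate and the downcrossing
  estimate rest on it.\<close>

lemma dq_subdivide:
  assumes r: "pm r"
  shows "2 * dq r k x v \<le> dq r (Suc k) x v + dq r (Suc k) (x + (1/2) ^ Suc k *\<^sub>R v) v"
proof -
  have e: "x + (1/2) ^ Suc k *\<^sub>R v + (1/2) ^ Suc k *\<^sub>R v = x + (1/2) ^ k *\<^sub>R v"
    by (simp add: algebra_simps flip: scaleR_add_left)
  have "r x (x + (1/2) ^ k *\<^sub>R v) \<le> r x (x + (1/2) ^ Suc k *\<^sub>R v) +
      r (x + (1/2) ^ Suc k *\<^sub>R v) (x + (1/2) ^ Suc k *\<^sub>R v + (1/2) ^ Suc k *\<^sub>R v)"
    unfolding e by (rule pm_triangle[OF r])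
  then have "2 ^ Suc k * r x (x + (1/2) ^ k *\<^sub>R v) \<le> 2 ^ Suc k * (r x (x + (1/2) ^ Suc k *\<^sub>R v) +
      r (x + (1/2) ^ Suc k *\<^sub>R v) (x + (1/2) ^ Suc k *\<^sub>R v + (1/2) ^ Suc k *\<^sub>R v))"
    by (intro mult_left_mono) auto
  then show ?thesis unfolding dq_def by (simp add: distrib_left)
qed

text \<open>Since \<open>2 s \<le> a + a'\<close> forces \<open>(a - s)\<^sup>2 + 2 s\<^sup>2 \<le> a\<^sup>2 + a'\<^sup>2\<close>, passing to a finer scale raises the
  energy by the square of the change. The balls of integration grow so as to absorb the shifts.\<close>

lemma dq_square_variation:
  fixes v :: "'e::euclidean_space"
  assumes r: "pm r" and \<rho>: "\<rho> \<ge> 0"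
  shows "(\<Sum>k<K. \<integral>\<^sup>+p. indicator (cball 0 \<rho>) p * ennreal ((dq r (Suc k) p v - dq r k p v)\<^sup>2) \<partial>lborel)
     \<le> 2 * (ennreal ((norm v)\<^sup>2) * emeasure lborel (cball (0::'e) (\<rho> + norm v)))"
proof -
  define g where "g k p = dq r k p v" for k p
  have g0: "0 \<le> g k p" and gv: "g k p \<le> norm v" for k p
    using dq_nonneg[OF r] dq_le_norm[OF r] by (auto simp: g_def)
  have [measurable]: "g k \<in> borel_measurable borel" for k
    unfolding g_def by (rule measurable_dq[OF r]) simp
  have cb [measurable]: "cball 0 s \<in> sets (borel :: 'e measure)" for s by simp
  \<comment> \<open>The shift from level \<open>k\<close> to the next has length
    \<open>2^-(k+1) norm v\<close>, and all shifts together stay below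
    \<open>norm v\<close>.\<close>
  define R where "R k = \<rho> + norm v * (1 - (1/2)^k)" for k
  have R0: "\<rho> \<le> R k" and R1: "R k \<le> \<rho> + norm v" for k
  proof -
    show "\<rho> \<le> R k" by (simp add: R_def power_le_one)
    have "norm v * (1 - (1/2)^k) \<le> norm v * 1" by (intro mult_left_mono) auto
    then show "R k \<le> \<rho> + norm v" by (simp add: R_def)
  qed
  define I where "I k = (\<integral>\<^sup>+p. indicator (cball 0 \<rho>) p * ennreal ((g (Suc k) p - g k p)\<^sup>2) \<partial>lborel)" for k
  define E where "E k = (\<integral>\<^sup>+p. indicator (cball 0 (R k)) p * ennreal ((g k p)\<^sup>2) \<partial>lborel)" for k
  have step: "I k + 2 * E k \<le> 2 * E (Suc k)" for k
  proof -
    define h where "h = (1/2) ^ Suc k *\<^sub>R v"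
    have pt: "(g (Suc k) p - g k p)\<^sup>2 + 2 * (g k p)\<^sup>2 \<le> (g (Suc k) p)\<^sup>2 + (g (Suc k) (p + h))\<^sup>2" for p
    proof -
      define a a' s where "a = g (Suc k) p" and "a' = g (Suc k) (p + h)" and "s = g k p"
      have s: "2 * s \<le> a + a'" using dq_subdivide[OF r, of k p v] by (simp add: a_def a'_def s_def g_def h_def)
      \<comment> \<open>The right side of the claim minus its left side equals
        \<open>(a' - s)^2 + 2 s (a + a' - 2 s)\<close>.\<close>
      have "0 \<le> 2 * s * (a + a' - 2 * s)" using s g0[of k p] by (simp add: s_def)
      moreover have "0 \<le> (a' - s)\<^sup>2" by simp
      ultimately have "(a - s)\<^sup>2 + 2 * s\<^sup>2 \<le> a\<^sup>2 + a'\<^sup>2" by (simp add: power2_eq_square algebra_simps)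
      then show ?thesis by (simp add: a_def a'_def s_def)
    qed
    have "I k \<le> (\<integral>\<^sup>+p. indicator (cball 0 (R k)) p * ennreal ((g (Suc k) p - g k p)\<^sup>2) \<partial>lborel)"
      unfolding I_def using R0[of k] by (intro nn_integral_mono mult_right_mono) (auto simp: indicator_def)
    then have "I k + 2 * E k \<le> (\<integral>\<^sup>+p. indicator (cball 0 (R k)) p * ennreal ((g (Suc k) p - g k p)\<^sup>2) \<partial>lborel) + 2 * E k"
      by (rule add_right_mono)
    also have "\<dots> = (\<integral>\<^sup>+p. indicator (cball 0 (R k)) p * ennreal ((g (Suc k) p - g k p)\<^sup>2) +
        2 * (indicator (cball 0 (R k)) p * ennreal ((g k p)\<^sup>2)) \<partial>lborel)"
    proof -
      have m1: "(\<lambda>p. indicator (cball 0 (R k)) p * ennreal ((g (Suc k) p - g k p)\<^sup>2)) \<in> borel_measurable lborel"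
        by measurable
      have m2: "(\<lambda>p. indicator (cball 0 (R k)) p * ennreal ((g k p)\<^sup>2)) \<in> borel_measurable lborel"
        by measurable
      show ?thesis
        unfolding E_def nn_integral_cmult[OF m2, symmetric]
        by (rule nn_integral_add[OF m1, symmetric]) measurable
    qed
    also have "\<dots> \<le> (\<integral>\<^sup>+p. indicator (cball 0 (R k)) p * ennreal ((g (Suc k) p)\<^sup>2) +
        indicator (cball 0 (R k)) p * ennreal ((g (Suc k) (p + h))\<^sup>2) \<partial>lborel)"
    proof (rule nn_integral_mono)
      fix p :: 'e
      have "ennreal ((g (Suc k) p - g k p)\<^sup>2) + 2 * ennreal ((g k p)\<^sup>2) = ennreal ((g (Suc k) p - g k p)\<^sup>2 + 2 * (g k p)\<^sup>2)"
        by (simp add: ennreal_plus ennreal_mult)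
      also have "\<dots> \<le> ennreal ((g (Suc k) p)\<^sup>2 + (g (Suc k) (p + h))\<^sup>2)" by (rule ennreal_leI[OF pt])
      also have "\<dots> = ennreal ((g (Suc k) p)\<^sup>2) + ennreal ((g (Suc k) (p + h))\<^sup>2)" by (simp add: ennreal_plus)
      finally show "indicator (cball 0 (R k)) p * ennreal ((g (Suc k) p - g k p)\<^sup>2) + 2 * (indicator (cball 0 (R k)) p * ennreal ((g k p)\<^sup>2))
        \<le> indicator (cball 0 (R k)) p * ennreal ((g (Suc k) p)\<^sup>2) + indicator (cball 0 (R k)) p * ennreal ((g (Suc k) (p + h))\<^sup>2)"
        by (auto simp: indicator_def)
    qed
    also have "\<dots> = (\<integral>\<^sup>+p. indicator (cball 0 (R k)) p * ennreal ((g (Suc k) p)\<^sup>2) \<partial>lborel) +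
        (\<integral>\<^sup>+p. indicator (cball 0 (R k)) p * ennreal ((g (Suc k) (p + h))\<^sup>2) \<partial>lborel)"
      by (rule nn_integral_add) measurable
    also have "\<dots> \<le> E (Suc k) + E (Suc k)"
    proof (rule add_mono)
      have R2: "R k + norm h = R (Suc k)" by (simp add: R_def h_def algebra_simps)
      show "(\<integral>\<^sup>+p. indicator (cball 0 (R k)) p * ennreal ((g (Suc k) p)\<^sup>2) \<partial>lborel) \<le> E (Suc k)"
        unfolding E_def
      proof (intro nn_integral_mono mult_right_mono)
        fix p :: 'e
        have "norm p \<le> R k \<Longrightarrow> norm p \<le> R (Suc k)" using R2 norm_ge_zero[of h] by linarith
        then show "indicator (cball 0 (R k)) p \<le> (indicator (cball 0 (R (Suc k))) p :: ennreal)"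
          by (auto simp: indicator_def)
      qed simp
      have "(\<integral>\<^sup>+p. indicator (cball 0 (R k)) p * ennreal ((g (Suc k) (p + h))\<^sup>2) \<partial>lborel)
        \<le> (\<integral>\<^sup>+p. indicator (cball 0 (R (Suc k))) (p + h) * ennreal ((g (Suc k) (p + h))\<^sup>2) \<partial>lborel)"
      proof (intro nn_integral_mono mult_right_mono)
        fix p :: 'e
        have "norm p \<le> R k \<Longrightarrow> norm (p + h) \<le> R (Suc k)" using norm_triangle_ineq[of p h] R2 by linarith
        then show "indicator (cball 0 (R k)) p \<le> (indicator (cball 0 (R (Suc k))) (p + h) :: ennreal)"
          by (auto simp: indicator_def)
      qed simp
      also have "\<dots> = E (Suc k)"
        unfolding E_def by (rule nn_integral_lborel_translate) measurable
      finally show "(\<integral>\<^sup>+p. indicator (cball 0 (R k)) p * ennreal ((g (Suc k) (p + h))\<^sup>2) \<partial>lborel) \<le> E (Suc k)" .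
    qed
    finally show ?thesis by (simp add: mult_2)
  qed
  have "(\<Sum>k<K. I k) + 2 * E 0 \<le> 2 * E K"
  proof (induction K)
    case (Suc K)
    have "(\<Sum>k<Suc K. I k) + 2 * E 0 = I K + ((\<Sum>k<K. I k) + 2 * E 0)" by (simp add: ac_simps)
    also have "\<dots> \<le> I K + 2 * E K" using Suc by (rule add_left_mono)
    also have "\<dots> \<le> 2 * E (Suc K)" by (rule step)
    finally show ?case .
  qed simp
  moreover have "(\<Sum>k<K. I k) \<le> (\<Sum>k<K. I k) + 2 * E 0" by (simp add: add_increasing2)
  ultimately have "(\<Sum>k<K. I k) \<le> 2 * E K" by (rule order_trans[rotated])
  also have "E K \<le> (\<integral>\<^sup>+p. ennreal ((norm v)\<^sup>2) * indicator (cball (0::'e) (\<rho> + norm v)) p \<partial>lborel)"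
    unfolding E_def
  proof (rule nn_integral_mono)
    fix p :: 'e
    have "(g K p)\<^sup>2 \<le> (norm v)\<^sup>2" using g0 gv by (intro power_mono) auto
    then show "indicator (cball 0 (R K)) p * ennreal ((g K p)\<^sup>2) \<le> ennreal ((norm v)\<^sup>2) * indicator (cball 0 (\<rho> + norm v)) p"
      using R1[of K] by (auto simp: indicator_def intro: ennreal_leI)
  qed
  also have "\<dots> = ennreal ((norm v)\<^sup>2) * emeasure lborel (cball (0::'e) (\<rho> + norm v))"
    by (rule nn_integral_cmult_indicator) auto
  finally show ?thesis unfolding I_def g_def by (simp add: mult_left_mono)
qed

text \<open>A failure of flatness has a witness \<open>w\<close>, \<open>v\<close> in a continuum.
  Difference quotients are Lipschitz in both, so the witness can be moved to finite nets while
  keeping half of the deviation. For each pair of the nets, Chebyshev's inequality and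
  \<open>dq_square_variation\<close> bound the sum over all levels, independently of
  \<open>r\<close> and \<open>K\<close>.\<close>

lemma nonflat_measure:
  fixes j :: nat
  assumes j: "j > 0"
  shows "\<exists>C::real. \<forall>r K. pm (r :: 'e::euclidean_space \<Rightarrow> 'e \<Rightarrow> real) \<longrightarrow>
    (\<Sum>k<K. emeasure lborel {p \<in> half_cube. \<not> flat j r k (corner k p)}) \<le> ennreal C"
proof -
  let ?d = "real DIM('e)"
  \<comment> \<open>Moving to the nets costs \<open>3 \<eta>\<close> at level \<open>k\<close> and
    \<open>5 \<eta>\<close> at the next level. The total \<open>8 \<eta> = 1 / (3 j)\<close> leaves
    at least half of the deviation \<open>1 / j\<close>.\<close>
  define \<eta> where "\<eta> = 1 / (24 * real j)"
  have \<eta>: "\<eta> > 0" using j by (simp add: \<eta>_def)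
  \<comment> \<open>The radius is \<open>j + d\<close> because the base point is measured from
    \<open>p\<close> instead of its corner. For fixed \<open>w\<close> the test point is then a
    translate of \<open>p\<close>, and translation invariance of the integral applies.\<close>
  obtain W where W: "finite W" "W \<subseteq> cball (0::'e) (real j + ?d)" "\<And>x. x \<in> cball 0 (real j + ?d) \<Longrightarrow> \<exists>y\<in>W. dist x y < \<eta>"
    using compact_finite_net[OF compact_cball \<eta>] by metis
  obtain V where V: "finite V" "V \<subseteq> cball (0::'e) (real j)" "\<And>x. x \<in> cball 0 (real j) \<Longrightarrow> \<exists>y\<in>V. dist x y < \<eta>"
    using compact_finite_net[OF compact_cball \<eta>] by metis
  define \<rho> where "\<rho> = ?d + (real j + ?d)"
  define C where "C = (\<Sum>w\<in>W. \<Sum>v\<in>V. (4 * real j * real j) * (2 * ((norm v)\<^sup>2 * measure lborel (cball (0::'e) (\<rho> + norm v)))))"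
  have fin: "emeasure lborel (cball (0::'e) R) = ennreal (measure lborel (cball (0::'e) R))" for R
    by (intro emeasure_eq_ennreal_measure) (use emeasure_bounded_finite[OF bounded_cball, of "0::'e" R] in auto)
  have cb [measurable]: "cball 0 s \<in> sets (borel :: 'e measure)" for s by simp
  have main: "(\<Sum>k<K. emeasure lborel {p \<in> half_cube. \<not> flat j r k (corner k p)}) \<le> ennreal C" if r: "pm r" for r :: "'e \<Rightarrow> 'e \<Rightarrow> real" and K
  proof -
    define \<Delta> where "\<Delta> k v p = dq r (Suc k) p v - dq r k p v" for k v p
    have [measurable]: "\<Delta> k v \<in> borel_measurable borel" for k v
      unfolding \<Delta>_def by (intro borel_measurable_diff measurable_dq[OF r]) auto
    define B where "B k w v = {p \<in> half_cube. 1 \<le> ennreal (4 * real j * real j) * ennreal ((\<Delta> k v (p + (1/2)^k *\<^sub>R w))\<^sup>2)}" for k w v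
    have Bm [measurable]: "B k w v \<in> sets borel" for k w v
      unfolding B_def by measurable
    have sub: "{p \<in> half_cube. \<not> flat j r k (corner k p)} \<subseteq> (\<Union>w\<in>W. \<Union>v\<in>V. B k w v)" for k
    proof
      fix p assume p: "p \<in> {p \<in> half_cube. \<not> flat j r k (corner k p)}"
      then obtain w0 v0 where wv: "norm w0 \<le> real j" "norm v0 \<le> real j"
        "1 / real j < \<bar>dq r k (corner k p + (1/2)^k *\<^sub>R w0) v0 - dq r (Suc k) (corner k p + (1/2)^k *\<^sub>R w0) v0\<bar>"
        unfolding flat_def by (auto simp: not_le)
      define w1 where "w1 = w0 - 2 ^ k *\<^sub>R (p - corner k p)"
      have "norm w1 \<le> norm w0 + norm (2 ^ k *\<^sub>R (p - corner k p))" unfolding w1_def by (rule norm_triangle_ineq4)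
      also have "\<dots> \<le> real j + ?d" using wv(1) norm_cube_le[OF corner_offset_mem] by (rule add_mono)
      finally have "w1 \<in> cball 0 (real j + ?d)" by simp
      then obtain w where w: "w \<in> W" "dist w1 w < \<eta>" using W(3) by blast
      obtain v where v: "v \<in> V" "dist v0 v < \<eta>" using V(3)[of v0] wv(2) by auto
      have px: "corner k p + (1/2)^k *\<^sub>R w0 = p + (1/2)^k *\<^sub>R w1"
      proof -
        define z where "z = (1/2)^k *\<^sub>R (2 ^ k *\<^sub>R (p - corner k p))"
        have z: "corner k p + z = p" unfolding z_def by (rule rescale_inverse)
        have "p + (1/2)^k *\<^sub>R w1 = (corner k p + z) + ((1/2)^k *\<^sub>R w0 - z)"
          unfolding w1_def scaleR_diff_right[of _ w0] z z_def[symmetric] by (rule refl)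
        then show ?thesis by simp
      qed
      have n1: "norm (p + (1/2)^k *\<^sub>R w1 - (p + (1/2)^k *\<^sub>R w)) = (1/2)^k * dist w1 w"
        by (simp add: dist_norm flip: scaleR_diff_right)
      have h: "2 ^ k * ((1/2)^k * x) = x" for x :: real by (simp add: power_one_over)
      have a1: "\<bar>dq r k (p + (1/2)^k *\<^sub>R w1) v0 - dq r k (p + (1/2)^k *\<^sub>R w) v\<bar> \<le> 3 * \<eta>"
        using dq_lip[OF r, of k "p + (1/2)^k *\<^sub>R w1" v0 "p + (1/2)^k *\<^sub>R w" v] w(2) v(2)
        unfolding n1 h by (simp add: dist_norm)
      have a2: "\<bar>dq r (Suc k) (p + (1/2)^k *\<^sub>R w1) v0 - dq r (Suc k) (p + (1/2)^k *\<^sub>R w) v\<bar> \<le> 5 * \<eta>"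
        using dq_lip[OF r, of "Suc k" "p + (1/2)^k *\<^sub>R w1" v0 "p + (1/2)^k *\<^sub>R w" v] w(2) v(2)
        unfolding n1 power_Suc mult.assoc h by (simp add: dist_norm)
      have "1 / real j - 8 * \<eta> \<le> \<bar>\<Delta> k v (p + (1/2)^k *\<^sub>R w)\<bar>"
        using wv(3) a1 a2 unfolding px \<Delta>_def by linarith
      moreover have "1 / real j - 8 * \<eta> \<ge> 1 / (2 * real j)" using j by (simp add: \<eta>_def field_simps)
      ultimately have "1 / (2 * real j) \<le> \<bar>\<Delta> k v (p + (1/2)^k *\<^sub>R w)\<bar>" by linarith
      then have "(1 / (2 * real j))\<^sup>2 \<le> \<bar>\<Delta> k v (p + (1/2)^k *\<^sub>R w)\<bar>\<^sup>2" by (intro power_mono) auto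
      then have "1 \<le> (4 * real j * real j) * (\<Delta> k v (p + (1/2)^k *\<^sub>R w))\<^sup>2"
        using j by (simp add: power2_eq_square field_simps)
      then have "ennreal 1 \<le> ennreal ((4 * real j * real j) * (\<Delta> k v (p + (1/2)^k *\<^sub>R w))\<^sup>2)" by (rule ennreal_leI)
      then have "p \<in> B k w v" using p by (simp add: B_def ennreal_mult)
      then show "p \<in> (\<Union>w\<in>W. \<Union>v\<in>V. B k w v)" using w(1) v(1) by blast
    qed
    have Bk: "emeasure lborel (B k w v) \<le> ennreal (4 * real j * real j) *
        (\<integral>\<^sup>+p. indicator (cball 0 \<rho>) p * ennreal ((\<Delta> k v p)\<^sup>2) \<partial>lborel)" if "w \<in> W" for k w v
    proof -
      have "emeasure lborel (B k w v) = (\<integral>\<^sup>+p. indicator (B k w v) p \<partial>lborel)" by simp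
      also have "\<dots> \<le> (\<integral>\<^sup>+p. ennreal (4 * real j * real j) * (indicator (cball 0 \<rho>) (p + (1/2)^k *\<^sub>R w) * ennreal ((\<Delta> k v (p + (1/2)^k *\<^sub>R w))\<^sup>2)) \<partial>lborel)"
      proof (rule nn_integral_mono)
        fix p :: 'e
        have "p + (1/2)^k *\<^sub>R w \<in> cball 0 \<rho>" if "p \<in> half_cube"
        proof -
          have "norm (p + (1/2)^k *\<^sub>R w) \<le> norm p + norm ((1/2)^k *\<^sub>R w)" by (rule norm_triangle_ineq)
          also have "norm ((1/2)^k *\<^sub>R w) = (1/2)^k * norm w" by simp
          also have "\<dots> \<le> 1 * norm w" by (intro mult_right_mono power_le_one) auto
          also have "norm w \<le> real j + ?d" using W(2) \<open>w \<in> W\<close> by auto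
          also have "norm p \<le> ?d" using norm_cube_le that half_cube_subset_cbox by blast
          finally show ?thesis by (simp add: \<rho>_def)
        qed
        then show "indicator (B k w v) p \<le> ennreal (4 * real j * real j) * (indicator (cball 0 \<rho>) (p + (1/2)^k *\<^sub>R w) * ennreal ((\<Delta> k v (p + (1/2)^k *\<^sub>R w))\<^sup>2))"
          by (auto simp: indicator_def B_def)
      qed
      also have "\<dots> = (\<integral>\<^sup>+p. ennreal (4 * real j * real j) * (indicator (cball 0 \<rho>) p * ennreal ((\<Delta> k v p)\<^sup>2)) \<partial>lborel)"
        by (rule nn_integral_lborel_translate) measurable
      also have "\<dots> = ennreal (4 * real j * real j) * (\<integral>\<^sup>+p. indicator (cball 0 \<rho>) p * ennreal ((\<Delta> k v p)\<^sup>2) \<partial>lborel)"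
        by (rule nn_integral_cmult) measurable
      finally show ?thesis .
    qed
    have "(\<Sum>k<K. emeasure lborel {p \<in> half_cube. \<not> flat j r k (corner k p)}) \<le> (\<Sum>k<K. \<Sum>w\<in>W. \<Sum>v\<in>V. emeasure lborel (B k w v))"
    proof (rule sum_mono)
      fix k
      have "emeasure lborel {p \<in> half_cube. \<not> flat j r k (corner k p)} \<le> emeasure lborel (\<Union>w\<in>W. \<Union>v\<in>V. B k w v)"
        using W(1) V(1) by (intro emeasure_mono[OF sub]) (auto intro!: sets.finite_UN)
      also have "\<dots> \<le> (\<Sum>w\<in>W. emeasure lborel (\<Union>v\<in>V. B k w v))"
        using W(1) V(1) by (intro emeasure_subadditive_finite) (auto intro!: sets.finite_UN)
      also have "\<dots> \<le> (\<Sum>w\<in>W. \<Sum>v\<in>V. emeasure lborel (B k w v))"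
        using V by (intro sum_mono emeasure_subadditive_finite) auto
      finally show "emeasure lborel {p \<in> half_cube. \<not> flat j r k (corner k p)} \<le> (\<Sum>w\<in>W. \<Sum>v\<in>V. emeasure lborel (B k w v))" .
    qed
    also have "\<dots> = (\<Sum>w\<in>W. \<Sum>v\<in>V. \<Sum>k<K. emeasure lborel (B k w v))"
      by (subst sum.swap, rule sum.cong[OF refl], rule sum.swap)
    also have "\<dots> \<le> (\<Sum>w\<in>W. \<Sum>v\<in>V. ennreal (4 * real j * real j) * (2 * (ennreal ((norm v)\<^sup>2) * emeasure lborel (cball (0::'e) (\<rho> + norm v)))))"
    proof (intro sum_mono)
      fix w v assume w: "w \<in> W"
      have "(\<Sum>k<K. emeasure lborel (B k w v)) \<le> (\<Sum>k<K. ennreal (4 * real j * real j) *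
        (\<integral>\<^sup>+p. indicator (cball 0 \<rho>) p * ennreal ((\<Delta> k v p)\<^sup>2) \<partial>lborel))"
        using Bk[OF w] by (rule sum_mono)
      also have "\<dots> = ennreal (4 * real j * real j) * (\<Sum>k<K. \<integral>\<^sup>+p. indicator (cball 0 \<rho>) p * ennreal ((\<Delta> k v p)\<^sup>2) \<partial>lborel)"
        by (rule sum_distrib_left[symmetric])
      also have "\<dots> \<le> ennreal (4 * real j * real j) * (2 * (ennreal ((norm v)\<^sup>2) * emeasure lborel (cball (0::'e) (\<rho> + norm v))))"
        unfolding \<Delta>_def by (intro mult_left_mono dq_square_variation[OF r]) (auto simp: \<rho>_def)
      finally show "(\<Sum>k<K. emeasure lborel (B k w v)) \<le> ennreal (4 * real j * real j) * (2 * (ennreal ((norm v)\<^sup>2) * emeasure lborel (cball (0::'e) (\<rho> + norm v))))" .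
    qed
    also have "\<dots> = ennreal C"
    proof -
      have t: "ennreal a * (2 * (ennreal b * ennreal c)) = ennreal (a * (2 * (b * c)))" if "a \<ge> 0" "b \<ge> 0" "c \<ge> 0" for a b c
        using that by (simp add: ennreal_mult)
      have eq: "ennreal (4 * real j * real j) * (2 * (ennreal ((norm v)\<^sup>2) * ennreal (measure lborel (cball (0::'e) (\<rho> + norm v))))) =
        ennreal ((4 * real j * real j) * (2 * ((norm v)\<^sup>2 * measure lborel (cball (0::'e) (\<rho> + norm v)))))" for v
        by (rule t) auto
      show ?thesis unfolding C_def fin eq by (simp add: sum_ennreal sum_nonneg del: sum_constant)
    qed
    finally show ?thesis .
  qed
  show ?thesis using main by blast
qed

subsection \<open>Downcrossings along lines\<close>

text \<open>A switch with hysteresis: it goes on at \<open>b\<close> and off only at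
  \<open>a\<close>, so that \<open>dn\<close> counts downcrossings of the interval and ignores
  smaller oscillations.\<close>

primrec hi :: "real \<Rightarrow> real \<Rightarrow> (nat \<Rightarrow> real) \<Rightarrow> nat \<Rightarrow> bool" where
  "hi a b X 0 \<longleftrightarrow> b \<le> X 0"
| "hi a b X (Suc k) \<longleftrightarrow> b \<le> X (Suc k) \<or> (hi a b X k \<and> a < X (Suc k))"

primrec dn :: "real \<Rightarrow> real \<Rightarrow> (nat \<Rightarrow> real) \<Rightarrow> nat \<Rightarrow> nat" where
  "dn a b X 0 = 0"
| "dn a b X (Suc k) = dn a b X k + (if hi a b X k \<and> \<not> hi a b X (Suc k) then 1 else 0)"

lemma hi_if: "b \<le> X k \<Longrightarrow> hi a b X k"
  by (cases k) auto

lemma not_hi_if: "a < b \<Longrightarrow> X k \<le> a \<Longrightarrow> \<not> hi a b X k"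
  by (cases k) auto

lemma dn_mono: "i \<le> k \<Longrightarrow> dn a b X i \<le> dn a b X k"
  by (induction k rule: dec_induct) auto

lemma dn_drop:
  assumes "hi a b X i" "\<not> hi a b X k" "i \<le> k"
  shows "dn a b X i + 1 \<le> dn a b X k"
proof -
  have "hi a b X k \<or> dn a b X i + 1 \<le> dn a b X k"
    using assms(3)
  proof (induction k rule: dec_induct)
    case base
    then show ?case using assms(1) by simp
  next
    case (step m)
    then show ?case using dn_mono[OF step(1), of a b X] by auto
  qed
  then show ?thesis using assms(2) by blast
qed

lemma hi_dn_cong: "(\<And>i. i \<le> k \<Longrightarrow> X i = Y i) \<Longrightarrow> hi a b X k = hi a b Y k \<and> dn a b X k = dn a b Y k"
  by (induction k) auto

text \<open>The potential of Doob's upcrossing argument.\<close>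

definition pot :: "real \<Rightarrow> real \<Rightarrow> real \<Rightarrow> (nat \<Rightarrow> real) \<Rightarrow> nat \<Rightarrow> real" where
  "pot H a b X k = (b - a) * real (dn a b X k) +
     (if hi a b X k then H + (b - a) - max 0 (X k - a) else H)"

text \<open>Changing the switch never raises the potential. Going off requires
  \<open>X \<le> a\<close>, and then the new downcrossing costs exactly the \<open>b - a\<close>
  that is released. Going on requires \<open>X \<ge> b\<close>, where
  \<open>(b - a) - (X - a)\<close> is at most 0.\<close>

lemma pot_Suc_le:
  assumes "a < b"
  shows "pot H a b X (Suc k) \<le> (b - a) * real (dn a b X k) +
     (if hi a b X k then H + (b - a) - max 0 (X (Suc k) - a) else H)"
  using assms unfolding pot_def by (auto simp: algebra_simps max_def)

text \<open>\<open>X\<close> and \<open>Y\<close> stand for the sequences at points in the two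
  halves of an interval of level \<open>k\<close>. Since \<open>max 0 (x - a)\<close> is convex and
  increasing in \<open>x\<close>, the submartingale inequality for the sequences turns the potential
  into a supermartingale.\<close>

lemma pot_average:
  assumes ab: "a < b" and XY: "\<And>i. i \<le> k \<Longrightarrow> X i = Y i" and avg: "2 * X k \<le> X (Suc k) + Y (Suc k)"
  shows "pot H a b X (Suc k) + pot H a b Y (Suc k) \<le> 2 * pot H a b X k"
proof -
  have "pot H a b X (Suc k) + pot H a b Y (Suc k) \<le>
     2 * ((b - a) * real (dn a b X k)) + (if hi a b X k then 2 * (H + (b - a)) - (max 0 (X (Suc k) - a) + max 0 (Y (Suc k) - a)) else 2 * H)"
    using pot_Suc_le[OF ab, of H X k] pot_Suc_le[OF ab, of H Y k] hi_dn_cong[of k X Y a b, OF XY]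
    by (auto split: if_splits)
  also have "\<dots> \<le> 2 * pot H a b X k"
  proof -
    have "2 * max 0 (X k - a) \<le> max 0 (X (Suc k) - a) + max 0 (Y (Suc k) - a)" using avg by (simp add: max_def)
    then show ?thesis unfolding pot_def by (simp add: algebra_simps)
  qed
  finally show ?thesis .
qed

lemma pot_ge: "a < b \<Longrightarrow> 0 \<le> a \<Longrightarrow> 0 \<le> H \<Longrightarrow> X k \<le> H \<Longrightarrow> (b - a) * real (dn a b X k) \<le> pot H a b X k"
  unfolding pot_def by (auto simp: max_def)

section \<open>Dyadic intervals on the lines of a fixed direction\<close>

definition lsig :: "'e::euclidean_space \<Rightarrow> 'e \<Rightarrow> real" where
  "lsig v p = (p \<bullet> v) / (v \<bullet> v)"

definition lfl :: "'e::euclidean_space \<Rightarrow> nat \<Rightarrow> 'e \<Rightarrow> int" where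
  "lfl v k p = \<lfloor>2 ^ k * lsig v p\<rfloor>"

text \<open>The initial end of the dyadic interval of length \<open>2^-k norm v\<close> around
  \<open>p\<close> on its line in direction \<open>v\<close>. Cell corners would not serve: the
  midpoint in \<open>dq_subdivide\<close> has to be the base point of one of the halves.\<close>

definition lbase :: "'e::euclidean_space \<Rightarrow> nat \<Rightarrow> 'e \<Rightarrow> 'e" where
  "lbase v k p = p - (lsig v p - real_of_int (lfl v k p) / 2 ^ k) *\<^sub>R v"

text \<open>Exchanges the two halves of the interval of level \<open>k\<close> by translation. It
  preserves Lebesgue measure and the base points up to level \<open>k\<close>, so that averaging
  over \<open>p\<close> and its swap takes the place of a conditional expectation.\<close>

definition lswap :: "'e::euclidean_space \<Rightarrow> nat \<Rightarrow> 'e \<Rightarrow> 'e" where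
  "lswap v k p = (if even (lfl v (Suc k) p) then p + (1/2) ^ Suc k *\<^sub>R v else p - (1/2) ^ Suc k *\<^sub>R v)"

lemma lsig_add: "v \<noteq> 0 \<Longrightarrow> lsig v (p + s *\<^sub>R v) = lsig v p + s"
  by (simp add: lsig_def inner_add_left add_divide_distrib)

lemma lfl_add: "v \<noteq> 0 \<Longrightarrow> lfl v k (p + (1/2) ^ k *\<^sub>R v) = lfl v k p + 1"
  by (simp add: lfl_def lsig_add distrib_left power_one_over)

lemma lfl_diff: "v \<noteq> 0 \<Longrightarrow> lfl v k (p - (1/2) ^ k *\<^sub>R v) = lfl v k p - 1"
  using lfl_add[of v k "p - (1/2) ^ k *\<^sub>R v"] by simp

lemma lfl_div: "lfl v j p = lfl v (j + i) p div 2 ^ i"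
  unfolding lfl_def by (rule floor_dyadic_div)

lemma lfl_swap_Suc: "v \<noteq> 0 \<Longrightarrow> lfl v (Suc k) (lswap v k p) = (if even (lfl v (Suc k) p) then lfl v (Suc k) p + 1 else lfl v (Suc k) p - 1)"
  using lfl_add[of v "Suc k" p] lfl_diff[of v "Suc k" p] by (simp add: lswap_def)

lemma lfl_swap:
  assumes "v \<noteq> 0" "j \<le> k" shows "lfl v j (lswap v k p) = lfl v j p"
proof -
  have "lfl v k (lswap v k p) = lfl v k p"
    using lfl_div[of v k "lswap v k p" 1] lfl_div[of v k p 1] lfl_swap_Suc[OF assms(1), of k p]
    by (auto split: if_splits elim!: evenE oddE)
  then show ?thesis using lfl_div[of v j "lswap v k p" "k - j"] lfl_div[of v j p "k - j"] assms(2) by simp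
qed

lemma lswap_perp:
  assumes v: "v \<noteq> 0" shows "lswap v k p - lsig v (lswap v k p) *\<^sub>R v = p - lsig v p *\<^sub>R v"
proof -
  obtain s where s: "lswap v k p = p + s *\<^sub>R v"
  proof (cases "even (lfl v (Suc k) p)")
    case True
    then show thesis using that[of "(1/2) ^ Suc k"] by (simp add: lswap_def)
  next
    case False
    then show thesis using that[of "- ((1/2) ^ Suc k)"] by (simp add: lswap_def)
  qed
  show ?thesis unfolding s lsig_add[OF v] by (simp add: scaleR_add_left)
qed

lemma lbase_alt: "lbase v k p = (p - lsig v p *\<^sub>R v) + (real_of_int (lfl v k p) / 2 ^ k) *\<^sub>R v"
  by (simp add: lbase_def algebra_simps)

lemma lbase_swap: "v \<noteq> 0 \<Longrightarrow> j \<le> k \<Longrightarrow> lbase v j (lswap v k p) = lbase v j p"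
  unfolding lbase_alt by (simp add: lswap_perp lfl_swap)

lemma norm_lbase_offset:
  assumes "v \<noteq> 0" shows "norm (lbase v k p - p) \<le> (1/2) ^ k * norm v"
proof -
  have "\<bar>2 ^ k * lsig v p - real_of_int (lfl v k p)\<bar> \<le> 1" unfolding lfl_def by linarith
  then have "\<bar>2 ^ k * lsig v p - real_of_int (lfl v k p)\<bar> / 2 ^ k \<le> 1 / 2 ^ k" by (rule divide_right_mono) simp
  moreover have "\<bar>2 ^ k * lsig v p - real_of_int (lfl v k p)\<bar> / 2 ^ k = \<bar>lsig v p - real_of_int (lfl v k p) / 2 ^ k\<bar>"
  proof -
    have "lsig v p - real_of_int (lfl v k p) / 2 ^ k = (2 ^ k * lsig v p - real_of_int (lfl v k p)) / 2 ^ k"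
      by (simp add: diff_divide_distrib)
    then show ?thesis by (simp add: abs_divide)
  qed
  ultimately have "\<bar>lsig v p - real_of_int (lfl v k p) / 2 ^ k\<bar> \<le> (1/2) ^ k" by (simp add: power_one_over)
  then have "\<bar>lsig v p - real_of_int (lfl v k p) / 2 ^ k\<bar> * norm v \<le> (1/2) ^ k * norm v"
    by (rule mult_right_mono) simp
  then show ?thesis by (simp add: lbase_def)
qed

text \<open>Which of the two points lies in the first half depends on \<open>p\<close>. An equation
  between unordered pairs is enough, since the two quotients get added.\<close>

lemma lbase_children:
  assumes v: "v \<noteq> 0"
  shows "{lbase v (Suc k) p, lbase v (Suc k) (lswap v k p)} = {lbase v k p, lbase v k p + (1/2) ^ Suc k *\<^sub>R v}"
proof -
  let ?m = "lfl v (Suc k) p"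
  have m: "lfl v k p = ?m div 2" using lfl_div[of v k p 1] by simp
  have b: "lbase v (Suc k) (lswap v k p) = (p - lsig v p *\<^sub>R v) + (real_of_int (lfl v (Suc k) (lswap v k p)) / 2 ^ Suc k) *\<^sub>R v"
    unfolding lbase_alt[of v "Suc k" "lswap v k p"] by (simp add: lswap_perp[OF v])
  have h: "(1/2 :: real) ^ Suc k = 1 / 2 ^ Suc k" by (simp add: power_one_over)
  define q where "q = p - lsig v p *\<^sub>R v"
  show ?thesis
  proof (cases "even ?m")
    case True
    then obtain i where i: "?m = 2 * i" by (elim evenE)
    have "lbase v (Suc k) p = lbase v k p" unfolding lbase_alt m i by simp
    moreover have "lbase v (Suc k) (lswap v k p) = lbase v k p + (1/2) ^ Suc k *\<^sub>R v"
      unfolding b lfl_swap_Suc[OF v] lbase_alt[of v k p] m i h q_def[symmetric]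
      by (simp add: add_divide_distrib scaleR_add_left)
    ultimately show ?thesis by simp
  next
    case False
    then obtain i where i: "?m = 2 * i + 1" by (elim oddE)
    have "lbase v (Suc k) (lswap v k p) = lbase v k p"
      unfolding b lfl_swap_Suc[OF v] lbase_alt[of v k p] m i by simp
    moreover have "lbase v (Suc k) p = lbase v k p + (1/2) ^ Suc k *\<^sub>R v"
      unfolding lbase_alt m i h q_def[symmetric] by (simp add: add_divide_distrib scaleR_add_left)
    ultimately show ?thesis by auto
  qed
qed

lemma measurable_lsig [measurable]: "lsig v \<in> borel_measurable borel"
  unfolding lsig_def by measurable

lemma measurable_lfl [measurable]: "lfl v k \<in> measurable borel (count_space UNIV)"
  unfolding lfl_def by measurable

lemma measurable_lbase [measurable]: "lbase v k \<in> borel_measurable borel"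
  unfolding lbase_def by measurable

lemma measurable_lswap [measurable]: "lswap v k \<in> borel_measurable borel"
  unfolding lswap_def by measurable

text \<open>On the points of even index and on those of odd index the swap is a translation, and it
  carries each set onto the other.\<close>

lemma nn_integral_lswap:
  fixes f :: "'e::euclidean_space \<Rightarrow> ennreal"
  assumes v: "v \<noteq> 0" and [measurable]: "f \<in> borel_measurable borel"
  shows "(\<integral>\<^sup>+p. f (lswap v k p) \<partial>lborel) = (\<integral>\<^sup>+p. f p \<partial>lborel)"
proof -
  define h where "h = (1/2) ^ Suc k *\<^sub>R v"
  define A where "A = {p. even (lfl v (Suc k) p)}"
  have [measurable]: "A \<in> sets borel" unfolding A_def by measurable
  have Ah: "p + h \<in> A \<longleftrightarrow> p \<notin> A" "p - h \<in> A \<longleftrightarrow> p \<notin> A" for p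
    using lfl_add[OF v, of "Suc k" p] lfl_diff[OF v, of "Suc k" p] by (auto simp: A_def h_def)
  have "(\<integral>\<^sup>+p. f (lswap v k p) \<partial>lborel) = (\<integral>\<^sup>+p. indicator A p * f (p + h) + indicator (- A) p * f (p + (- h)) \<partial>lborel)"
    by (rule nn_integral_cong) (auto simp: lswap_def A_def h_def indicator_def)
  also have "\<dots> = (\<integral>\<^sup>+p. indicator A p * f (p + h) \<partial>lborel) + (\<integral>\<^sup>+p. indicator (- A) p * f (p + (- h)) \<partial>lborel)"
    by (rule nn_integral_add) measurable
  also have "(\<integral>\<^sup>+p. indicator A p * f (p + h) \<partial>lborel) = (\<integral>\<^sup>+p. indicator (- A) (p + h) * f (p + h) \<partial>lborel)"
    by (rule nn_integral_cong) (auto simp: indicator_def Ah)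
  also have "\<dots> = (\<integral>\<^sup>+p. indicator (- A) p * f p \<partial>lborel)"
    by (rule nn_integral_lborel_translate) measurable
  also have "(\<integral>\<^sup>+p. indicator (- A) p * f (p + (- h)) \<partial>lborel) = (\<integral>\<^sup>+p. indicator A (p + (- h)) * f (p + (- h)) \<partial>lborel)"
    by (rule nn_integral_cong) (auto simp: indicator_def Ah)
  also have "\<dots> = (\<integral>\<^sup>+p. indicator A p * f p \<partial>lborel)"
    by (rule nn_integral_lborel_translate) measurable
  also have "(\<integral>\<^sup>+p. indicator (- A) p * f p \<partial>lborel) + (\<integral>\<^sup>+p. indicator A p * f p \<partial>lborel) =
    (\<integral>\<^sup>+p. indicator (- A) p * f p + indicator A p * f p \<partial>lborel)"
    by (rule nn_integral_add[symmetric]) measurable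
  also have "\<dots> = (\<integral>\<^sup>+p. f p \<partial>lborel)"
    by (rule nn_integral_cong) (auto simp: indicator_def)
  finally show ?thesis .
qed

definition lseq :: "('e::euclidean_space \<Rightarrow> 'e \<Rightarrow> real) \<Rightarrow> 'e \<Rightarrow> 'e \<Rightarrow> nat \<Rightarrow> real" where
  "lseq r v p k = dq r k (lbase v k p) v"

lemma measurable_hi_dn:
  assumes [measurable]: "\<And>k. (\<lambda>p. X p k) \<in> borel_measurable M"
  shows "Measurable.pred M (\<lambda>p. hi a b (X p) k)" "(\<lambda>p. dn a b (X p) k) \<in> measurable M (count_space UNIV)"
proof -
  have hi [measurable]: "Measurable.pred M (\<lambda>p. hi a b (X p) k)" for k
    by (induction k) simp_all
  then show "Measurable.pred M (\<lambda>p. hi a b (X p) k)" .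
  show "(\<lambda>p. dn a b (X p) k) \<in> measurable M (count_space UNIV)"
    by (induction k) simp_all
qed

text \<open>Doob's inequality by swaps: twice the integral of the potential at level
  \<open>Suc k\<close> is the integral of its sum over a point and the swapped point, to which
  \<open>pot_average\<close> applies, so the integral does not increase with the level. It starts
  below \<open>norm v + (b - a)\<close> times the measure of \<open>\<Omega>\<close> and finally
  dominates \<open>b - a\<close> times the integral of the number of downcrossings.\<close>

lemma downcrossings_bounded:
  fixes v :: "'e::euclidean_space"
  assumes v: "v \<noteq> 0" and ab: "0 \<le> a" "a < b"
  shows "\<exists>C::real. \<forall>r K. pm r \<longrightarrow>
    (\<integral>\<^sup>+p. indicator half_cube p * ennreal (real (dn a b (lseq r v p) K)) \<partial>lborel) \<le> ennreal C"
proof -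
  let ?d = "real DIM('e)"
  define A :: int where "A = \<lceil>?d / norm v\<rceil> + 1"
  \<comment> \<open>The domain of integration must be invariant under all swaps, contain the
    half-open cube and have finite measure. Membership is therefore decided by the level 0 interval
    and the component orthogonal to \<open>v\<close>.\<close>
  define \<Omega> where "\<Omega> = {p. - A \<le> lfl v 0 p \<and> lfl v 0 p \<le> A \<and> norm (p - lsig v p *\<^sub>R v) \<le> 2 * ?d}"
  have [measurable]: "\<Omega> \<in> sets borel" unfolding \<Omega>_def by measurable
  have \<Omega>swap: "lswap v k p \<in> \<Omega> \<longleftrightarrow> p \<in> \<Omega>" for k p
    unfolding \<Omega>_def by (simp add: lswap_perp[OF v] lfl_swap[OF v])
  have vv: "v \<bullet> v = norm v * norm v" by (simp add: dot_square_norm power2_eq_square)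
  have sig: "\<bar>lsig v p\<bar> * norm v \<le> norm p" for p
  proof -
    have "\<bar>lsig v p\<bar> * norm v = \<bar>p \<bullet> v\<bar> / norm v" using v by (simp add: lsig_def vv abs_mult)
    also have "\<dots> \<le> norm p * norm v / norm v" by (intro divide_right_mono Cauchy_Schwarz_ineq2) auto
    finally show ?thesis using v by simp
  qed
  have sub: "half_cube \<subseteq> \<Omega>"
  proof
    fix p :: 'e assume "p \<in> half_cube"
    then have np: "norm p \<le> ?d" using half_cube_subset_cbox norm_cube_le by blast
    have "\<bar>lsig v p\<bar> \<le> ?d / norm v" using sig[of p] np v by (simp add: pos_le_divide_eq)
    then have "- A \<le> lfl v 0 p" "lfl v 0 p \<le> A" unfolding A_def lfl_def by (simp_all; linarith)+
    moreover have "norm (p - lsig v p *\<^sub>R v) \<le> norm p + \<bar>lsig v p\<bar> * norm v"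
      using norm_triangle_ineq4[of p "lsig v p *\<^sub>R v"] by simp
    ultimately show "p \<in> \<Omega>" using sig[of p] np by (simp add: \<Omega>_def)
  qed
  have bnd: "\<Omega> \<subseteq> cball 0 (2 * ?d + (real_of_int A + 1) * norm v)"
  proof
    fix p assume p: "p \<in> \<Omega>"
    have "\<bar>lsig v p\<bar> \<le> real_of_int A + 1" using p unfolding \<Omega>_def lfl_def by (simp; linarith)
    then have "\<bar>lsig v p\<bar> * norm v \<le> (real_of_int A + 1) * norm v" by (rule mult_right_mono) simp
    moreover have "norm p \<le> norm (p - lsig v p *\<^sub>R v) + norm (lsig v p *\<^sub>R v)"
      using norm_triangle_ineq[of "p - lsig v p *\<^sub>R v" "lsig v p *\<^sub>R v"] by simp
    ultimately show "p \<in> cball 0 (2 * ?d + (real_of_int A + 1) * norm v)" using p by (simp add: \<Omega>_def)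
  qed
  have fin: "emeasure lborel \<Omega> < \<infinity>"
    by (rule emeasure_bounded_finite[OF bounded_subset[OF bounded_cball bnd]])
  define C where "C = enn2real (emeasure lborel \<Omega>) * ((norm v + (b - a)) / (b - a))"
  show ?thesis
  proof (intro exI[of _ C] allI impI)
    fix r :: "'e \<Rightarrow> 'e \<Rightarrow> real" and K assume r: "pm r"
    let ?X = "lseq r v"
    let ?H = "norm v"
    have [measurable]: "(\<lambda>p. ?X p k) \<in> borel_measurable borel" for k
      unfolding lseq_def by (rule measurable_dq[OF r]) measurable
    note [measurable] = measurable_hi_dn
    have [measurable]: "(\<lambda>p. pot ?H a b (?X p) k) \<in> borel_measurable borel" for k
      unfolding pot_def by measurable
    have XH: "?X p k \<le> ?H" for p k unfolding lseq_def by (rule dq_le_norm[OF r])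
    have pot0: "0 \<le> pot ?H a b (?X p) k" for p k
      using pot_ge[OF ab(2,1), of ?H "?X p" k] XH ab by (smt (verit) mult_nonneg_nonneg norm_ge_zero of_nat_0_le_iff)
    define I where "I k = (\<integral>\<^sup>+p. indicator \<Omega> p * ennreal (pot ?H a b (?X p) k) \<partial>lborel)" for k
    have step: "I (Suc k) \<le> I k" for k
    proof -
      have pt: "pot ?H a b (?X p) (Suc k) + pot ?H a b (?X (lswap v k p)) (Suc k) \<le> 2 * pot ?H a b (?X p) k" for p
      proof (rule pot_average[OF ab(2)])
        show "?X p i = ?X (lswap v k p) i" if "i \<le> k" for i unfolding lseq_def by (simp add: lbase_swap[OF v that])
        have "?X p (Suc k) + ?X (lswap v k p) (Suc k) =
            dq r (Suc k) (lbase v k p) v + dq r (Suc k) (lbase v k p + (1/2) ^ Suc k *\<^sub>R v) v"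
          using lbase_children[OF v, of k p] unfolding lseq_def doubleton_eq_iff by auto
        then show "2 * ?X p k \<le> ?X p (Suc k) + ?X (lswap v k p) (Suc k)"
          using dq_subdivide[OF r, of k "lbase v k p" v] by (simp add: lseq_def)
      qed
      have "I (Suc k) + I (Suc k) = I (Suc k) + (\<integral>\<^sup>+p. indicator \<Omega> (lswap v k p) * ennreal (pot ?H a b (?X (lswap v k p)) (Suc k)) \<partial>lborel)"
        unfolding I_def by (subst nn_integral_lswap[OF v, of "\<lambda>p. indicator \<Omega> p * ennreal (pot ?H a b (?X p) (Suc k))"]) measurable
      also have "\<dots> = (\<integral>\<^sup>+p. indicator \<Omega> p * ennreal (pot ?H a b (?X p) (Suc k)) + indicator \<Omega> (lswap v k p) * ennreal (pot ?H a b (?X (lswap v k p)) (Suc k)) \<partial>lborel)"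
        unfolding I_def by (rule nn_integral_add[symmetric]) measurable
      also have "\<dots> \<le> (\<integral>\<^sup>+p. 2 * (indicator \<Omega> p * ennreal (pot ?H a b (?X p) k)) \<partial>lborel)"
      proof (rule nn_integral_mono)
        fix p
        have "ennreal (pot ?H a b (?X p) (Suc k)) + ennreal (pot ?H a b (?X (lswap v k p)) (Suc k)) \<le> 2 * ennreal (pot ?H a b (?X p) k)"
          using ennreal_leI[OF pt[of p]] pot0 by (simp add: ennreal_plus ennreal_mult)
        then show "indicator \<Omega> p * ennreal (pot ?H a b (?X p) (Suc k)) + indicator \<Omega> (lswap v k p) * ennreal (pot ?H a b (?X (lswap v k p)) (Suc k))
           \<le> 2 * (indicator \<Omega> p * ennreal (pot ?H a b (?X p) k))"
          by (auto simp: indicator_def \<Omega>swap)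
      qed
      also have "\<dots> = 2 * I k" unfolding I_def by (rule nn_integral_cmult) measurable
      finally have "2 * I (Suc k) \<le> 2 * I k" by (simp add: mult_2)
      then show ?thesis by (simp add: ennreal_mult_le_mult_iff)
    qed
    have "I K \<le> I 0" by (induction K) (auto intro: order_trans[OF step])
    also have "I 0 \<le> (\<integral>\<^sup>+p. ennreal (?H + (b - a)) * indicator \<Omega> p \<partial>lborel)"
      unfolding I_def
    proof (rule nn_integral_mono)
      fix p
      have "pot ?H a b (?X p) 0 \<le> ?H + (b - a)" using ab by (simp add: pot_def)
      then show "indicator \<Omega> p * ennreal (pot ?H a b (?X p) 0) \<le> ennreal (?H + (b - a)) * indicator \<Omega> p"
        by (auto simp: indicator_def intro: ennreal_leI)
    qed
    also have "\<dots> = ennreal (?H + (b - a)) * emeasure lborel \<Omega>" by (rule nn_integral_cmult_indicator) auto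
    finally have IK: "I K \<le> ennreal (?H + (b - a)) * emeasure lborel \<Omega>" .
    have "(\<integral>\<^sup>+p. indicator half_cube p * ennreal (real (dn a b (?X p) K)) \<partial>lborel) \<le>
      (\<integral>\<^sup>+p. ennreal (1 / (b - a)) * (indicator \<Omega> p * ennreal (pot ?H a b (?X p) K)) \<partial>lborel)"
    proof (rule nn_integral_mono)
      fix p
      have "(b - a) * real (dn a b (?X p) K) \<le> pot ?H a b (?X p) K"
        by (rule pot_ge) (use ab XH in auto)
      then have "real (dn a b (?X p) K) \<le> 1 / (b - a) * pot ?H a b (?X p) K" using ab by (simp add: field_simps)
      then have "ennreal (real (dn a b (?X p) K)) \<le> ennreal (1 / (b - a)) * ennreal (pot ?H a b (?X p) K)"
        using ab pot0 by (simp add: ennreal_mult[symmetric] ennreal_leI)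
      then show "indicator half_cube p * ennreal (real (dn a b (?X p) K)) \<le> ennreal (1 / (b - a)) * (indicator \<Omega> p * ennreal (pot ?H a b (?X p) K))"
        using sub by (auto simp: indicator_def)
    qed
    also have "\<dots> = ennreal (1 / (b - a)) * I K" unfolding I_def by (rule nn_integral_cmult) measurable
    also have "\<dots> \<le> ennreal (1 / (b - a)) * (ennreal (?H + (b - a)) * emeasure lborel \<Omega>)"
      by (rule mult_left_mono[OF IK]) simp
    also have "\<dots> = ennreal C"
    proof -
      define m where "m = enn2real (emeasure lborel \<Omega>)"
      have m: "emeasure lborel \<Omega> = ennreal m" "m \<ge> 0" using fin by (simp_all add: m_def)
      have "C = 1 / (b - a) * ((?H + (b - a)) * m)" unfolding C_def m_def by simp
      moreover have "1 / (b - a) \<ge> 0" "?H + (b - a) \<ge> 0" using ab by simp_all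
      ultimately show ?thesis unfolding m(1) using m(2) by (simp only: ennreal_mult mult_nonneg_nonneg)
    qed
    finally show "(\<integral>\<^sup>+p. indicator half_cube p * ennreal (real (dn a b (?X p) K)) \<partial>lborel) \<le> ennreal C" .
  qed
qed

subsection \<open>Breaks along dyadic cells\<close>

lemma half_cube_corner: "corner k p \<in> half_cube \<longleftrightarrow> p \<in> half_cube"
proof -
  have "0 \<le> corner k p \<bullet> b \<longleftrightarrow> 0 \<le> p \<bullet> b" "corner k p \<bullet> b < 1 \<longleftrightarrow> p \<bullet> b < 1" if b: "b \<in> Basis" for b
  proof -
    have "0 \<le> corner k p \<bullet> b \<longleftrightarrow> 0 \<le> 2 ^ k * (p \<bullet> b)"
      unfolding corner_inner[OF b] by (subst pos_le_divide_eq) simp_all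
    also have "\<dots> \<longleftrightarrow> 0 \<le> p \<bullet> b" using mult_le_cancel_left_pos[of "2 ^ k" 0 "p \<bullet> b"] by simp
    finally show "0 \<le> corner k p \<bullet> b \<longleftrightarrow> 0 \<le> p \<bullet> b" .
    have "corner k p \<bullet> b < 1 \<longleftrightarrow> real_of_int \<lfloor>2 ^ k * (p \<bullet> b)\<rfloor> < real_of_int (2 ^ k)"
      unfolding corner_inner[OF b] by simp
    also have "\<dots> \<longleftrightarrow> \<lfloor>2 ^ k * (p \<bullet> b)\<rfloor> < 2 ^ k" by (rule of_int_less_iff)
    also have "\<dots> \<longleftrightarrow> 2 ^ k * (p \<bullet> b) < 2 ^ k" by (simp add: floor_less_iff)
    finally show "corner k p \<bullet> b < 1 \<longleftrightarrow> p \<bullet> b < 1" by simp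
  qed
  then show ?thesis by (simp add: half_cube_def)
qed

section \<open>Strips of dyadic cells\<close>

definition slab :: "nat \<Rightarrow> nat \<Rightarrow> 'e::euclidean_space \<Rightarrow> int \<Rightarrow> 'e set" where
  "slab s k b i = {p. \<lfloor>2 ^ (k + s) * (p \<bullet> b)\<rfloor> mod 2 ^ s = i}"

lemma slab_borel [measurable]: "slab s k b i \<in> sets borel"
proof -
  have "slab s k b i = (\<lambda>p. \<lfloor>2 ^ (k + s) * (p \<bullet> b)\<rfloor>) -` {m. m mod 2 ^ s = i} \<inter> space borel"
    by (auto simp: slab_def)
  also have "\<dots> \<in> sets borel" by (rule measurable_sets[OF measurable_floor_dyadic]) simp
  finally show ?thesis .
qed

text \<open>Translation by \<open>i\<close> cells of level \<open>k + s\<close> in direction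
  \<open>b\<close> carries strip 0 to strip \<open>i\<close> without leaving the cells of level
  \<open>k\<close>. The \<open>2^s\<close> strips of a union of such cells therefore have equal
  measure.\<close>

lemma emeasure_slab:
  fixes b :: "'e::euclidean_space"
  assumes b: "b \<in> Basis" and i: "0 \<le> i" "i < 2 ^ s"
  shows "emeasure lborel ({p. P (corner k p)} \<inter> slab s k b i) = ennreal (1 / 2 ^ s) * emeasure lborel {p. P (corner k p)}"
proof -
  define A where "A = {p::'e. P (corner k p)}"
  have [measurable]: "A \<in> sets borel" unfolding A_def by (rule measurable_corner_pred)
  have shift: "emeasure lborel (A \<inter> slab s k b 0) = emeasure lborel (A \<inter> slab s k b i)" if i: "0 \<le> i" "i < 2 ^ s" for i
  proof -
    define c where "c = (real_of_int i / 2 ^ (k + s)) *\<^sub>R b"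
    have fl: "\<lfloor>2 ^ (k + s) * ((p + c) \<bullet> b)\<rfloor> = \<lfloor>2 ^ (k + s) * (p \<bullet> b)\<rfloor> + i" for p
    proof -
      have "2 ^ (k + s) * ((p + c) \<bullet> b) = 2 ^ (k + s) * (p \<bullet> b) + real_of_int i"
        using b by (simp add: c_def inner_add_left distrib_left)
      then show ?thesis by simp
    qed
    have fl': "(p + c) \<bullet> b' = p \<bullet> b'" if "b' \<in> Basis" "b' \<noteq> b" for p b'
      using that b by (simp add: c_def inner_add_left inner_Basis)
    have mod: "(m + i) mod 2 ^ s = i \<longleftrightarrow> m mod 2 ^ s = 0" for m :: int
    proof -
      have "(m + i) mod 2 ^ s = i \<longleftrightarrow> (m + i) mod 2 ^ s = i mod 2 ^ s" using i by simp
      also have "\<dots> \<longleftrightarrow> 2 ^ s dvd (m + i) - i" by (rule mod_eq_dvd_iff)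
      finally show ?thesis by (simp add: dvd_eq_mod_eq_0)
    qed
    have mem: "p \<in> A \<inter> slab s k b 0 \<longleftrightarrow> p + c \<in> A \<inter> slab s k b i" for p
    proof (cases "\<lfloor>2 ^ (k + s) * (p \<bullet> b)\<rfloor> mod 2 ^ s = 0")
      case True
      have "(\<lfloor>2 ^ (k + s) * (p \<bullet> b)\<rfloor> + i) div 2 ^ s = \<lfloor>2 ^ (k + s) * (p \<bullet> b)\<rfloor> div 2 ^ s"
        using True i by (simp add: div_add1_eq)
      then have "\<lfloor>2 ^ k * ((p + c) \<bullet> b)\<rfloor> = \<lfloor>2 ^ k * (p \<bullet> b)\<rfloor>"
        using floor_dyadic_div[of k "(p + c) \<bullet> b" s] floor_dyadic_div[of k "p \<bullet> b" s] fl[of p] by simp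
      then have "corner k (p + c) = corner k p" unfolding corner_eq_iff using fl' by metis
      then have "p \<in> A \<longleftrightarrow> p + c \<in> A" by (simp add: A_def)
      moreover have "p \<in> slab s k b 0" using True by (simp add: slab_def)
      moreover have "p + c \<in> slab s k b i" unfolding slab_def mem_Collect_eq fl mod by (rule True)
      ultimately show ?thesis by blast
    next
      case False
      have "p \<notin> slab s k b 0" using False by (simp add: slab_def)
      moreover have "p + c \<notin> slab s k b i" unfolding slab_def mem_Collect_eq fl mod by (rule False)
      ultimately show ?thesis by blast
    qed
    have "emeasure lborel (A \<inter> slab s k b 0) = (\<integral>\<^sup>+p. indicator (A \<inter> slab s k b 0) p \<partial>lborel)" by simp
    also have "\<dots> = (\<integral>\<^sup>+p. indicator (A \<inter> slab s k b i) (p + c) \<partial>lborel)"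
      by (rule nn_integral_cong) (simp only: indicator_def mem)
    also have "\<dots> = (\<integral>\<^sup>+p. indicator (A \<inter> slab s k b i) p \<partial>lborel)"
      by (rule nn_integral_lborel_translate) measurable
    finally show ?thesis by simp
  qed
  have "A = (\<Union>i\<in>{0..<2 ^ s}. A \<inter> slab s k b i)" by (auto simp: slab_def)
  then have "emeasure lborel A = emeasure lborel (\<Union>i\<in>{0..<2 ^ s}. A \<inter> slab s k b i)" by simp
  also have "\<dots> = (\<Sum>i\<in>{0..<2 ^ s}. emeasure lborel (A \<inter> slab s k b i))"
    by (rule sum_emeasure[symmetric]) (auto simp: disjoint_family_on_def slab_def[of s k b])
  also have "\<dots> = (\<Sum>i\<in>{0..<(2::int) ^ s}. emeasure lborel (A \<inter> slab s k b 0))"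
    by (rule sum.cong[OF refl]) (metis shift atLeastLessThan_iff)
  also have "\<dots> = ennreal (2 ^ s) * emeasure lborel (A \<inter> slab s k b 0)"
    by (simp add: ennreal_of_nat_eq_real_of_nat nat_power_eq)
  finally have "ennreal (1 / 2 ^ s) * emeasure lborel A = ennreal (1 / 2 ^ s) * ennreal (2 ^ s) * emeasure lborel (A \<inter> slab s k b 0)"
    by (simp add: mult.assoc)
  also have "ennreal (1 / 2 ^ s) * ennreal (2 ^ s) = 1" by (simp add: ennreal_mult[symmetric])
  finally show ?thesis using shift[OF i] by (simp add: A_def)
qed

lemma emeasure_half_cube_le: "emeasure lborel (half_cube :: 'e::euclidean_space set) \<le> 1"
proof -
  have "emeasure lborel (half_cube :: 'e set) \<le> emeasure lborel (cbox 0 (One::'e))"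
    by (intro emeasure_mono half_cube_subset_cbox) simp
  also have "\<dots> = 1" by (simp add: emeasure_lborel_cbox_eq)
  finally show ?thesis .
qed

text \<open>A state \<open>S\<close> is kept along the dyadic cells around a point for as long as it is admissible; the
  levels at which it has to be replaced are the breaks.\<close>

locale coding =
  fixes ok :: "'e::euclidean_space set \<Rightarrow> nat \<Rightarrow> 'e \<Rightarrow> bool"
    and nxt :: "nat \<Rightarrow> 'e \<Rightarrow> 'e set" and S0 :: "'e set"
begin

text \<open>Both \<open>ok\<close> and \<open>nxt\<close> are evaluated at the corner, so state,
  break and count at level \<open>k\<close> are constant on each cell of that level. A new state
  takes effect one level below the break.\<close>

primrec st :: "nat \<Rightarrow> 'e \<Rightarrow> 'e set" where
  "st 0 p = S0"
| "st (Suc k) p = (if ok (st k p) k (corner k p) then st k p else nxt k (corner k p))"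

definition brk :: "nat \<Rightarrow> 'e \<Rightarrow> bool" where
  "brk k p \<longleftrightarrow> \<not> ok (st k p) k (corner k p)"

definition cnt :: "nat \<Rightarrow> 'e \<Rightarrow> nat" where
  "cnt k p = card {j. j < k \<and> brk j p}"

lemma st_cong: "corner k p = corner k q \<Longrightarrow> st k p = st k q"
proof (induction k)
  case (Suc k)
  then have "corner k p = corner k q" using corner_eq_mono[of k 1 p q] by simp
  with Suc.IH show ?case by simp
qed simp

lemma brk_cong: "corner k p = corner k q \<Longrightarrow> brk k p = brk k q"
  using st_cong[of k p q] unfolding brk_def by metis

lemma st_Suc_brk: "brk k p \<Longrightarrow> st (Suc k) p = nxt k (corner k p)"
  by (simp add: brk_def)

lemma st_keep: "i \<le> k \<Longrightarrow> (\<And>j. i \<le> j \<Longrightarrow> j < k \<Longrightarrow> \<not> brk j p) \<Longrightarrow> st k p = st i p"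
proof (induction k rule: dec_induct)
  case (step n)
  have "\<not> brk n p" "st n p = st i p" using step by auto
  then show ?case by (simp add: brk_def)
qed simp

lemma cnt_0 [simp]: "cnt 0 p = 0"
  by (simp add: cnt_def)

lemma cnt_Suc: "cnt (Suc k) p = cnt k p + (if brk k p then 1 else 0)"
proof -
  have "{j. j < Suc k \<and> brk j p} = (if brk k p then insert k {j. j < k \<and> brk j p} else {j. j < k \<and> brk j p})"
    by (auto simp: less_Suc_eq)
  then show ?thesis by (simp add: cnt_def)
qed

lemma cnt_mono: "i \<le> k \<Longrightarrow> cnt i p \<le> cnt k p"
  unfolding cnt_def by (intro card_mono) auto

lemma cnt_keep: "i \<le> k \<Longrightarrow> (\<And>j. i \<le> j \<Longrightarrow> j < k \<Longrightarrow> \<not> brk j p) \<Longrightarrow> cnt k p = cnt i p"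
  by (induction k rule: dec_induct) (auto simp: cnt_Suc)

lemma cnt_cong: "corner k p = corner k q \<Longrightarrow> cnt k p = cnt k q"
proof -
  assume c: "corner k p = corner k q"
  have "brk j p = brk j q" if "j < k" for j
    using corner_eq_mono[of j "k - j" p q] c that by (intro brk_cong) simp
  then show ?thesis unfolding cnt_def by (metis (mono_tags, lifting))
qed

text \<open>At a given point the number of earlier breaks identifies a break. This makes it possible
  to record colors in a word indexed by that number.\<close>

lemma cnt_inj: "brk i p \<Longrightarrow> brk k p \<Longrightarrow> cnt i p = cnt k p \<Longrightarrow> i = k"
proof (rule ccontr)
  have lt: "cnt i p < cnt k p" if "brk i p" "i < k" for i k
    using cnt_mono[of "Suc i" k p] that by (simp add: cnt_Suc)
  assume "brk i p" "brk k p" "cnt i p = cnt k p" "i \<noteq> k"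
  then show False using lt[of i k] lt[of k i] by (cases i k rule: linorder_cases) auto
qed

lemma card_early_breaks: "card {k. k < K \<and> brk k p \<and> cnt k p < M} \<le> M"
proof -
  have "inj_on (\<lambda>k. cnt k p) {k. k < K \<and> brk k p \<and> cnt k p < M}"
    by (rule inj_onI) (use cnt_inj in blast)
  then have "card {k. k < K \<and> brk k p \<and> cnt k p < M} \<le> card {..<M}"
    by (rule card_inj_on_le) auto
  then show ?thesis by simp
qed

definition margin :: "nat \<Rightarrow> nat \<Rightarrow> 'e \<Rightarrow> bool" where
  "margin s k p \<longleftrightarrow> (\<forall>b\<in>Basis. p \<notin> slab s k b 0 \<and> p \<notin> slab s k b (2 ^ s - 1))"

text \<open>A point has at most \<open>M\<close> breaks with count below \<open>M\<close>, so the
  corresponding break cells have total measure at most \<open>M\<close>, however many levels they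
  are spread over. In each direction the two outer strips take the share \<open>2 / 2^s\<close> of
  them.\<close>

lemma emeasure_no_margin:
  "emeasure lborel {p \<in> half_cube. \<exists>k. brk k p \<and> cnt k p < M \<and> \<not> margin s k p} \<le> ennreal (2 * real DIM('e) * real M / 2 ^ s)"
proof -
  define A where "A k = {p \<in> half_cube. brk k p \<and> cnt k p < M}" for k
  have Ac: "A k = {p. corner k p \<in> half_cube \<and> brk k (corner k p) \<and> cnt k (corner k p) < M}" for k
  proof -
    have cc: "corner k (corner k p) = corner k p" for p :: 'e
      unfolding corner_eq_iff by (simp add: corner_inner)
    show ?thesis using brk_cong[OF cc] cnt_cong[OF cc] by (auto simp: A_def half_cube_corner)
  qed
  have [measurable]: "A k \<in> sets borel" for k unfolding Ac by (rule measurable_corner_pred)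
  define B where "B k = (\<Union>b\<in>Basis. (A k \<inter> slab s k b 0) \<union> (A k \<inter> slab s k b (2 ^ s - 1)))" for k
  have [measurable]: "B k \<in> sets borel" for k unfolding B_def by (intro sets.finite_UN) auto
  have Bk: "emeasure lborel (B k) \<le> ennreal (2 * real DIM('e) / 2 ^ s) * emeasure lborel (A k)" for k
  proof -
    have sl: "emeasure lborel (A k \<inter> slab s k b i) = ennreal (1 / 2 ^ s) * emeasure lborel (A k)"
      if "b \<in> Basis" "0 \<le> i" "i < 2 ^ s" for b i
      unfolding Ac using that by (rule emeasure_slab)
    have "emeasure lborel (B k) \<le> (\<Sum>b\<in>Basis. emeasure lborel ((A k \<inter> slab s k b 0) \<union> (A k \<inter> slab s k b (2 ^ s - 1))))"
      unfolding B_def by (rule emeasure_subadditive_finite) auto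
    also have "\<dots> \<le> (\<Sum>b\<in>(Basis::'e set). ennreal (1 / 2 ^ s) * emeasure lborel (A k) + ennreal (1 / 2 ^ s) * emeasure lborel (A k))"
    proof (rule sum_mono)
      fix b :: 'e assume b: "b \<in> Basis"
      have "emeasure lborel ((A k \<inter> slab s k b 0) \<union> (A k \<inter> slab s k b (2 ^ s - 1))) \<le>
        emeasure lborel (A k \<inter> slab s k b 0) + emeasure lborel (A k \<inter> slab s k b (2 ^ s - 1))"
        by (rule emeasure_subadditive) auto
      then show "emeasure lborel ((A k \<inter> slab s k b 0) \<union> (A k \<inter> slab s k b (2 ^ s - 1))) \<le>
        ennreal (1 / 2 ^ s) * emeasure lborel (A k) + ennreal (1 / 2 ^ s) * emeasure lborel (A k)"
        using sl[OF b, of 0] sl[OF b, of "2 ^ s - 1"] by simp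
    qed
    also have "\<dots> = of_nat DIM('e) * (ennreal (1 / 2 ^ s) * emeasure lborel (A k) + ennreal (1 / 2 ^ s) * emeasure lborel (A k))"
      by simp
    also have "\<dots> = (of_nat DIM('e) * (ennreal (1 / 2 ^ s) + ennreal (1 / 2 ^ s))) * emeasure lborel (A k)"
      by (simp add: distrib_left distrib_right mult.assoc)
    also have "of_nat DIM('e) * (ennreal (1 / 2 ^ s) + ennreal (1 / 2 ^ s)) = ennreal (2 * real DIM('e) / 2 ^ s)"
      unfolding ennreal_of_nat_eq_real_of_nat
      by (simp add: ennreal_plus[symmetric] ennreal_mult[symmetric] del: ennreal_plus)
    finally show ?thesis .
  qed
  have sumA: "(\<Sum>k<K. emeasure lborel (A k)) \<le> of_nat M" for K
  proof -
    have "(\<Sum>k<K. emeasure lborel (A k)) = (\<Sum>k<K. \<integral>\<^sup>+p. indicator (A k) p \<partial>lborel)" by simp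
    also have "\<dots> = (\<integral>\<^sup>+p. (\<Sum>k<K. indicator (A k) p) \<partial>lborel)"
      by (rule nn_integral_sum[symmetric]) measurable
    also have "\<dots> \<le> (\<integral>\<^sup>+p. of_nat M * indicator (half_cube :: 'e set) p \<partial>lborel)"
    proof (rule nn_integral_mono)
      fix p :: 'e
      have "(\<Sum>k<K. indicator (A k) p :: ennreal) = (\<Sum>k<K. if p \<in> A k then 1 else 0)"
        by (rule sum.cong) (auto simp: indicator_def)
      also have "\<dots> = of_nat (card ({..<K} \<inter> {k. p \<in> A k}))" by (simp add: sum.If_cases)
      also have "{..<K} \<inter> {k. p \<in> A k} = {k \<in> {..<K}. p \<in> A k}" by auto
      also have "of_nat (card {k \<in> {..<K}. p \<in> A k}) \<le> (of_nat M * indicator half_cube p :: ennreal)"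
      proof (cases "p \<in> half_cube")
        case True
        then have "{k \<in> {..<K}. p \<in> A k} = {k. k < K \<and> brk k p \<and> cnt k p < M}" by (auto simp: A_def)
        then show ?thesis using card_early_breaks[of K p M] True by simp
      next
        case False
        then have "{k \<in> {..<K}. p \<in> A k} = {}" by (auto simp: A_def)
        then show ?thesis by (simp only: card.empty) simp
      qed
      finally show "(\<Sum>k<K. indicator (A k) p :: ennreal) \<le> of_nat M * indicator half_cube p" .
    qed
    also have "\<dots> = of_nat M * emeasure lborel (half_cube :: 'e set)" by (rule nn_integral_cmult_indicator) simp
    also have "\<dots> \<le> of_nat M * 1" by (intro mult_left_mono emeasure_half_cube_le) simp
    finally show ?thesis by simp
  qed
  have "{p \<in> half_cube. \<exists>k. brk k p \<and> cnt k p < M \<and> \<not> margin s k p} \<subseteq> (\<Union>k. B k)"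
    by (auto simp: A_def B_def margin_def)
  then have "emeasure lborel {p \<in> half_cube. \<exists>k. brk k p \<and> cnt k p < M \<and> \<not> margin s k p} \<le> emeasure lborel (\<Union>k. B k)"
    by (rule emeasure_mono) simp
  also have "\<dots> \<le> (\<Sum>k. emeasure lborel (B k))"
    by (rule emeasure_subadditive_countably) auto
  also have "\<dots> \<le> (\<Sum>k. ennreal (2 * real DIM('e) / 2 ^ s) * emeasure lborel (A k))"
    by (intro suminf_le Bk) auto
  also have "\<dots> = ennreal (2 * real DIM('e) / 2 ^ s) * (\<Sum>k. emeasure lborel (A k))"
    by (rule ennreal_suminf_cmult)
  also have "(\<Sum>k. emeasure lborel (A k)) \<le> of_nat M"
    unfolding suminf_eq_SUP by (intro SUP_least sumA)
  also have "ennreal (2 * real DIM('e) / 2 ^ s) * of_nat M = ennreal (2 * real DIM('e) * real M / 2 ^ s)"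
    unfolding ennreal_of_nat_eq_real_of_nat by (simp add: ennreal_mult[symmetric])
  finally show ?thesis by (simp add: mult_left_mono)
qed

text \<open>A break at a flat level either follows a break at a non-flat level, or some difference
  quotient has fallen since the previous break.\<close>

lemma cnt_le_nonflat_dn:
  fixes fl :: "nat \<Rightarrow> bool" and D :: "'v \<Rightarrow> nat \<Rightarrow> nat" and h :: "'v \<Rightarrow> nat \<Rightarrow> bool" and V :: "'e set \<Rightarrow> 'v set"
  assumes fin: "finite W" "\<And>S. V S \<subseteq> W"
    and Dmono: "\<And>v i k. i \<le> k \<Longrightarrow> D v i \<le> D v k"
    and Ddrop: "\<And>v i k. h v i \<Longrightarrow> \<not> h v k \<Longrightarrow> i \<le> k \<Longrightarrow> D v i + 1 \<le> D v k"
    and up: "\<And>k v. brk k p \<Longrightarrow> fl k \<Longrightarrow> v \<in> V (nxt k (corner k p)) \<Longrightarrow> h v k"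
    and down: "\<And>k. brk k p \<Longrightarrow> fl k \<Longrightarrow> \<exists>v\<in>V (st k p). \<not> h v k"
  shows "cnt K p \<le> 2 * card {k. k < K \<and> \<not> fl k} + (\<Sum>v\<in>W. D v K) + 1"
proof -
  define nf where "nf K = card {k. k < K \<and> \<not> fl k}" for K
  have nfSuc: "nf (Suc k) = nf k + (if fl k then 0 else 1)" for k
  proof -
    have "{j. j < Suc k \<and> \<not> fl j} = (if fl k then {j. j < k \<and> \<not> fl j} else insert k {j. j < k \<and> \<not> fl j})"
      by (auto simp: less_Suc_eq)
    then show ?thesis by (simp add: nf_def)
  qed
  have nfmono: "i \<le> k \<Longrightarrow> nf i \<le> nf k" for i k unfolding nf_def by (intro card_mono) auto
  define Z where "Z k = (\<Sum>v\<in>W. D v k)" for k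
  have Zmono: "i \<le> k \<Longrightarrow> Z i \<le> Z k" for i k unfolding Z_def by (intro sum_mono Dmono)
  \<comment> \<open>A non-flat level pays for two breaks: its own, and the following one, before
    which nothing is known about the state. The extra summand on the left is this advance payment;
    the \<open>1\<close> on the right pays for the first break.\<close>
  have key: "brk k p \<Longrightarrow> cnt (Suc k) p + (if fl k then 0 else 1) \<le> 2 * nf (Suc k) + Z k + 1" for k
  proof (induction k rule: less_induct)
    case (less k)
    show ?case
    proof (cases "\<exists>i<k. brk i p")
      case False
      then have "cnt k p = 0" by (simp add: cnt_def)
      then show ?thesis using less.prems by (simp add: cnt_Suc nfSuc)
    next
      case True
      define i where "i = Max {i. i < k \<and> brk i p}"
      have "i \<in> {i. i < k \<and> brk i p}" unfolding i_def using True by (intro Max_in) auto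
      then have i: "i < k" "brk i p" by auto
      have nob: "\<not> brk l p" if "Suc i \<le> l" "l < k" for l
      proof
        assume "brk l p"
        then have "l \<le> i" unfolding i_def using that by (intro Max_ge) auto
        with that show False by simp
      qed
      have c: "cnt k p = cnt (Suc i) p" using i nob by (intro cnt_keep) auto
      have s: "st k p = nxt i (corner i p)" using st_keep[of "Suc i" k p] i nob st_Suc_brk[OF i(2)] by simp
      have IH: "cnt (Suc i) p + (if fl i then 0 else 1) \<le> 2 * nf (Suc i) + Z i + 1" using less.IH[OF i] .
      have nfk: "nf (Suc i) \<le> nf k" using i(1) by (intro nfmono) simp
      have zk: "Z i \<le> Z k" using i(1) by (intro Zmono) simp
      show ?thesis
      proof (cases "fl k \<and> fl i")
        case False
        then show ?thesis using IH nfk zk c less.prems by (auto simp: cnt_Suc nfSuc split: if_splits)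
      next
        case True
        obtain v where v: "v \<in> V (st k p)" "\<not> h v k" using down[OF less.prems] True by blast
        have "h v i" using up[OF i(2)] True v(1) s by simp
        then have "D v i + 1 \<le> D v k" using Ddrop v(2) i(1) by simp
        moreover have vW: "v \<in> W" using v(1) fin(2) by blast
        moreover have "(\<Sum>u\<in>W - {v}. D u i) \<le> (\<Sum>u\<in>W - {v}. D u k)" using i(1) by (intro sum_mono Dmono) simp
        ultimately have "Z i + 1 \<le> Z k" unfolding Z_def by (simp add: sum.remove[OF fin(1) vW])
        then show ?thesis using IH nfk c less.prems True by (simp add: cnt_Suc nfSuc)
      qed
    qed
  qed
  have "cnt K p \<le> 2 * nf K + Z K + 1"
  proof (cases "\<exists>i<K. brk i p")
    case False
    then have "cnt K p = 0" by (simp add: cnt_def)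
    then show ?thesis by simp
  next
    case True
    define i where "i = Max {i. i < K \<and> brk i p}"
    have "i \<in> {i. i < K \<and> brk i p}" unfolding i_def using True by (intro Max_in) auto
    then have i: "i < K" "brk i p" by auto
    have nob: "\<not> brk l p" if "Suc i \<le> l" "l < K" for l
    proof
      assume "brk l p"
      then have "l \<le> i" unfolding i_def using that by (intro Max_ge) auto
      with that show False by simp
    qed
    have "cnt K p = cnt (Suc i) p" using i nob by (intro cnt_keep) auto
    moreover have "nf (Suc i) \<le> nf K" "Z i \<le> Z K" using i(1) by (auto intro: nfmono Zmono)
    ultimately show ?thesis using key[OF i(2)] by linarith
  qed
  then show ?thesis by (simp add: nf_def Z_def)
qed

end

section \<open>The number of breaks\<close>

lemma not_steepE:
  assumes "\<not> steep e S r k c" obtains x v where "x \<in> cell k c" "v \<in> annulus S" "dq r k x v < e"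
  using assms unfolding steep_def by (auto simp: not_le)

text \<open>At a flat level without a thin cell the newly chosen state has quotients at least
  \<open>c1\<close>, and losing it takes one below \<open>c1 / 2\<close>. Through flatness and
  finite nets this shows as a downcrossing of one of finitely many sequences
  \<open>lseq r v p\<close>. The function \<open>g\<close>, which counts non-flat levels and
  downcrossings, has a bounded integral, and Chebyshev's inequality gives \<open>M\<close>. Both
  \<open>c\<close> and \<open>M\<close> are chosen before \<open>r\<close>.\<close>

proposition few_breaks:
  fixes n :: nat and S0 :: "'e::euclidean_space set"
  assumes al: "\<alpha> > 0" and eps: "\<epsilon> > 0" and n: "n \<le> DIM('e)" and S0: "S0 \<subseteq> Basis"
  obtains c :: real and M :: nat where "0 < c" "c \<le> 1/2"
    "\<And>r. pm (r :: 'e \<Rightarrow> 'e \<Rightarrow> real) \<Longrightarrow> \<exists>nxt H. (\<forall>k x. nxt k x \<subseteq> Basis \<and> card (nxt k x) = n) \<and>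
       H \<in> sets borel \<and> emeasure lborel H \<le> ennreal \<epsilon> \<and>
       (\<forall>p\<in>half_cube - H. (\<forall>k. \<not> thin \<alpha> n r k (corner k p)) \<longrightarrow>
          (\<forall>K. coding.cnt (\<lambda>S k x. steep c S r k x) nxt S0 K p \<le> M))"
proof -
  let ?d = "real DIM('e)"
  have d1: "?d \<ge> 1" by (simp add: Suc_leI)
  obtain j1 where j1: "j1 > 0" "\<And>r k (c::'e). \<lbrakk>pm r; flat j1 r k c; \<not> thin \<alpha> n r k c\<rbrakk> \<Longrightarrow>
     \<exists>S\<subseteq>Basis. card S = n \<and> steep (1 / real j1) S r k c"
    using flat_thick_steep[OF al, of n] by metis
  define c1 where "c1 = 1 / real j1"
  have c1: "0 < c1" "c1 \<le> 1" using j1(1) by (simp_all add: c1_def)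
  have net: "\<exists>F. finite F \<and> F \<subseteq> annulus S \<and> (\<forall>v\<in>annulus S. \<exists>u\<in>F. dist v u < c1 / 20)" for S :: "'e set"
    using compact_finite_net[OF compact_annulus, of "c1 / 20" S] c1 by (metis divide_pos_pos zero_less_numeral)
  then obtain V :: "'e set \<Rightarrow> 'e set" where V: "\<And>S. finite (V S)" "\<And>S. V S \<subseteq> annulus S"
     "\<And>S v. v \<in> annulus S \<Longrightarrow> \<exists>u\<in>V S. dist v u < c1 / 20" by metis
  define W where "W = (\<Union>S\<in>Pow Basis. V S)"
  have W: "finite W" using V(1) by (simp add: W_def)
  have annD: "?d / 2 \<le> norm v" "norm v \<le> 2 * ?d" if "v \<in> annulus S" for v :: 'e and S
    using that by (auto simp: annulus_def)
  \<comment> \<open>\<open>J\<close> makes the shift term in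
    \<open>flat_translation_insensitive\<close> at most \<open>c1 / 20\<close> for shifts up to
    \<open>4 d\<close>. Then \<open>j2\<close> does the same for the other term, and its window
    admits base points up to \<open>3 d\<close> and vectors up to \<open>2 d\<close> doubled
    \<open>J\<close> times.\<close>
  obtain J where J: "160 * ?d / c1 < 2 ^ J" using real_arch_pow[of 2] by auto
  obtain j2 :: nat where j2: "max (real j1) (max (2 ^ J * (2 * ?d)) (max (40 / c1) (3 * ?d))) < real j2"
    using reals_Archimedean2 by blast
  have jj: "real j1 < real j2" "2 ^ J * (2 * ?d) \<le> real j2" "40 / c1 < real j2" "3 * ?d \<le> real j2"
    using j2 by auto
  have j0: "j2 > 0" "j1 \<le> j2" using jj(1) by auto
  obtain C1 where C1: "\<forall>r K. pm (r :: 'e \<Rightarrow> 'e \<Rightarrow> real) \<longrightarrow>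
    (\<Sum>k<K. emeasure lborel {p \<in> half_cube. \<not> flat j2 r k (corner k p)}) \<le> ennreal C1"
    using nonflat_measure[OF j0(1)] by blast
  \<comment> \<open>In units of \<open>c1\<close>: changing the base point costs \<open>1/10\<close>
    and the net \<open>1/20\<close>. A new state shows at least \<open>1 - 1/10\<close>, which
    exceeds \<open>8/10\<close>; a lost one shows at most \<open>1/2 + 1/20 + 1/10\<close>, which is
    below \<open>7/10\<close>.\<close>
  define a b where "a = 7/10 * c1" and "b = 8/10 * c1"
  have ab: "0 \<le> a" "a < b" using c1 by (auto simp: a_def b_def)
  have Wnz: "v \<noteq> 0" if "v \<in> W" for v
    using that V(2) annD(1)[of v] d1 unfolding W_def by fastforce
  have "\<forall>v\<in>W. \<exists>C. \<forall>r K. pm r \<longrightarrow> (\<integral>\<^sup>+p. indicator half_cube p * ennreal (real (dn a b (lseq r v p) K)) \<partial>lborel) \<le> ennreal C"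
    using downcrossings_bounded[OF Wnz ab] by blast
  from bchoice[OF this] obtain C2 where C2: "\<forall>v\<in>W. \<forall>r K. pm r \<longrightarrow>
      (\<integral>\<^sup>+p. indicator half_cube p * ennreal (real (dn a b (lseq r v p) K)) \<partial>lborel) \<le> ennreal (C2 v)" by blast
  define C where "C = 2 * max 0 C1 + (\<Sum>v\<in>W. max 0 (C2 v)) + 1"
  have C: "C > 0" unfolding C_def by (simp add: add_nonneg_pos sum_nonneg)
  obtain M :: nat where M: "C / \<epsilon> < real M" using reals_Archimedean2 by blast
  have M0: "real M > 0" using M C eps by (smt (verit) divide_pos_pos)
  \<comment> \<open>Default state where no steep set exists. At a point without thin cells this
    happens only at non-flat levels, to which the consequences are charged.\<close>
  obtain Sd :: "'e set" where Sd: "Sd \<subseteq> Basis" "card Sd = n" using n by (meson obtain_subset_with_card_n)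
  show thesis
  proof (rule that[of "c1 / 2" M])
    show "0 < c1 / 2" "c1 / 2 \<le> 1 / 2" using c1 by auto
    fix r :: "'e \<Rightarrow> 'e \<Rightarrow> real" assume r: "pm r"
    define nxt where "nxt k x = (if \<exists>S\<subseteq>Basis. card S = n \<and> steep c1 S r k x then SOME S. S \<subseteq> Basis \<and> card S = n \<and> steep c1 S r k x else Sd)" for k x
    have nxt: "nxt k x \<subseteq> Basis \<and> card (nxt k x) = n" for k x
    proof (cases "\<exists>S\<subseteq>Basis. card S = n \<and> steep c1 S r k x")
      case True
      then have "\<exists>S. S \<subseteq> Basis \<and> card S = n \<and> steep c1 S r k x" by blast
      from someI_ex[OF this] show ?thesis unfolding nxt_def if_P[OF True] by blast
    next
      case False
      show ?thesis unfolding nxt_def if_not_P[OF False] using Sd by blast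
    qed
    have nxt_steep: "steep c1 (nxt k x) r k x" if "\<exists>S\<subseteq>Basis. card S = n \<and> steep c1 S r k x" for k x
    proof -
      from that have "\<exists>S. S \<subseteq> Basis \<and> card S = n \<and> steep c1 S r k x" by blast
      from someI_ex[OF this] show ?thesis unfolding nxt_def if_P[OF that] by blast
    qed
    interpret coding "\<lambda>S k x. steep (c1 / 2) S r k x" nxt S0 .
    define E where "E k = {p \<in> half_cube. \<not> flat j2 r k (corner k p)}" for k
    have [measurable]: "E k \<in> sets borel" for k
    proof -
      have "E k = half_cube \<inter> {p. \<not> flat j2 r k (corner k p)}" by (auto simp: E_def)
      also have "\<dots> \<in> sets borel" by (intro sets.Int half_cube_borel measurable_corner_pred)
      finally show ?thesis .
    qed
    have lm [measurable]: "(\<lambda>p. lseq r v p k) \<in> borel_measurable borel" for v k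
      unfolding lseq_def by (rule measurable_dq[OF r]) measurable
    have [measurable]: "(\<lambda>p. dn a b (lseq r v p) K) \<in> measurable borel (count_space UNIV)" for v K
      by (rule measurable_hi_dn(2)) measurable
    define g where "g K p = 2 * (\<Sum>k<K. indicator (E k) p) +
       ((\<Sum>v\<in>W. indicator half_cube p * ennreal (real (dn a b (lseq r v p) K))) + indicator half_cube p)" for K and p :: 'e
    have [measurable]: "g K \<in> borel_measurable borel" for K unfolding g_def by measurable
    have gint: "(\<integral>\<^sup>+p. g K p \<partial>lborel) \<le> ennreal C" for K
    proof -
      have "(\<integral>\<^sup>+p. g K p \<partial>lborel) = (\<integral>\<^sup>+p. 2 * (\<Sum>k<K. indicator (E k) p) \<partial>lborel) +
        (\<integral>\<^sup>+p. (\<Sum>v\<in>W. indicator half_cube p * ennreal (real (dn a b (lseq r v p) K))) + indicator half_cube p \<partial>lborel)"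
        unfolding g_def by (rule nn_integral_add) measurable
      also have "(\<integral>\<^sup>+p. 2 * (\<Sum>k<K. indicator (E k) p) \<partial>lborel) = 2 * (\<integral>\<^sup>+p. (\<Sum>k<K. indicator (E k) p) \<partial>lborel)"
        by (rule nn_integral_cmult) measurable
      also have "(\<integral>\<^sup>+p. (\<Sum>v\<in>W. indicator half_cube p * ennreal (real (dn a b (lseq r v p) K))) + indicator half_cube p \<partial>lborel) =
        (\<integral>\<^sup>+p. (\<Sum>v\<in>W. indicator half_cube p * ennreal (real (dn a b (lseq r v p) K))) \<partial>lborel) + (\<integral>\<^sup>+p. indicator (half_cube :: 'e set) p \<partial>lborel)"
        by (rule nn_integral_add) measurable
      finally have eq: "(\<integral>\<^sup>+p. g K p \<partial>lborel) = 2 * (\<integral>\<^sup>+p. (\<Sum>k<K. indicator (E k) p) \<partial>lborel) +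
        ((\<integral>\<^sup>+p. (\<Sum>v\<in>W. indicator half_cube p * ennreal (real (dn a b (lseq r v p) K))) \<partial>lborel) + (\<integral>\<^sup>+p. indicator (half_cube :: 'e set) p \<partial>lborel))" .
      have "(\<integral>\<^sup>+p. (\<Sum>k<K. indicator (E k) p) \<partial>lborel) = (\<Sum>k<K. \<integral>\<^sup>+p. indicator (E k) p \<partial>lborel)"
        by (rule nn_integral_sum) measurable
      also have "\<dots> = (\<Sum>k<K. emeasure lborel (E k))" by simp
      also have "\<dots> \<le> ennreal C1" unfolding E_def by (rule C1[rule_format, OF r])
      also have "\<dots> \<le> ennreal (max 0 C1)" by (simp add: ennreal_leI)
      finally have i1: "(\<integral>\<^sup>+p. (\<Sum>k<K. indicator (E k) p) \<partial>lborel) \<le> ennreal (max 0 C1)" .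
      have "(\<integral>\<^sup>+p. (\<Sum>v\<in>W. indicator half_cube p * ennreal (real (dn a b (lseq r v p) K))) \<partial>lborel) =
         (\<Sum>v\<in>W. \<integral>\<^sup>+p. indicator half_cube p * ennreal (real (dn a b (lseq r v p) K)) \<partial>lborel)"
        by (rule nn_integral_sum) measurable
      also have "\<dots> \<le> (\<Sum>v\<in>W. ennreal (max 0 (C2 v)))"
      proof (rule sum_mono)
        fix v assume "v \<in> W"
        from C2[rule_format, OF this r, of K] show "(\<integral>\<^sup>+p. indicator half_cube p * ennreal (real (dn a b (lseq r v p) K)) \<partial>lborel) \<le> ennreal (max 0 (C2 v))"
          by (rule order_trans) (simp add: ennreal_leI)
      qed
      also have "\<dots> = ennreal (\<Sum>v\<in>W. max 0 (C2 v))" by (rule sum_ennreal) simp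
      finally have i2: "(\<integral>\<^sup>+p. (\<Sum>v\<in>W. indicator half_cube p * ennreal (real (dn a b (lseq r v p) K))) \<partial>lborel) \<le> ennreal (\<Sum>v\<in>W. max 0 (C2 v))" .
      have i3: "(\<integral>\<^sup>+p. indicator (half_cube :: 'e set) p \<partial>lborel) \<le> 1" using emeasure_half_cube_le by simp
      have "(\<integral>\<^sup>+p. g K p \<partial>lborel) \<le> 2 * ennreal (max 0 C1) + (ennreal (\<Sum>v\<in>W. max 0 (C2 v)) + 1)"
        unfolding eq by (intro add_mono mult_left_mono i1 i2 i3) simp
      also have "\<dots> = ennreal C"
      proof -
        have t: "2 * ennreal x + (ennreal y + 1) = ennreal (2 * x + y + 1)" if "x \<ge> 0" "y \<ge> 0" for x y
          using that by (simp add: ennreal_mult ennreal_plus add.assoc)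
        show ?thesis unfolding C_def by (rule t) (simp_all add: sum_nonneg)
      qed
      finally show ?thesis .
    qed
    \<comment> \<open>The sets increase with \<open>K\<close>, so the bound for each
      \<open>K\<close> passes to the union and a single exceptional set serves all levels.\<close>
    define H where "H = (\<Union>K. {p. 1 \<le> ennreal (1 / real M) * g K p})"
    have Hm [measurable]: "{p. 1 \<le> ennreal (1 / real M) * g K p} \<in> sets borel" for K by measurable
    have gmono: "g K p \<le> g (Suc K) p" for K p
      unfolding g_def
      by (intro add_mono mult_left_mono sum_mono2 sum_mono) (auto intro!: ennreal_leI dn_mono of_nat_mono simp del: dn.simps)
    have inc: "incseq (\<lambda>K. {p. 1 \<le> ennreal (1 / real M) * g K p})"
    proof (rule incseq_SucI, rule Collect_mono, rule impI)
      fix K p assume "1 \<le> ennreal (1 / real M) * g K p"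
      also have "\<dots> \<le> ennreal (1 / real M) * g (Suc K) p" by (intro mult_left_mono gmono) simp
      finally show "1 \<le> ennreal (1 / real M) * g (Suc K) p" .
    qed
    have HK: "emeasure lborel {p. 1 \<le> ennreal (1 / real M) * g K p} \<le> ennreal \<epsilon>" for K
    proof -
      have "emeasure lborel {p. 1 \<le> ennreal (1 / real M) * g K p} = (\<integral>\<^sup>+p. indicator {p. 1 \<le> ennreal (1 / real M) * g K p} p \<partial>lborel)" by simp
      also have "\<dots> \<le> (\<integral>\<^sup>+p. ennreal (1 / real M) * g K p \<partial>lborel)"
        by (rule nn_integral_mono) (auto simp: indicator_def)
      also have "\<dots> = ennreal (1 / real M) * (\<integral>\<^sup>+p. g K p \<partial>lborel)" by (rule nn_integral_cmult) measurable
      also have "\<dots> \<le> ennreal (1 / real M) * ennreal C" by (intro mult_left_mono gint) simp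
      also have "\<dots> = ennreal (C / real M)" by (simp add: ennreal_mult'[symmetric])
      also have "\<dots> \<le> ennreal \<epsilon>" using M M0 eps by (intro ennreal_leI) (simp add: field_simps)
      finally show ?thesis .
    qed
    have "emeasure lborel H = (SUP K. emeasure lborel {p. 1 \<le> ennreal (1 / real M) * g K p})"
      unfolding H_def by (rule SUP_emeasure_incseq[symmetric]) (use inc in auto)
    also have "\<dots> \<le> ennreal \<epsilon>" by (intro SUP_least HK)
    finally have Hmeas: "emeasure lborel H \<le> ennreal \<epsilon>" .
    have "cnt K p \<le> M" if p: "p \<in> half_cube" "p \<notin> H" and thick: "\<And>k. \<not> thin \<alpha> n r k (corner k p)" for p K
    proof -
      let ?fl = "\<lambda>k. flat j2 r k (corner k p)"
      \<comment> \<open>The base point on the line is within \<open>norm v \<le> 2 d\<close> cell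
        sides of \<open>p\<close> but may lie outside the cell; hence the window of radius
        \<open>3 d\<close>.\<close>
      have ins: "\<bar>dq r k x v - lseq r v p k\<bar> \<le> c1 / 10" if fl: "?fl k" and x: "x \<in> cell k (corner k p)" and v: "v \<in> annulus S" for k x v S
      proof -
        define w where "w = 2 ^ k *\<^sub>R (x - corner k p)"
        define w' where "w' = 2 ^ k *\<^sub>R (lbase v k p - corner k p)"
        have xw: "x = corner k p + (1/2)^k *\<^sub>R w" "lbase v k p = corner k p + (1/2)^k *\<^sub>R w'"
          unfolding w_def w'_def by (rule rescale_inverse[symmetric])+
        have nw: "norm w \<le> ?d" using x unfolding mem_cell_rescale w_def by (rule norm_cube_le)
        have v0: "v \<noteq> 0" using annD(1)[OF v] d1 by auto
        have "w' = 2 ^ k *\<^sub>R (lbase v k p - p) + 2 ^ k *\<^sub>R (p - corner k p)" unfolding w'_def by (simp add: algebra_simps)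
        then have "norm w' \<le> norm (2 ^ k *\<^sub>R (lbase v k p - p)) + norm (2 ^ k *\<^sub>R (p - corner k p))" by (metis norm_triangle_ineq)
        also have "norm (2 ^ k *\<^sub>R (p - corner k p)) \<le> ?d" by (rule norm_cube_le[OF corner_offset_mem])
        also have "norm (2 ^ k *\<^sub>R (lbase v k p - p)) = 2 ^ k * norm (lbase v k p - p)" by simp
        also have "\<dots> \<le> 2 ^ k * ((1/2) ^ k * norm v)" by (intro mult_left_mono norm_lbase_offset v0) simp
        also have "\<dots> = norm v" by (simp add: power_one_over)
        finally have nw': "norm w' \<le> 3 * ?d" using annD(2)[OF v] by linarith
        have "norm (w - w') \<le> 4 * ?d" using norm_triangle_ineq4[of w w'] nw nw' by linarith
        then have "2 * norm (w - w') / 2 ^ J \<le> 8 * ?d / 2 ^ J" by (intro divide_right_mono) auto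
        also have "\<dots> \<le> c1 / 20" using J c1 by (simp add: field_simps)
        finally have A: "2 * norm (w - w') / 2 ^ J \<le> c1 / 20" .
        have B: "2 / real j2 \<le> c1 / 20" using jj(3) c1 j0 by (simp add: field_simps)
        have "2 ^ J * norm v \<le> 2 ^ J * (2 * ?d)" using annD(2)[OF v] by (intro mult_left_mono) auto
        then have "2 ^ J * norm v \<le> real j2" using jj(2) by linarith
        from flat_translation_insensitive[OF r fl this, of w w'] nw nw' jj(4) d1
        have "\<bar>dq r k x v - dq r k (lbase v k p) v\<bar> \<le> 2 / real j2 + 2 * norm (w - w') / 2 ^ J"
          unfolding xw by simp
        then show ?thesis using A B unfolding lseq_def by linarith
      qed
      have "cnt K p \<le> 2 * card {k. k < K \<and> \<not> ?fl k} + (\<Sum>v\<in>W. dn a b (lseq r v p) K) + 1"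
      proof (rule cnt_le_nonflat_dn[where V = "\<lambda>S. if S \<subseteq> Basis then V S else {}" and h = "\<lambda>v. hi a b (lseq r v p)"])
        show "finite W" by (rule W)
        show "(if S \<subseteq> Basis then V S else {}) \<subseteq> W" for S by (auto simp: W_def)
        show "dn a b (lseq r v p) i \<le> dn a b (lseq r v p) k" if "i \<le> k" for v i k by (rule dn_mono[OF that])
        show "dn a b (lseq r v p) i + 1 \<le> dn a b (lseq r v p) k"
          if "hi a b (lseq r v p) i" "\<not> hi a b (lseq r v p) k" "i \<le> k" for v i k by (rule dn_drop[OF that])
        show "hi a b (lseq r v p) k" if "brk k p" "?fl k" "v \<in> (if nxt k (corner k p) \<subseteq> Basis then V (nxt k (corner k p)) else {})" for k v
        proof -
          have v: "v \<in> annulus (nxt k (corner k p))" using that(3) V(2) by (auto split: if_splits)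
          have "\<exists>S\<subseteq>Basis. card S = n \<and> steep c1 S r k (corner k p)"
            unfolding c1_def by (rule j1(2)[OF r flat_mono[OF that(2) j0(2) j1(1)] thick])
          then have "c1 \<le> dq r k p v" using nxt_steep mem_cell_corner v unfolding steep_def by blast
          then have "b \<le> lseq r v p k" using ins[OF that(2) mem_cell_corner v] unfolding b_def by linarith
          then show ?thesis by (rule hi_if)
        qed
        show "\<exists>v\<in>(if st k p \<subseteq> Basis then V (st k p) else {}). \<not> hi a b (lseq r v p) k" if "brk k p" "?fl k" for k
        proof -
          have stB: "st k p \<subseteq> Basis" by (induction k) (use S0 nxt in auto)
          have ns: "\<not> steep (c1 / 2) (st k p) r k (corner k p)" using that(1) unfolding brk_def .
          obtain x v where xv: "x \<in> cell k (corner k p)" "v \<in> annulus (st k p)" "dq r k x v < c1 / 2"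
            by (rule not_steepE[OF ns])
          obtain u where u: "u \<in> V (st k p)" "dist v u < c1 / 20" using V(3)[OF xv(2)] by blast
          have ua: "u \<in> annulus (st k p)" using u(1) V(2) by blast
          have "\<bar>dq r k x v - dq r k x u\<bar> \<le> c1 / 20"
            using dq_lip[OF r, of k x v x u] u(2) by (simp add: dist_norm)
          then have "lseq r u p k \<le> a" using ins[OF that(2) xv(1) ua] xv(3) unfolding a_def by linarith
          then have "\<not> hi a b (lseq r u p) k" by (rule not_hi_if[OF ab(2)])
          then show ?thesis using u(1) stB by auto
        qed
      qed
      also have "\<dots> < M"
      proof (rule ccontr)
        define X where "X = 2 * card {k. k < K \<and> \<not> ?fl k} + (\<Sum>v\<in>W. dn a b (lseq r v p) K) + 1"
        assume "\<not> ?thesis"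
        then have "\<not> X < M" unfolding X_def .
        then have XM: "real M \<le> real X" by simp
        have "(\<Sum>k<K. indicator (E k) p :: ennreal) = (\<Sum>k<K. if \<not> ?fl k then 1 else 0)"
          using p(1) by (intro sum.cong) (auto simp: indicator_def E_def)
        also have "\<dots> = of_nat (card ({..<K} \<inter> {k. \<not> ?fl k}))" by (simp add: sum.If_cases)
        also have "{..<K} \<inter> {k. \<not> ?fl k} = {k. k < K \<and> \<not> ?fl k}" by auto
        finally have e1: "(\<Sum>k<K. indicator (E k) p :: ennreal) = of_nat (card {k. k < K \<and> \<not> ?fl k})" .
        have e2: "(\<Sum>v\<in>W. indicator half_cube p * ennreal (real (dn a b (lseq r v p) K))) = of_nat (\<Sum>v\<in>W. dn a b (lseq r v p) K)"
          using p(1) by (simp add: ennreal_of_nat_eq_real_of_nat)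
        have "g K p = of_nat X" unfolding g_def e1 e2 X_def using p(1) by (simp add: add.assoc)
        also have "\<dots> = ennreal (real X)" by (rule ennreal_of_nat_eq_real_of_nat)
        finally have "ennreal (1 / real M) * g K p = ennreal (real X / real M)" by (simp add: ennreal_mult'[symmetric])
        moreover have "ennreal 1 \<le> ennreal (real X / real M)" using XM M0 by (intro ennreal_leI) simp
        ultimately have "1 \<le> ennreal (1 / real M) * g K p" by simp
        then have "p \<in> H" unfolding H_def by blast
        then show False using p(2) by simp
      qed
      finally show ?thesis by simp
    qed
    then show "\<exists>nxt H. (\<forall>k x. nxt k x \<subseteq> Basis \<and> card (nxt k x) = n) \<and>
       H \<in> sets borel \<and> emeasure lborel H \<le> ennreal \<epsilon> \<and>
       (\<forall>p\<in>half_cube - H. (\<forall>k. \<not> thin \<alpha> n r k (corner k p)) \<longrightarrow>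
          (\<forall>K. coding.cnt (\<lambda>S k x. steep (c1 / 2) S r k x) nxt S0 K p \<le> M))"
      using nxt Hmeas Hm unfolding H_def by (intro exI[of _ nxt] exI[of _ H]) (auto simp: H_def)
  qed
qed

subsection \<open>Gluing isometries across the breaks\<close>

lemma corner_idem: "corner k (corner k p) = corner k p"
  unfolding corner_eq_iff by (simp add: corner_inner)

lemma borel_corner_invariant:
  assumes "\<And>p q. corner m p = corner m q \<Longrightarrow> Q p = Q q"
  shows "{p::'e::euclidean_space. Q p} \<in> sets borel"
proof -
  have "{p. Q p} = {p. Q (corner m p)}" using assms corner_idem by metis
  then show ?thesis by (simp only: measurable_corner_pred)
qed

text \<open>Strict because the cells are half-open. The strict form is what rules out a common cell
  at the level of the distance of two points.\<close>

lemma dist_same_corner: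
  fixes p q :: "'e::euclidean_space"
  assumes "corner k p = corner k q"
  shows "dist p q < real DIM('e) * (1/2) ^ k"
proof -
  have 1: "\<bar>(p - q) \<bullet> b\<bar> < (1/2) ^ k" if b: "b \<in> Basis" for b
  proof -
    have "\<lfloor>2 ^ k * (p \<bullet> b)\<rfloor> = \<lfloor>2 ^ k * (q \<bullet> b)\<rfloor>" using assms b corner_eq_iff by blast
    then have "\<bar>2 ^ k * (p \<bullet> b) - 2 ^ k * (q \<bullet> b)\<bar> < 1" by linarith
    then have "2 ^ k * \<bar>p \<bullet> b - q \<bullet> b\<bar> < 1" by (simp add: abs_mult flip: right_diff_distrib)
    then show ?thesis by (simp add: inner_diff_left power_one_over field_simps)
  qed
  have "dist p q \<le> (\<Sum>b\<in>Basis. \<bar>(p - q) \<bullet> b\<bar>)" unfolding dist_norm by (rule norm_le_l1)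
  also have "\<dots> < (\<Sum>b\<in>(Basis::'e set). (1/2) ^ k)" by (rule sum_strict_mono) (use 1 in auto)
  finally show ?thesis by simp
qed

lemma dist_half_cube:
  fixes p q :: "'e::euclidean_space"
  assumes "p \<in> half_cube" "q \<in> half_cube"
  shows "dist p q \<le> real DIM('e)"
proof -
  have "\<bar>(p - q) \<bullet> b\<bar> \<le> 1" if b: "b \<in> Basis" for b
  proof -
    have "0 \<le> p \<bullet> b" "p \<bullet> b < 1" "0 \<le> q \<bullet> b" "q \<bullet> b < 1"
      using assms b unfolding half_cube_def by blast+
    then show ?thesis by (simp add: inner_diff_left)
  qed
  then have "(\<Sum>b\<in>Basis. \<bar>(p - q) \<bullet> b\<bar>) \<le> (\<Sum>b\<in>(Basis::'e set). 1)" by (intro sum_mono)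
  then show ?thesis unfolding dist_norm using norm_le_l1[of "p - q"] by simp
qed

text \<open>If \<open>u\<close> avoids both outer strips of its cell, a whole strip of length 1
  separates it from every number in another cell.\<close>

lemma coordinate_gap:
  fixes u w :: real
  assumes e: "\<lfloor>u\<rfloor> mod 2 ^ s \<noteq> 0" "\<lfloor>u\<rfloor> mod 2 ^ s \<noteq> 2 ^ s - 1"
    and ne: "\<lfloor>u\<rfloor> div 2 ^ s \<noteq> \<lfloor>w\<rfloor> div (2::int) ^ s"
  shows "1 \<le> \<bar>u - w\<bar>"
proof -
  define z :: int where "z = 2 ^ s"
  have z: "z > 0" by (simp add: z_def)
  define m m' where "m = \<lfloor>u\<rfloor> div z" and "m' = \<lfloor>w\<rfloor> div z"
  define r where "r = \<lfloor>u\<rfloor> mod z"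
  have r: "0 \<le> r" "r < z" "r \<noteq> 0" "r \<noteq> z - 1" using e z by (auto simp: r_def z_def)
  have u: "\<lfloor>u\<rfloor> = z * m + r" by (simp add: m_def r_def)
  have w: "z * m' \<le> \<lfloor>w\<rfloor>" "\<lfloor>w\<rfloor> < z * m' + z"
    using z pos_mod_sign[of z "\<lfloor>w\<rfloor>"] pos_mod_bound[of z "\<lfloor>w\<rfloor>"] mult_div_mod_eq[of z "\<lfloor>w\<rfloor>"] unfolding m'_def by linarith+
  have "m \<noteq> m'" using ne by (simp add: m_def m'_def z_def)
  then consider "m + 1 \<le> m'" | "m' + 1 \<le> m" by linarith
  then show ?thesis
  proof cases
    case 1
    have "z * (m + 1) \<le> z * m'" using 1 z by (intro mult_left_mono) auto
    then have "\<lfloor>u\<rfloor> + 2 \<le> \<lfloor>w\<rfloor>" using u w r by (simp add: distrib_left)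
    then show ?thesis by linarith
  next
    case 2
    have "z * (m' + 1) \<le> z * m" using 2 z by (intro mult_left_mono) auto
    then have "\<lfloor>w\<rfloor> + 2 \<le> \<lfloor>u\<rfloor>" using u w r by (simp add: distrib_left)
    then show ?thesis by linarith
  qed
qed

lemma mod_eq_gap:
  fixes x y :: int
  assumes "x mod n = y mod n" "x \<noteq> y" "n > 0" shows "n \<le> \<bar>x - y\<bar>"
proof -
  have "n dvd x - y" using assms(1) by (simp add: mod_eq_dvd_iff)
  then show ?thesis using assms(2) dvd_imp_le_int[of "x - y" n] assms(3) by simp
qed

text \<open>The color of a break records its level modulo \<open>s + DIM\<close> and the position of the cell of
  level \<open>k + J\<close> modulo \<open>2 DIM + 1\<close> cells of level \<open>k\<close>: points of one piece either share that cell or are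
  far apart.\<close>

locale gluing = coding ok nxt S0
  for ok :: "'e::euclidean_space set \<Rightarrow> nat \<Rightarrow> 'e \<Rightarrow> bool" and nxt :: "nat \<Rightarrow> 'e \<Rightarrow> 'e set" and S0 :: "'e set" +
  fixes P :: "'e set \<Rightarrow> 'e \<Rightarrow> 'e" and J s M :: nat
  assumes linP: "\<And>S. linear (P S)" and normP: "\<And>S x. norm (P S x) = norm x"
begin

definition col :: "nat \<Rightarrow> 'e \<Rightarrow> nat \<times> ('e \<Rightarrow> int)" where
  "col k p = (k mod (s + DIM('e)),
     restrict (\<lambda>b. \<lfloor>2 ^ (k + J) * (p \<bullet> b)\<rfloor> mod ((2 * int DIM('e) + 1) * 2 ^ J)) Basis)"

definition codes :: "(nat \<Rightarrow> nat \<times> ('e \<Rightarrow> int)) set" where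
  "codes = PiE {..<M} (\<lambda>_. {..<s + DIM('e)} \<times> PiE Basis (\<lambda>_. {0..<(2 * int DIM('e) + 1) * 2 ^ J}))"

definition piece :: "(nat \<Rightarrow> nat \<times> ('e \<Rightarrow> int)) \<Rightarrow> 'e set" where
  "piece w = {p \<in> half_cube. \<forall>k. brk k p \<longrightarrow> cnt k p < M \<and> col k p = w (cnt k p) \<and> margin s k p}"

text \<open>A center and its image, through which \<open>apx k\<close> is the isometry with linear
  part \<open>P (st k p)\<close>. At a break the old isometry determines the image of the new
  center, so the old and the new one agree there. The center comes from level \<open>k + J\<close>,
  hence at \<open>p\<close> they differ by \<open>O(2^-(k+J))\<close> only.\<close>

primrec anchor :: "nat \<Rightarrow> 'e \<Rightarrow> 'e \<times> 'e" where
  "anchor 0 p = (0, 0)"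
| "anchor (Suc k) p = (if brk k p then (corner (k + J) p, snd (anchor k p) + P (st k p) (corner (k + J) p - fst (anchor k p)))
     else anchor k p)"

definition apx :: "nat \<Rightarrow> 'e \<Rightarrow> 'e" where
  "apx k p = snd (anchor k p) + P (st k p) (p - fst (anchor k p))"

definition \<phi> :: "'e \<Rightarrow> 'e" where
  "\<phi> p = apx (LEAST K. \<forall>k\<ge>K. \<not> brk k p) p"

text \<open>Equal break levels and equal centers at all levels before \<open>k\<close> make two
  points use the same isometry at level \<open>k\<close>.\<close>

definition agree :: "nat \<Rightarrow> 'e \<Rightarrow> 'e \<Rightarrow> bool" where
  "agree k p q \<longleftrightarrow> (\<forall>j<k. (brk j p \<longleftrightarrow> brk j q) \<and> (brk j p \<longrightarrow> corner (j + J) p = corner (j + J) q))"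

lemma P_diff: "P S (x - y) = P S x - P S y"
  by (rule linear_diff[OF linP])

lemma finite_codes: "finite codes"
  unfolding codes_def by (intro finite_PiE finite_cartesian_product) auto

lemma card_codes: "card codes = ((s + DIM('e)) * ((2 * DIM('e) + 1) * 2 ^ J) ^ DIM('e)) ^ M"
proof -
  have "nat ((2 * int DIM('e) + 1) * 2 ^ J) = (2 * DIM('e) + 1) * 2 ^ J"
    by (simp add: nat_mult_distrib nat_add_distrib nat_power_eq)
  then show ?thesis unfolding codes_def by (simp add: card_PiE card_cartesian_product)
qed

lemma col_mem: "col k p \<in> {..<s + DIM('e)} \<times> PiE Basis (\<lambda>_. {0..<(2 * int DIM('e) + 1) * 2 ^ J})"
  unfolding col_def by auto

lemma piece_borel: "piece w \<in> sets borel"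
proof -
  have "piece w = half_cube \<inter> (\<Inter>k. {p. brk k p \<longrightarrow> cnt k p < M \<and> col k p = w (cnt k p) \<and> margin s k p})"
    by (auto simp: piece_def)
  also have "\<dots> \<in> sets borel"
  proof (intro sets.Int half_cube_borel sets.countable_INT'')
    fix k
    \<comment> \<open>Count and break are decided by the corner of level \<open>k\<close>, the color
      by that of level \<open>k + J\<close>, the margin by that of level
      \<open>k + s\<close>.\<close>
    show "{p. brk k p \<longrightarrow> cnt k p < M \<and> col k p = w (cnt k p) \<and> margin s k p} \<in> sets borel"
    proof (rule borel_corner_invariant[of "k + J + s"])
      fix p q :: 'e assume c: "corner (k + J + s) p = corner (k + J + s) q"
      have cJ: "corner (k + J) p = corner (k + J) q" by (rule corner_eq_mono[OF c])
      have ck: "corner k p = corner k q" by (rule corner_eq_mono[OF cJ])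
      have "corner (k + s + J) p = corner (k + s + J) q" using c by (simp add: ac_simps)
      then have cs: "corner (k + s) p = corner (k + s) q" by (rule corner_eq_mono)
      have "brk k p = brk k q" "cnt k p = cnt k q" using brk_cong[OF ck] cnt_cong[OF ck] by auto
      moreover have "col k p = col k q"
        using cJ unfolding corner_eq_iff col_def by (auto intro!: restrict_ext)
      moreover have "margin s k p = margin s k q"
        using cs unfolding corner_eq_iff margin_def slab_def by auto
      ultimately show "(brk k p \<longrightarrow> cnt k p < M \<and> col k p = w (cnt k p) \<and> margin s k p) =
        (brk k q \<longrightarrow> cnt k q < M \<and> col k q = w (cnt k q) \<and> margin s k q)" by simp
    qed
  qed auto
  finally show ?thesis .
qed

lemma pieces_cover:
  assumes p: "p \<in> half_cube" and few: "\<And>K. cnt K p \<le> M" and marg: "\<And>k. brk k p \<Longrightarrow> margin s k p"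
  shows "\<exists>w\<in>codes. p \<in> piece w"
proof
  \<comment> \<open>A number that is not the count of any break receives the color of
    \<open>p\<close> at an arbitrary level, which still belongs to the alphabet.\<close>
  define w where "w = restrict (\<lambda>i. col (SOME k. brk k p \<and> cnt k p = i) p) {..<M}"
  show "w \<in> codes" unfolding codes_def w_def using col_mem by (intro restrict_PiE_iff[THEN iffD2]) blast
  have "cnt k p < M \<and> col k p = w (cnt k p)" if "brk k p" for k
  proof -
    have lt: "cnt k p < M" using few[of "Suc k"] that by (simp add: cnt_Suc)
    have "(SOME k'. brk k' p \<and> cnt k' p = cnt k p) = k"
      by (rule some_equality) (use that cnt_inj in auto)
    then show ?thesis using lt by (simp add: w_def)
  qed
  then show "p \<in> piece w" using p marg by (simp add: piece_def)
qed

lemma piece_finite_breaks: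
  assumes p: "p \<in> piece w" shows "\<exists>K. \<forall>k\<ge>K. \<not> brk k p"
proof -
  have c: "cnt k p \<le> M" for k
  proof (induction k)
    case (Suc k)
    then show ?case using p by (auto simp: cnt_Suc piece_def)
  qed simp
  have "finite {k. brk k p}"
  proof (rule ccontr)
    assume "infinite {k. brk k p}"
    then obtain T where T: "T \<subseteq> {k. brk k p}" "finite T" "card T = Suc M"
      using infinite_arbitrarily_large by blast
    obtain K where K: "\<forall>k\<in>T. k < K" using T(2) finite_nat_set_iff_bounded by blast
    have "card T \<le> cnt K p" unfolding cnt_def using T(1) K by (intro card_mono) auto
    then show False using c[of K] T(3) by simp
  qed
  then obtain K where "\<forall>k\<in>{k. brk k p}. k < K" using finite_nat_set_iff_bounded by blast
  then show ?thesis by (metis leD mem_Collect_eq)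
qed

lemma apx_Suc: "norm (apx (Suc k) p - apx k p) \<le> 2 * real DIM('e) * (1/2) ^ (k + J)"
proof (cases "brk k p")
  case True
  define a b c where "a = fst (anchor k p)" and "b = snd (anchor k p)" and "c = corner (k + J) p"
  let ?S = "st k p" and ?S' = "st (Suc k) p"
  have "apx (Suc k) p - apx k p = b + P ?S (c - a) + P ?S' (p - c) - (b + P ?S (p - a))"
    using True by (simp add: apx_def a_def b_def c_def)
  also have "\<dots> = P ?S' (p - c) - P ?S (p - c)" by (simp add: P_diff)
  finally have "norm (apx (Suc k) p - apx k p) \<le> norm (P ?S' (p - c)) + norm (P ?S (p - c))"
    by (metis norm_triangle_ineq4)
  then show ?thesis using norm_corner_offset[of p "k + J"] by (simp add: normP c_def)
next
  case False
  then have "apx (Suc k) p = apx k p" by (simp add: apx_def brk_def)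
  then show ?thesis by simp
qed

text \<open>The changes at successive levels form a geometric series. The subtracted tail keeps the
  induction going.\<close>

lemma apx_diff: "i \<le> k \<Longrightarrow> norm (apx k p - apx i p) \<le> 4 * real DIM('e) * ((1/2) ^ (i + J) - (1/2) ^ (k + J))"
proof (induction k rule: dec_induct)
  case (step k)
  have "norm (apx (Suc k) p - apx i p) \<le> norm (apx (Suc k) p - apx k p) + norm (apx k p - apx i p)"
    using norm_triangle_ineq[of "apx (Suc k) p - apx k p" "apx k p - apx i p"] by simp
  also have "\<dots> \<le> 2 * real DIM('e) * (1/2) ^ (k + J) + 4 * real DIM('e) * ((1/2) ^ (i + J) - (1/2) ^ (k + J))"
    by (intro add_mono apx_Suc step.IH)
  also have "\<dots> = 4 * real DIM('e) * ((1/2) ^ (i + J) - (1/2) ^ (Suc k + J))"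
    by (simp add: algebra_simps)
  finally show ?case .
qed simp

lemma apx_stable:
  assumes "\<forall>k\<ge>K. \<not> brk k p" "K \<le> k" shows "apx k p = apx K p"
  using assms(2)
proof (induction k rule: dec_induct)
  case (step k)
  then have "\<not> brk k p" using assms(1) by simp
  then have "apx (Suc k) p = apx k p" by (simp add: apx_def brk_def)
  with step show ?case by simp
qed simp

lemma \<phi>_apx:
  assumes "p \<in> piece w" shows "norm (\<phi> p - apx k p) \<le> 4 * real DIM('e) * (1/2) ^ (k + J)"
proof -
  define K where "K = (LEAST K. \<forall>k\<ge>K. \<not> brk k p)"
  have K: "\<forall>k\<ge>K. \<not> brk k p" unfolding K_def by (rule LeastI_ex[OF piece_finite_breaks[OF assms]])
  have eq: "\<phi> p = apx K p" by (simp add: \<phi>_def K_def)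
  show ?thesis
  proof (cases "K \<le> k")
    case True
    then show ?thesis using apx_stable[OF K True] by (simp add: eq)
  next
    case False
    then have "norm (apx K p - apx k p) \<le> 4 * real DIM('e) * ((1/2) ^ (k + J) - (1/2) ^ (K + J))"
      by (intro apx_diff) simp
    also have "\<dots> \<le> 4 * real DIM('e) * (1/2) ^ (k + J)" by (intro mult_left_mono) auto
    finally show ?thesis by (simp add: eq)
  qed
qed

lemma norm_\<phi>_le: "p \<in> piece w \<Longrightarrow> norm (\<phi> p) \<le> 5 * real DIM('e)"
proof -
  assume p: "p \<in> piece w"
  have "apx 0 p = P S0 p" by (simp add: apx_def)
  then have "norm (apx 0 p) = norm p" by (simp add: normP)
  also have "\<dots> \<le> real DIM('e)"
    using p half_cube_subset_cbox norm_cube_le by (fastforce simp: piece_def)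
  finally have "norm (apx 0 p) \<le> real DIM('e)" .
  moreover have "norm (\<phi> p - apx 0 p) \<le> 4 * real DIM('e) * (1/2) ^ (0 + J)" by (rule \<phi>_apx[OF p])
  moreover have "4 * real DIM('e) * (1/2) ^ (0 + J) \<le> 4 * real DIM('e) * 1"
    by (intro mult_left_mono power_le_one) auto
  moreover have "norm (\<phi> p) \<le> norm (\<phi> p - apx 0 p) + norm (apx 0 p)"
    using norm_triangle_ineq[of "\<phi> p - apx 0 p" "apx 0 p"] by simp
  ultimately show ?thesis by linarith
qed

lemma agree_Suc: "agree (Suc k) p q \<longleftrightarrow> agree k p q \<and> (brk k p \<longleftrightarrow> brk k q) \<and> (brk k p \<longrightarrow> corner (k + J) p = corner (k + J) q)"
  unfolding agree_def by (auto simp: less_Suc_eq)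

lemma agree_sym: "agree k p q \<longleftrightarrow> agree k q p"
  unfolding agree_def by metis

lemma agree_same: "agree k p q \<Longrightarrow> st k p = st k q \<and> anchor k p = anchor k q \<and> cnt k p = cnt k q"
proof (induction k)
  case (Suc k)
  then have a: "agree k p q" "brk k p \<longleftrightarrow> brk k q" "brk k p \<Longrightarrow> corner (k + J) p = corner (k + J) q"
    by (auto simp: agree_Suc)
  have IH: "st k p = st k q" "anchor k p = anchor k q" "cnt k p = cnt k q" using Suc.IH[OF a(1)] by auto
  show ?case
  proof (cases "brk k p")
    case True
    have "corner k p = corner k q" by (rule corner_eq_mono[OF a(3)[OF True]])
    moreover have "brk k q" using True a(2) by simp
    ultimately have "st (Suc k) p = st (Suc k) q" using st_Suc_brk[OF True] st_Suc_brk[of k q] by metis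
    then show ?thesis using True \<open>brk k q\<close> IH a(3)[OF True] by (simp add: cnt_Suc del: st.simps)
  next
    case False
    then have "\<not> brk k q" using a(2) by simp
    then show ?thesis using False IH by (simp add: cnt_Suc brk_def)
  qed
qed simp

lemma \<phi>_diff:
  assumes p: "p \<in> piece w" and q: "q \<in> piece w" and a: "agree k p q"
  shows "norm (\<phi> p - \<phi> q - P (st k p) (p - q)) \<le> 8 * real DIM('e) * (1/2) ^ (k + J)"
proof -
  have "apx k p - apx k q = P (st k p) (p - q)"
    using agree_same[OF a] by (simp add: apx_def P_diff)
  then have "\<phi> p - \<phi> q - P (st k p) (p - q) = (\<phi> p - apx k p) - (\<phi> q - apx k q)" by (simp add: algebra_simps)
  then have "norm (\<phi> p - \<phi> q - P (st k p) (p - q)) \<le> norm (\<phi> p - apx k p) + norm (\<phi> q - apx k q)"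
    by (metis norm_triangle_ineq4)
  then show ?thesis using \<phi>_apx[OF p, of k] \<phi>_apx[OF q, of k] by linarith
qed

text \<open>The margin of \<open>p\<close> and the different cells at level \<open>k\<close> keep
  the points \<open>2^-(k+s)\<close> apart, so \<open>l < k + s + d\<close>. The first break of
  \<open>q\<close> from level \<open>k\<close> on would have the same count as the break of
  \<open>p\<close>, hence the same color, hence a level congruent to \<open>k\<close> modulo
  \<open>s + d\<close>; that lies deeper than \<open>l\<close>.\<close>

lemma single_break:
  assumes p: "p \<in> piece w" and q: "q \<in> piece w" and a: "agree k p q"
    and b: "brk k p" "\<not> brk k q" and l: "k \<le> l" "dist p q < 2 * real DIM('e) * (1/2) ^ l"
  shows "\<not> brk l q" "st l q = st k q" "(1/2) ^ (k + s) \<le> dist p q"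
proof -
  have "corner k p \<noteq> corner k q" using brk_cong b by blast
  then obtain i where i: "i \<in> Basis" "\<lfloor>2 ^ k * (p \<bullet> i)\<rfloor> \<noteq> \<lfloor>2 ^ k * (q \<bullet> i)\<rfloor>" using corner_eq_iff by blast
  have "margin s k p" using p b(1) by (simp add: piece_def)
  then have m: "\<lfloor>2 ^ (k + s) * (p \<bullet> i)\<rfloor> mod 2 ^ s \<noteq> 0" "\<lfloor>2 ^ (k + s) * (p \<bullet> i)\<rfloor> mod 2 ^ s \<noteq> 2 ^ s - 1"
    using i(1) by (auto simp: margin_def slab_def)
  have "1 \<le> \<bar>2 ^ (k + s) * (p \<bullet> i) - 2 ^ (k + s) * (q \<bullet> i)\<bar>"
    by (rule coordinate_gap[OF m]) (use i(2) floor_dyadic_div[of k _ s] in metis)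
  also have "\<dots> = 2 ^ (k + s) * \<bar>(p - q) \<bullet> i\<bar>" by (simp add: abs_mult inner_diff_left flip: right_diff_distrib)
  also have "\<dots> \<le> 2 ^ (k + s) * dist p q" unfolding dist_norm by (intro mult_left_mono Basis_le_norm i) simp
  finally show gap: "(1/2) ^ (k + s) \<le> dist p q" by (simp add: power_one_over field_simps)
  \<comment> \<open>At level \<open>k + s + d\<close> the bound on the distance would be
    \<open>2 d / 2^d\<close> times \<open>2^-(k+s)\<close>, and \<open>2 d \<le> 2^d\<close>. This
    is the origin of the modulus \<open>s + d\<close>.\<close>
  have lk: "l < k + (s + DIM('e))"
  proof (rule ccontr)
    assume "\<not> ?thesis"
    then have "(1/2::real) ^ l \<le> (1/2) ^ (k + s + DIM('e))" by (intro power_decreasing) auto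
    then have "2 * real DIM('e) * (1/2) ^ l \<le> 2 * real DIM('e) * ((1/2) ^ (k + s) * (1/2) ^ DIM('e))"
      by (intro mult_left_mono) (auto simp: power_add)
    also have "\<dots> = (2 * real DIM('e) / 2 ^ DIM('e)) * (1/2) ^ (k + s)" by (simp add: power_one_over)
    also have "\<dots> \<le> 1 * (1/2) ^ (k + s)"
    proof (rule mult_right_mono)
      have "2 * n \<le> 2 ^ n" if "n \<ge> 1" for n :: nat
        using that by (induction n rule: dec_induct) auto
      then have "2 * DIM('e) \<le> 2 ^ DIM('e)" by (simp add: Suc_leI)
      then have "real (2 * DIM('e)) \<le> real (2 ^ DIM('e))" by (rule of_nat_mono)
      then show "2 * real DIM('e) / 2 ^ DIM('e) \<le> 1" by simp
    qed simp
    finally show False using gap l(2) by simp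
  qed
  have nob: "\<not> brk j q" if "k \<le> j" "j \<le> l" for j
  proof
    assume "brk j q"
    define k' where "k' = (LEAST k'. k \<le> k' \<and> brk k' q)"
    have k': "k \<le> k'" "brk k' q" using LeastI[of "\<lambda>k'. k \<le> k' \<and> brk k' q" j] \<open>brk j q\<close> that by (auto simp: k'_def)
    have "k' \<le> j" unfolding k'_def by (rule Least_le) (use \<open>brk j q\<close> that in auto)
    have "k \<noteq> k'" using k'(2) b(2) by auto
    then have kk: "k < k'" "k' < k + (s + DIM('e))" using k'(1) \<open>k' \<le> j\<close> that lk by auto
    have "\<not> brk i q" if "k \<le> i" "i < k'" for i using not_less_Least[of i "\<lambda>k'. k \<le> k' \<and> brk k' q"] that by (auto simp: k'_def)
    then have "cnt k' q = cnt k q" using k'(1) by (intro cnt_keep) auto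
    also have "\<dots> = cnt k p" using agree_same[OF a] by simp
    finally have "col k' q = col k p" using p q b(1) k'(2) by (simp add: piece_def)
    then have "k' mod (s + DIM('e)) = k mod (s + DIM('e))" by (simp add: col_def)
    then have "(s + DIM('e)) dvd k' - k" using kk(1) by (simp add: mod_eq_dvd_iff_nat)
    then have "s + DIM('e) \<le> k' - k" using kk(1) by (intro dvd_imp_le) auto
    then show False using kk by simp
  qed
  show "\<not> brk l q" using nob l(1) by simp
  show "st l q = st k q" using l(1) nob by (intro st_keep) auto
qed

text \<open>If the histories agree through the level \<open>l\<close> of the distance, the common
  isometry applies. Otherwise consider the first disagreement \<open>k \<le> l\<close>. If both
  points break there with different centers, their equal colors put them too far apart. If only one
  breaks, the other point \<open>x\<close> keeps the common state down to \<open>l\<close>, and the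
  error \<open>2^-(k+J)\<close> is at most \<open>2^s / 2^J\<close> times the distance. That
  \<open>x\<close> does not break at \<open>l\<close> later supplies the steepness of its
  state.\<close>

proposition pair_scale:
  assumes p: "p \<in> piece w" and q: "q \<in> piece w" and pq: "p \<noteq> q"
  shows "\<exists>l. \<exists>x\<in>{p, q}. \<not> brk l x \<and> real DIM('e) * (1/2) ^ l \<le> dist p q \<and> dist p q < 2 * real DIM('e) * (1/2) ^ l \<and>
    norm (\<phi> p - \<phi> q - P (st l x) (p - q)) \<le> 8 * real DIM('e) * 2 ^ s / 2 ^ J * dist p q"
proof -
  let ?d = "real DIM('e)"
  have d1: "?d \<ge> 1" by (simp add: Suc_leI)
  have pqh: "p \<in> half_cube" "q \<in> half_cube" using p q by (auto simp: piece_def)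
  define l where "l = (LEAST l. ?d * (1/2) ^ l \<le> dist p q)"
  obtain n where n: "(1/2::real) ^ n < dist p q / ?d" using real_arch_pow_inv[of "dist p q / ?d" "1/2"] pq d1 by auto
  then have "?d * (1/2) ^ n \<le> dist p q" using d1 by (simp add: field_simps)
  then have l1: "?d * (1/2) ^ l \<le> dist p q" unfolding l_def by (rule LeastI)
  have l2: "dist p q < 2 * ?d * (1/2) ^ l"
  proof (cases l)
    \<comment> \<open>At level 0 minimality says nothing, and the size of the cube gives the
      bound.\<close>
    case 0
    have "dist p q < 2 * ?d" using dist_half_cube[OF pqh] d1 by linarith
    then show ?thesis by (simp add: 0)
  next
    case (Suc m)
    then have "\<not> ?d * (1/2) ^ m \<le> dist p q" using not_less_Least[of m "\<lambda>l. ?d * (1/2) ^ l \<le> dist p q"] by (simp add: l_def)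
    then show ?thesis by (simp add: Suc)
  qed
  have l2': "dist q p < 2 * ?d * (1/2) ^ l" using l2 by (simp add: dist_commute)
  have err: "8 * ?d * (1/2) ^ (k + J) \<le> 8 * ?d * 2 ^ s / 2 ^ J * dist p q" if "(1/2) ^ (k + s) \<le> dist p q" for k
  proof -
    have "8 * ?d * (1/2) ^ (k + J) = 8 * ?d * 2 ^ s / 2 ^ J * (1/2) ^ (k + s)" by (simp add: power_add power_one_over)
    also have "\<dots> \<le> 8 * ?d * 2 ^ s / 2 ^ J * dist p q" using that by (intro mult_left_mono) auto
    finally show ?thesis .
  qed
  show ?thesis
  proof (cases "agree (Suc l) p q")
    case True
    then have a: "agree l p q" "brk l p \<Longrightarrow> corner (l + J) p = corner (l + J) q" by (auto simp: agree_Suc)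
    have nb: "\<not> brk l p"
    proof
      assume "brk l p"
      then have "corner l p = corner l q" by (intro corner_eq_mono[of l J] a(2))
      from dist_same_corner[OF this] l1 show False by simp
    qed
    have "(1/2) ^ (l + s) \<le> dist p q"
    proof -
      have "(1/2::real) ^ (l + s) \<le> 1 * (1/2) ^ l" by (simp add: power_add mult_left_le power_le_one)
      also have "\<dots> \<le> ?d * (1/2) ^ l" using d1 by (intro mult_right_mono) auto
      finally show ?thesis using l1 by simp
    qed
    from order_trans[OF \<phi>_diff[OF p q a(1)] err[OF this]] show ?thesis using nb l1 l2 by blast
  next
    case False
    define k where "k = (LEAST k. \<not> agree (Suc k) p q)"
    have k: "\<not> agree (Suc k) p q" unfolding k_def by (rule LeastI[of "\<lambda>k. \<not> agree (Suc k) p q", OF False])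
    have kl: "k \<le> l" unfolding k_def by (rule Least_le[of "\<lambda>k. \<not> agree (Suc k) p q", OF False])
    have a: "agree k p q"
    proof (cases k)
      case 0
      then show ?thesis by (simp add: agree_def)
    next
      case (Suc m)
      then show ?thesis using not_less_Least[of m "\<lambda>k. \<not> agree (Suc k) p q"] by (simp add: k_def)
    qed
    have a': "agree k q p" using a agree_sym by blast
    consider "brk k p" "brk k q" "corner (k + J) p \<noteq> corner (k + J) q" | "brk k p" "\<not> brk k q" | "brk k q" "\<not> brk k p"
      using k a by (auto simp: agree_Suc)
    then show ?thesis
    proof cases
      case 1
      have "col k p = col k q" using p q 1 agree_same[OF a] by (simp add: piece_def)
      then have c: "\<lfloor>2 ^ (k + J) * (p \<bullet> b)\<rfloor> mod ((2 * int DIM('e) + 1) * 2 ^ J) = \<lfloor>2 ^ (k + J) * (q \<bullet> b)\<rfloor> mod ((2 * int DIM('e) + 1) * 2 ^ J)"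
        if "b \<in> Basis" for b using that unfolding col_def by (metis (no_types, lifting) restrict_apply' prod.inject)
      obtain b where b: "b \<in> Basis" "\<lfloor>2 ^ (k + J) * (p \<bullet> b)\<rfloor> \<noteq> \<lfloor>2 ^ (k + J) * (q \<bullet> b)\<rfloor>"
        using 1(3) corner_eq_iff by blast
      have "(2 * int DIM('e) + 1) * 2 ^ J \<le> \<bar>\<lfloor>2 ^ (k + J) * (p \<bullet> b)\<rfloor> - \<lfloor>2 ^ (k + J) * (q \<bullet> b)\<rfloor>\<bar>"
        by (rule mod_eq_gap[OF c[OF b(1)] b(2)]) simp
      then have "real_of_int ((2 * int DIM('e) + 1) * 2 ^ J) \<le> real_of_int \<bar>\<lfloor>2 ^ (k + J) * (p \<bullet> b)\<rfloor> - \<lfloor>2 ^ (k + J) * (q \<bullet> b)\<rfloor>\<bar>"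
        by (simp only: of_int_le_iff)
      \<comment> \<open>Dropping the floors costs 1. The last summand of \<open>2 d + 1\<close>
        contributes \<open>2^J\<close>, which is at least as much.\<close>
      then have "(2 * ?d + 1) * 2 ^ J - 1 \<le> \<bar>2 ^ (k + J) * (p \<bullet> b) - 2 ^ (k + J) * (q \<bullet> b)\<bar>"
        by (simp; linarith)
      also have "\<dots> = 2 ^ (k + J) * \<bar>(p - q) \<bullet> b\<bar>" by (simp add: abs_mult inner_diff_left flip: right_diff_distrib)
      also have "\<dots> \<le> 2 ^ (k + J) * dist p q" unfolding dist_norm by (intro mult_left_mono Basis_le_norm b) simp
      also have "\<dots> < 2 ^ (k + J) * (2 * ?d * (1/2) ^ l)" using l2 by (intro mult_strict_left_mono) auto
      also have "\<dots> \<le> 2 ^ (k + J) * (2 * ?d * (1/2) ^ k)" using kl by (intro mult_left_mono power_decreasing) auto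
      also have "\<dots> = 2 * ?d * 2 ^ J" by (simp add: power_add power_one_over)
      finally have "2 ^ J < (1::real)" by (simp add: algebra_simps)
      moreover have "(1::real) \<le> 2 ^ J" by simp
      ultimately show ?thesis by linarith
    next
      case 2
      note sb = single_break[OF p q a 2 kl l2]
      have "st l q = st k p" using sb(2) agree_same[OF a] by simp
      then have "norm (\<phi> p - \<phi> q - P (st l q) (p - q)) \<le> 8 * ?d * 2 ^ s / 2 ^ J * dist p q"
        using order_trans[OF \<phi>_diff[OF p q a] err[OF sb(3)]] by simp
      then show ?thesis using sb(1) l1 l2 by blast
    next
      case 3
      note sb = single_break[OF q p a' 3 kl l2']
      have "(1/2) ^ (k + s) \<le> dist p q" using sb(3) by (simp add: dist_commute)
      from order_trans[OF \<phi>_diff[OF p q a] err[OF this]] sb(2)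
      have "norm (\<phi> p - \<phi> q - P (st l p) (p - q)) \<le> 8 * ?d * 2 ^ s / 2 ^ J * dist p q" by simp
      then show ?thesis using sb(1) l1 l2 by blast
    qed
  qed
qed

end

subsection \<open>Mapping content\<close>

lemma ediam_mcball_le:
  assumes "s \<ge> 0" shows "ediam X (mcball_of X x s) \<le> ennreal (2 * s)"
  unfolding ediam_def
proof (intro SUP_least ennreal_leI)
  fix y z assume y: "y \<in> mcball_of X x s" and z: "z \<in> mcball_of X x s"
  then have "mdist X y z \<le> mdist X y x + mdist X x z" by (intro mdist_triangle) auto
  then show "mdist X y z \<le> 2 * s" using y z by (simp add: mdist_commute[of X y x])
qed

lemma hausdorff_content_le_card:
  assumes Y: "finite Y" "Y \<subseteq> mspace X" and s: "s > 0"
    and cov: "\<And>a. a \<in> A \<Longrightarrow> \<exists>y\<in>Y. a \<in> mspace X \<and> mdist X y a \<le> s"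
  shows "hausdorff_content X k A \<le> ennreal (real (card Y) * (2 * s) ^ k)"
proof -
  define \<B> where "\<B> = (\<lambda>y. mcball_of X y s) ` Y"
  have fin: "finite \<B>" using Y by (simp add: \<B>_def)
  have mem: "\<B> \<in> {\<B>. \<B> \<subseteq> closed_balls X \<and> countable \<B> \<and> A \<subseteq> \<Union>\<B>}"
    using Y s cov fin unfolding \<B>_def closed_balls_def by (fastforce simp: countable_finite)
  have "hausdorff_content X k A \<le> (\<Sum>\<^sub>\<infinity>B\<in>\<B>. ediam X B ^ k)"
    unfolding hausdorff_content_def by (rule INF_lower[OF mem])
  also have "\<dots> = (\<Sum>B\<in>\<B>. ediam X B ^ k)" using fin by simp
  also have "\<dots> \<le> (\<Sum>B\<in>\<B>. ennreal (2 * s) ^ k)"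
    using s by (intro sum_mono power_mono) (auto simp: \<B>_def ediam_mcball_le)
  also have "\<dots> = of_nat (card \<B>) * ennreal (2 * s) ^ k" by simp
  also have "\<dots> \<le> of_nat (card Y) * ennreal (2 * s) ^ k"
    using card_image_le[OF Y(1)] by (intro mult_right_mono) (auto simp: \<B>_def)
  also have "\<dots> = ennreal (real (card Y) * (2 * s) ^ k)"
  proof -
    have "ennreal (2 * s) ^ k = ennreal ((2 * s) ^ k)" using s by (intro ennreal_power) simp
    then show ?thesis using s by (simp only: ennreal_of_nat_eq_real_of_nat) (simp add: ennreal_mult')
  qed
  finally show ?thesis .
qed

section \<open>Dyadic cells in the unit cube\<close>

lemma cell_dyadic: "cell k (corner k x) \<in> dyadic_cubes"
proof -
  define c where "c = 2 ^ k *\<^sub>R corner k x"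
  have h: "(2::real) powi (- int k) = (1/2) ^ k" by (simp add: power_int_minus power_one_over inverse_eq_divide)
  have 1: "corner k x = (1/2) ^ k *\<^sub>R c" by (simp add: c_def power_one_over)
  have "cell k (corner k x) = cbox ((2 powi (- int k)) *\<^sub>R c) ((2 powi (- int k)) *\<^sub>R (c + One))"
    unfolding cell_def h scaleR_add_right 1[symmetric] ..
  moreover have "\<forall>b\<in>Basis. c \<bullet> b \<in> \<int>" by (simp add: c_def corner_inner)
  ultimately show ?thesis unfolding dyadic_cubes_def by blast
qed

lemma side_cell: "side (cell k c) = (1/2) ^ k"
  unfolding cell_def by (rule side_cbox) simp

lemma corner_half_cube_bounds:
  assumes x: "x \<in> half_cube" and b: "b \<in> Basis"
  shows "0 \<le> corner k x \<bullet> b" "corner k x \<bullet> b + (1/2) ^ k \<le> 1"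
proof -
  have "corner k x \<in> half_cube" using x half_cube_corner by blast
  then have c: "0 \<le> corner k x \<bullet> b" "corner k x \<bullet> b < 1" using b by (auto simp: half_cube_def)
  then show "0 \<le> corner k x \<bullet> b" by simp
  have "real_of_int \<lfloor>2 ^ k * (x \<bullet> b)\<rfloor> < real_of_int (2 ^ k)"
    using c(2) by (simp add: corner_inner[OF b])
  then have "\<lfloor>2 ^ k * (x \<bullet> b)\<rfloor> < 2 ^ k" by (simp only: of_int_less_iff)
  then have "\<lfloor>2 ^ k * (x \<bullet> b)\<rfloor> + 1 \<le> 2 ^ k" by simp
  then have "real_of_int (\<lfloor>2 ^ k * (x \<bullet> b)\<rfloor> + 1) \<le> real_of_int (2 ^ k)" by (simp only: of_int_le_iff)
  then show "corner k x \<bullet> b + (1/2) ^ k \<le> 1" by (simp add: corner_inner[OF b] power_one_over field_simps)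
qed

lemma cell_subset_unit: "x \<in> half_cube \<Longrightarrow> cell k (corner k x) \<subseteq> unit_cube"
  unfolding cell_def unit_cube_def
  by (rule subset_box_imp) (auto simp: inner_simps corner_half_cube_bounds)

lemma interior_cell: "interior (cell k c) = box c (c + (1/2) ^ k *\<^sub>R One)"
  by (simp add: cell_def interior_cbox)

lemma corner_of_interior:
  assumes "y \<in> interior (cell k (corner k x))" shows "corner k y = corner k x"
  unfolding corner_eq_iff
proof
  fix b :: 'a assume b: "b \<in> Basis"
  have "corner k x \<bullet> b < y \<bullet> b" "y \<bullet> b < corner k x \<bullet> b + (1/2) ^ k"
    using assms b unfolding interior_cell mem_box by (auto simp: inner_simps)
  then have "2 ^ k * (corner k x \<bullet> b) < 2 ^ k * (y \<bullet> b)" "2 ^ k * (y \<bullet> b) < 2 ^ k * (corner k x \<bullet> b + (1/2) ^ k)"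
    by simp_all
  then show "\<lfloor>2 ^ k * (y \<bullet> b)\<rfloor> = \<lfloor>2 ^ k * (x \<bullet> b)\<rfloor>"
    unfolding corner_inner[OF b] by (simp add: distrib_left power_one_over floor_eq_iff)
qed

lemma emeasure_interior_cell:
  "emeasure lborel (interior (cell k (c::'e::euclidean_space))) = ennreal (((1/2) ^ k) ^ DIM('e))"
proof -
  have "emeasure lborel (interior (cell k c)) = ennreal (\<Prod>b\<in>Basis. (c + (1/2) ^ k *\<^sub>R One - c) \<bullet> b)"
    unfolding interior_cell by (rule emeasure_lborel_box) (simp add: inner_simps)
  also have "(\<Prod>b\<in>Basis. (c + (1/2) ^ k *\<^sub>R One - c) \<bullet> b) = (\<Prod>b\<in>(Basis::'e set). (1/2) ^ k)"
    by (rule prod.cong) (auto simp: inner_simps)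
  finally show ?thesis by simp
qed

lemma dist_cell:
  fixes y z :: "'e::euclidean_space"
  assumes "y \<in> cell k c" "z \<in> cell k c"
  shows "dist y z \<le> real DIM('e) * (1/2) ^ k"
proof -
  have "\<bar>(y - z) \<bullet> b\<bar> \<le> (1/2) ^ k" if "b \<in> Basis" for b
    using assms that unfolding cell_def mem_box inner_diff_left by (force simp: inner_simps abs_le_iff)
  then have "(\<Sum>b\<in>Basis. \<bar>(y - z) \<bullet> b\<bar>) \<le> (\<Sum>b\<in>(Basis::'e set). (1/2) ^ k)" by (intro sum_mono)
  then show ?thesis unfolding dist_norm using norm_le_l1[of "y - z"] by simp
qed

lemma small_cell_in_open:
  fixes p :: "'e::euclidean_space"
  assumes U: "open U" "p \<in> U" and p: "p \<in> unit_cube"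
  obtains k x where "x \<in> half_cube" "p \<in> cell k (corner k x)" "cell k (corner k x) \<subseteq> U"
proof -
  obtain e where e: "e > 0" "ball p e \<subseteq> U" using U open_contains_ball by blast
  have d1: "real DIM('e) \<ge> 1" by (simp add: Suc_leI)
  obtain k where "(1/2::real) ^ k < e / real DIM('e)" using real_arch_pow_inv[of "e / real DIM('e)" "1/2"] e d1 by auto
  then have k: "real DIM('e) * (1/2) ^ k < e" using d1 by (simp add: field_simps)
  define h where "h = (1/2::real) ^ k"
  have h: "0 < h" "h \<le> 1" "2 ^ k * h = 1" by (simp_all add: h_def power_le_one power_one_over)
  \<comment> \<open>A point on an upper face belongs to no half-open cell of the cube. Lowering its
    coordinates to at most \<open>1 - h\<close> gives a point whose closed cell contains it.\<close>
  define x where "x = (\<Sum>b\<in>Basis. min (p \<bullet> b) (1 - h) *\<^sub>R b)"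
  have xb: "x \<bullet> b = min (p \<bullet> b) (1 - h)" if "b \<in> Basis" for b using that by (simp add: x_def)
  have pb: "0 \<le> p \<bullet> b" "p \<bullet> b \<le> 1" if "b \<in> Basis" for b
    using p that by (auto simp: unit_cube_def mem_box)
  have x: "x \<in> half_cube"
    unfolding half_cube_def
  proof (intro CollectI ballI conjI)
    fix b :: 'e assume b: "b \<in> Basis"
    show "0 \<le> x \<bullet> b" "x \<bullet> b < 1" using xb[OF b] pb[OF b] h by auto
  qed
  have mem: "p \<in> cell k (corner k x)"
    unfolding cell_def mem_box
  proof (intro ballI conjI)
    fix b :: 'e assume b: "b \<in> Basis"
    have c: "corner k x \<bullet> b \<le> x \<bullet> b" "x \<bullet> b \<le> corner k x \<bullet> b + h"
      using mem_cell_corner[of x k] b unfolding cell_def mem_box h_def by (auto simp: inner_simps)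
    show "corner k x \<bullet> b \<le> p \<bullet> b" using c(1) xb[OF b] by simp
    show "p \<bullet> b \<le> (corner k x + (1/2) ^ k *\<^sub>R One) \<bullet> b"
    proof (cases "p \<bullet> b \<le> 1 - h")
      case True
      then show ?thesis using c(2) xb[OF b] b by (simp add: inner_simps h_def)
    next
      case False
      then have "2 ^ k * (x \<bullet> b) = real_of_int (2 ^ k - 1)" using xb[OF b] h(3) by (simp add: right_diff_distrib)
      then have "\<lfloor>2 ^ k * (x \<bullet> b)\<rfloor> = 2 ^ k - 1" by (simp only: floor_of_int)
      then have "corner k x \<bullet> b = 1 - h" by (simp add: corner_inner[OF b] h_def power_one_over diff_divide_distrib)
      then show ?thesis using pb(2)[OF b] b by (simp add: inner_simps h_def)
    qed
  qed
  have "cell k (corner k x) \<subseteq> ball p e"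
  proof
    fix y assume "y \<in> cell k (corner k x)"
    then have "dist p y \<le> real DIM('e) * (1/2) ^ k" by (rule dist_cell[OF mem])
    then show "y \<in> ball p e" using k by simp
  qed
  then show thesis using that x mem e(2) by blast
qed

text \<open>Dyadic cells are nested or have disjoint interiors, so the maximal good cells form an
  admissible cover. A cell of side \<open>h\<close> with content at most \<open>c h^n\<close>
  contributes at most \<open>c h^(n+m)\<close>, that is, \<open>c\<close> times its volume. Cells of
  small content thus cost at most \<alpha> altogether, and the others lie in \<open>U\<close> and
  cost at most \<open>C\<close> times its measure. Openness of \<open>U\<close> gives each of its
  points in the cube a cell inside \<open>U\<close>.\<close>

proposition mapping_content_le:
  fixes X :: "'x metric" and f :: "(real^'n) \<times> (real^'m) \<Rightarrow> 'x"
  assumes C: "C \<ge> 0" and al: "\<alpha> \<ge> 0"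
    and triv: "\<And>k x. x \<in> half_cube \<Longrightarrow> hausdorff_content X CARD('n) (f ` cell k (corner k x)) \<le> ennreal (C * ((1/2) ^ k) ^ CARD('n))"
    and U: "open U" and E: "E \<subseteq> unit_cube"
    and cov: "\<And>p. p \<in> E \<Longrightarrow> p \<in> U \<or> (\<exists>k. \<exists>x\<in>half_cube. p \<in> cell k (corner k x) \<and>
        hausdorff_content X CARD('n) (f ` cell k (corner k x)) \<le> ennreal (\<alpha> * ((1/2) ^ k) ^ CARD('n)))"
  shows "mapping_content X f E \<le> ennreal \<alpha> + ennreal C * emeasure lborel U"
proof -
  let ?hc = "\<lambda>Q. hausdorff_content X CARD('n) (f ` Q)"
  define small where "small k x \<longleftrightarrow> ?hc (cell k (corner k x)) \<le> ennreal (\<alpha> * ((1/2) ^ k) ^ CARD('n))" for k x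
  define good where "good k x \<longleftrightarrow> small k x \<or> cell k (corner k x) \<subseteq> U" for k x
  define \<Q> where "\<Q> = {cell k (corner k x) | k x. x \<in> half_cube \<and> good k x \<and> (\<forall>j<k. \<not> good j x)}"
  have good_cong: "good k x = good k y" if "corner k x = corner k y" for k x y
    unfolding good_def small_def that ..
  have max: "\<exists>Q\<in>\<Q>. cell k (corner k x) \<subseteq> Q" if "x \<in> half_cube" "good k x" for k x
  proof -
    define i where "i = (LEAST i. good i x)"
    have i: "good i x" "i \<le> k" "\<And>j. j < i \<Longrightarrow> \<not> good j x"
      unfolding i_def using LeastI[of "\<lambda>i. good i x" k] Least_le[of "\<lambda>i. good i x" k] that(2) not_less_Least by auto
    have "cell i (corner i x) \<in> \<Q>" unfolding \<Q>_def using that(1) i by blast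
    moreover have "cell k (corner k x) \<subseteq> cell i (corner i x)"
      unfolding cell_def
    proof (rule subset_box_imp, intro ballI)
      fix b :: "(real^'n) \<times> (real^'m)" assume b: "b \<in> Basis"
      define m where "m = \<lfloor>2 ^ k * (x \<bullet> b)\<rfloor>"
      define z :: int where "z = 2 ^ (k - i)"
      have z: "z > 0" by (simp add: z_def)
      have mi: "\<lfloor>2 ^ i * (x \<bullet> b)\<rfloor> = m div z" using floor_dyadic_div[of i "x \<bullet> b" "k - i"] i(2) by (simp add: m_def z_def)
      have r: "0 \<le> m mod z" "m mod z < z" using z by auto
      have "z * (m div z + 1) = z * (m div z) + z" by (simp add: distrib_left)
      then have 1: "z * (m div z) \<le> m" "m + 1 \<le> z * (m div z + 1)" using r mult_div_mod_eq[of z m] by linarith+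
      have kk: "(2::real) ^ k = 2 ^ i * real_of_int z" using i(2) by (simp add: z_def flip: power_add)
      have A: "real_of_int (m div z) / 2 ^ i \<le> real_of_int m / 2 ^ k"
      proof -
        have "real_of_int (m div z) / 2 ^ i = real_of_int (z * (m div z)) / 2 ^ k" using z by (simp add: kk)
        also have "\<dots> \<le> real_of_int m / 2 ^ k" using 1(1) by (intro divide_right_mono) (simp_all only: of_int_le_iff zero_le_power zero_le_numeral)
        finally show ?thesis .
      qed
      have B: "real_of_int m / 2 ^ k + (1/2) ^ k \<le> real_of_int (m div z) / 2 ^ i + (1/2) ^ i"
      proof -
        have "real_of_int m / 2 ^ k + (1/2) ^ k = real_of_int (m + 1) / 2 ^ k" by (simp add: power_one_over add_divide_distrib)
        also have "\<dots> \<le> real_of_int (z * (m div z + 1)) / 2 ^ k" using 1(2) by (intro divide_right_mono) (simp_all only: of_int_le_iff zero_le_power zero_le_numeral)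
        also have "\<dots> = real_of_int (m div z + 1) / 2 ^ i" using z by (simp add: kk)
        also have "\<dots> = real_of_int (m div z) / 2 ^ i + (1/2) ^ i" by (simp add: power_one_over add_divide_distrib)
        finally show ?thesis .
      qed
      show "corner i x \<bullet> b \<le> corner k x \<bullet> b \<and> (corner k x + (1/2) ^ k *\<^sub>R One) \<bullet> b \<le> (corner i x + (1/2) ^ i *\<^sub>R One) \<bullet> b"
        using A B b by (simp add: inner_simps corner_inner[OF b] mi m_def[symmetric])
    qed
    ultimately show ?thesis by blast
  qed
  have pw: "pairwise (\<lambda>Q R. interior Q \<inter> interior R = {}) \<Q>"
  proof (rule pairwiseI)
    fix Q R assume "Q \<in> \<Q>" "R \<in> \<Q>" and ne: "Q \<noteq> R"
    then obtain k x i y where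
      k: "Q = cell k (corner k x)" "good k x" "\<And>j. j < k \<Longrightarrow> \<not> good j x" and
      i: "R = cell i (corner i y)" "good i y" "\<And>j. j < i \<Longrightarrow> \<not> good j y"
      unfolding \<Q>_def by blast
    show "interior Q \<inter> interior R = {}"
    proof (rule ccontr)
      assume "interior Q \<inter> interior R \<noteq> {}"
      then obtain z where z: "z \<in> interior Q" "z \<in> interior R" by blast
      have zk: "corner k z = corner k x" using z(1) corner_of_interior k(1) by metis
      have zi: "corner i z = corner i y" using z(2) corner_of_interior i(1) by metis
      have gk: "good k z" "good i z" using good_cong[OF zk] good_cong[OF zi] k(2) i(2) by auto
      consider "k < i" | "i < k" | "k = i" by linarith
      then show False
      proof cases
        case 1
        then have "corner k z = corner k y" using corner_eq_mono[of k "i - k" z y] zi by simp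
        then show False using good_cong gk(1) i(3)[OF 1] by metis
      next
        case 2
        then have "corner i z = corner i x" using corner_eq_mono[of i "k - i" z x] zk by simp
        then show False using good_cong gk(2) k(3)[OF 2] by metis
      next
        case 3
        then show False using zk zi k(1) i(1) ne by simp
      qed
    qed
  qed
  have sub: "Q \<subseteq> unit_cube" "Q \<in> dyadic_cubes" if "Q \<in> \<Q>" for Q
    using that cell_subset_unit cell_dyadic unfolding \<Q>_def by blast+
  have covQ: "E \<subseteq> \<Union>\<Q>"
  proof
    fix p assume p: "p \<in> E"
    have "\<exists>k x. x \<in> half_cube \<and> p \<in> cell k (corner k x) \<and> good k x"
    proof (cases "p \<in> U")
      case True
      obtain k x where "x \<in> half_cube" "p \<in> cell k (corner k x)" "cell k (corner k x) \<subseteq> U"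
        by (rule small_cell_in_open[OF U True subsetD[OF E p]])
      then show ?thesis unfolding good_def by blast
    next
      case False
      then show ?thesis using cov[OF p] unfolding good_def small_def by blast
    qed
    then show "p \<in> \<Union>\<Q>" using max by blast
  qed
  have mem: "\<Q> \<in> {\<Q>. \<Q> \<subseteq> dyadic_cubes \<and> (\<forall>Q\<in>\<Q>. Q \<subseteq> unit_cube) \<and>
       pairwise (\<lambda>Q R. interior Q \<inter> interior R = {}) \<Q> \<and> E \<subseteq> \<Union>\<Q>}"
    using sub pw covQ by blast
  let ?term = "\<lambda>Q. ?hc Q * ennreal (side Q) ^ CARD('m)"
  have dim: "DIM((real^'n) \<times> (real^'m)) = CARD('n) + CARD('m)" by simp
  have packing: "(\<Sum>Q\<in>F. emeasure lborel (interior Q)) \<le> emeasure lborel V"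
    if "finite F" "F \<subseteq> \<Q>" "V \<in> sets borel" "\<And>Q. Q \<in> F \<Longrightarrow> interior Q \<subseteq> V" for F V
  proof -
    have "disjoint_family_on interior F"
      using pairwise_subset[OF pw that(2)] by (auto simp: disjoint_family_on_def pairwise_def)
    then have "(\<Sum>Q\<in>F. emeasure lborel (interior Q)) = emeasure lborel (\<Union>Q\<in>F. interior Q)"
      using that(1) by (intro sum_emeasure) auto
    also have "\<dots> \<le> emeasure lborel V" using that by (intro emeasure_mono) auto
    finally show ?thesis .
  qed
  have tb: "?term Q \<le> ennreal c * emeasure lborel (interior Q)"
    if "?hc Q \<le> ennreal (c * ((1/2) ^ k) ^ CARD('n))" "Q = cell k (corner k x)" "c \<ge> 0" for Q k x c
  proof -
    have "?term Q \<le> ennreal (c * ((1/2) ^ k) ^ CARD('n)) * ennreal ((1/2) ^ k) ^ CARD('m)"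
      unfolding that(2) side_cell using that(1)[unfolded that(2)] by (intro mult_right_mono) auto
    also have "\<dots> = ennreal (c * ((1/2) ^ k) ^ CARD('n) * ((1/2) ^ k) ^ CARD('m))"
      using that(3) by (simp only: ennreal_power ennreal_mult zero_le_power mult_nonneg_nonneg zero_le_divide_1_iff zero_le_numeral)
    also have "c * ((1/2) ^ k) ^ CARD('n) * ((1/2) ^ k) ^ CARD('m) = c * (((1/2) ^ k) ^ (CARD('n) + CARD('m)))"
      by (simp add: power_add mult.assoc)
    also have "ennreal \<dots> = ennreal c * emeasure lborel (interior Q)"
      unfolding that(2) emeasure_interior_cell dim using that(3) by (simp add: ennreal_mult)
    finally show ?thesis .
  qed
  have "mapping_content X f E \<le> (\<Sum>\<^sub>\<infinity>Q\<in>\<Q>. ?term Q)"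
    unfolding mapping_content_def by (rule INF_lower[OF mem])
  also have "\<dots> = (SUP F\<in>{F. finite F \<and> F \<subseteq> \<Q>}. sum ?term F)"
    by (rule nonneg_infsum_complete) simp
  also have "\<dots> \<le> ennreal \<alpha> + ennreal C * emeasure lborel U"
  proof (rule SUP_least)
    fix F assume "F \<in> {F. finite F \<and> F \<subseteq> \<Q>}"
    then have F: "finite F" "F \<subseteq> \<Q>" by auto
    \<comment> \<open>Sorted by interiors, which are what the packing estimate measures. A cell left
      over is not contained in \<open>U\<close> and so has small content.\<close>
    define F1 where "F1 = {Q \<in> F. interior Q \<subseteq> U}"
    define F2 where "F2 = F - F1"
    have "sum ?term F = sum ?term F2 + sum ?term F1"
      unfolding F2_def using F(1) by (intro sum.subset_diff) (auto simp: F1_def)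
    also have "\<dots> \<le> ennreal \<alpha> + ennreal C * emeasure lborel U"
    proof (rule add_mono)
      have "sum ?term F2 \<le> (\<Sum>Q\<in>F2. ennreal \<alpha> * emeasure lborel (interior Q))"
      proof (rule sum_mono)
        fix Q assume Q: "Q \<in> F2"
        then obtain k x where kx: "Q = cell k (corner k x)" "good k x" using F(2) unfolding F2_def \<Q>_def by blast
        have "\<not> cell k (corner k x) \<subseteq> U" using Q kx(1) interior_subset unfolding F2_def F1_def by blast
        then have "small k x" using kx(2) by (simp add: good_def)
        then have "?hc Q \<le> ennreal (\<alpha> * ((1/2) ^ k) ^ CARD('n))" unfolding small_def kx(1) .
        then show "?term Q \<le> ennreal \<alpha> * emeasure lborel (interior Q)" by (rule tb[OF _ kx(1) al])
      qed
      also have "\<dots> = ennreal \<alpha> * (\<Sum>Q\<in>F2. emeasure lborel (interior Q))" by (rule sum_distrib_left[symmetric])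
      also have "\<dots> \<le> ennreal \<alpha> * emeasure lborel (unit_cube :: ((real^'n) \<times> (real^'m)) set)"
      proof (rule mult_left_mono[OF packing])
        show "interior Q \<subseteq> unit_cube" if "Q \<in> F2" for Q using that F(2) sub(1) interior_subset unfolding F2_def by blast
      qed (use F in \<open>auto simp: F2_def unit_cube_def\<close>)
      also have "emeasure lborel (unit_cube :: ((real^'n) \<times> (real^'m)) set) = 1"
        unfolding unit_cube_def by (simp add: emeasure_lborel_cbox_eq)
      finally show "sum ?term F2 \<le> ennreal \<alpha>" by simp
      have "sum ?term F1 \<le> (\<Sum>Q\<in>F1. ennreal C * emeasure lborel (interior Q))"
      proof (rule sum_mono)
        fix Q assume "Q \<in> F1"
        then obtain k x where kx: "Q = cell k (corner k x)" "x \<in> half_cube" using F(2) unfolding F1_def \<Q>_def by blast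
        show "?term Q \<le> ennreal C * emeasure lborel (interior Q)"
          by (rule tb[OF _ kx(1) C]) (unfold kx(1), rule triv[OF kx(2)])
      qed
      also have "\<dots> = ennreal C * (\<Sum>Q\<in>F1. emeasure lborel (interior Q))" by (rule sum_distrib_left[symmetric])
      also have "\<dots> \<le> ennreal C * emeasure lborel U"
        by (rule mult_left_mono[OF packing]) (use F U in \<open>auto simp: F1_def\<close>)
      finally show "sum ?term F1 \<le> ennreal C * emeasure lborel U" .
    qed
    finally show "sum ?term F \<le> ennreal \<alpha> + ennreal C * emeasure lborel U" .
  qed
  finally show ?thesis .
qed

subsection \<open>Transport to metrics on the reals\<close>

unbundle cardinal_syntax

lemma card_Times_le_real:
  assumes "|A| \<le>o |UNIV :: real set|" "|B| \<le>o |UNIV :: real set|"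
  shows "|A \<times> B| \<le>o |UNIV :: real set|"
  by (rule card_of_Times_ordLeq_infinite_Field[OF _ assms card_of_Card_order])
     (simp only: Field_card_of infinite_UNIV_char_0 not_False_eq_True)

lemma card_Un_le_real:
  assumes "|A| \<le>o |UNIV :: real set|" "|B| \<le>o |UNIV :: real set|"
  shows "|A \<union> B| \<le>o |UNIV :: real set|"
  by (rule card_of_Un_ordLeq_infinite_Field[OF _ assms card_of_Card_order])
     (simp only: Field_card_of infinite_UNIV_char_0 not_False_eq_True)

lemma card_PiE_real: "finite A \<Longrightarrow> |PiE A (\<lambda>_. UNIV :: real set)| \<le>o |UNIV :: real set|"
proof (induction A rule: finite_induct)
  case empty
  show ?case unfolding PiE_empty_domain by (rule card_of_singl_ordLeq) (rule UNIV_not_empty)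
next
  case (insert x A)
  have "PiE (insert x A) (\<lambda>_. UNIV :: real set) = (\<lambda>(y, g). g(x := y)) ` (UNIV \<times> PiE A (\<lambda>_. UNIV))"
    by (rule PiE_insert_eq)
  then have "|PiE (insert x A) (\<lambda>_. UNIV :: real set)| \<le>o |(UNIV :: real set) \<times> PiE A (\<lambda>_. UNIV :: real set)|"
    by (simp only: card_of_image)
  moreover have "|(UNIV :: real set) \<times> PiE A (\<lambda>_. UNIV :: real set)| \<le>o |UNIV :: real set|"
    by (rule card_Times_le_real[OF card_of_mono1[OF order_refl] insert.IH])
  ultimately show ?case by (rule ordLeq_transitive)
qed

lemma card_euclidean_real: "|UNIV :: 'e::euclidean_space set| \<le>o |UNIV :: real set|"
proof -
  let ?g = "\<lambda>p::'e. restrict (\<lambda>b. p \<bullet> b) Basis"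
  have "inj ?g"
  proof (rule injI)
    fix p q assume "?g p = ?g q"
    then have "p \<bullet> b = q \<bullet> b" if "b \<in> Basis" for b using that by (metis restrict_apply')
    then show "p = q" by (rule euclidean_eqI)
  qed
  then have "|UNIV :: 'e set| \<le>o |PiE (Basis :: 'e set) (\<lambda>_. UNIV :: real set)|"
    by (intro card_of_ordLeqI[of ?g]) auto
  then show ?thesis using card_PiE_real[OF finite_Basis] by (rule ordLeq_transitive)
qed

text \<open>Balls of a subspace can have a smaller diameter than the balls of the ambient space with the same
  center and radius. The subset \<open>M\<close> contains, for each ball centered in \<open>M\<close> and each \<open>q\<close>, a pair of
  points of the ball at distance at least \<open>q\<close> if there is one, so that it sees all diameters.\<close>

lemma diameter_closed_subset:
  fixes X :: "'x metric"
  assumes A: "A \<subseteq> mspace X" "|A| \<le>o |UNIV :: real set|"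
  shows "\<exists>M. A \<subseteq> M \<and> M \<subseteq> mspace X \<and> |M| \<le>o |UNIV :: real set| \<and>
    (\<forall>x\<in>M. \<forall>r. \<forall>u\<in>mcball_of X x r. \<forall>w\<in>mcball_of X x r.
       \<exists>u'\<in>M \<inter> mcball_of X x r. \<exists>w'\<in>M \<inter> mcball_of X x r. mdist X u w \<le> mdist X u' w')"
proof -
  define Q where "Q = (\<lambda>(x, r, q) (u, w). u \<in> mcball_of X x r \<and> w \<in> mcball_of X x r \<and> q \<le> mdist X u w)"
  \<comment> \<open>The default value repeats the center, so that \<open>step\<close> never leaves
    the space.\<close>
  define h where "h t = (if \<exists>z. Q t z then SOME z. Q t z else (fst t, fst t))" for t
  have hQ: "Q t (h t)" if "\<exists>z. Q t z" for t using someI_ex[OF that] that by (simp add: h_def)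
  define step where "step M = M \<union> (fst \<circ> h) ` (M \<times> UNIV \<times> UNIV) \<union> (snd \<circ> h) ` (M \<times> UNIV \<times> UNIV)" for M
  \<comment> \<open>Countably many rounds suffice: a center in the union lies in some
    \<open>T k\<close>, and witnesses for all its balls are in \<open>T (Suc k)\<close>.\<close>
  define T where "T k = (step ^^ k) A" for k
  have T0: "T 0 = A" and TS: "T (Suc k) = step (T k)" for k by (simp_all add: T_def)
  have inf: "infinite (UNIV :: real set)" by (simp add: infinite_UNIV_char_0)
  have cardT: "|T k| \<le>o |UNIV :: real set|" for k
  proof (induction k)
    case 0
    then show ?case using A(2) by (simp add: T0)
  next
    case (Suc k)
    have 1: "|T k \<times> (UNIV :: real set) \<times> (UNIV :: real set)| \<le>o |UNIV :: real set|"
      by (intro card_Times_le_real Suc card_of_mono1 order_refl)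
    have 2: "|(fst \<circ> h) ` (T k \<times> (UNIV :: real set) \<times> (UNIV :: real set))| \<le>o |UNIV :: real set|"
      "|(snd \<circ> h) ` (T k \<times> (UNIV :: real set) \<times> (UNIV :: real set))| \<le>o |UNIV :: real set|"
      by (rule ordLeq_transitive[OF card_of_image 1])+
    show ?case unfolding TS step_def
      by (intro card_Un_le_real Suc 2)
  qed
  have Tsub: "T k \<subseteq> mspace X" for k
  proof (induction k)
    case 0
    then show ?case using A(1) by (simp add: T0)
  next
    case (Suc k)
    have "fst (h t) \<in> mspace X \<and> snd (h t) \<in> mspace X" if "fst t \<in> T k" for t
    proof (cases "\<exists>z. Q t z")
      case True
      then show ?thesis using hQ[OF True] by (auto simp: Q_def split: prod.splits)
    next
      case False
      then show ?thesis using that Suc by (auto simp: h_def)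
    qed
    then show ?case unfolding TS step_def using Suc by auto
  qed
  define M where "M = (\<Union>k. T k)"
  show ?thesis
  proof (intro exI[of _ M] conjI ballI allI)
    show "A \<subseteq> M" unfolding M_def using T0 by blast
    show "M \<subseteq> mspace X" unfolding M_def using Tsub by blast
    have "|UNIV :: nat set| \<le>o |UNIV :: real set|"
      using inf unfolding infinite_iff_card_of_nat .
    then show "|M| \<le>o |UNIV :: real set|" unfolding M_def
      by (intro card_of_UNION_ordLeq_infinite inf ballI cardT)
    fix x r u w assume x: "x \<in> M" and uw: "u \<in> mcball_of X x r" "w \<in> mcball_of X x r"
    obtain k where k: "x \<in> T k" using x by (auto simp: M_def)
    define t where "t = (x, r, mdist X u w)"
    have "Q t (u, w)" using uw by (simp add: Q_def t_def)
    then have "Q t (h t)" using hQ by blast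
    then have 1: "fst (h t) \<in> mcball_of X x r" "snd (h t) \<in> mcball_of X x r" "mdist X u w \<le> mdist X (fst (h t)) (snd (h t))"
      by (auto simp: Q_def t_def split: prod.splits)
    have "t \<in> T k \<times> UNIV \<times> UNIV" using k by (simp add: t_def)
    then have "fst (h t) \<in> T (Suc k)" "snd (h t) \<in> T (Suc k)" unfolding TS step_def by force+
    then have "fst (h t) \<in> M" "snd (h t) \<in> M" unfolding M_def by blast+
    with 1 show "\<exists>u'\<in>M \<inter> mcball_of X x r. \<exists>w'\<in>M \<inter> mcball_of X x r. mdist X u w \<le> mdist X u' w'" by blast
  qed
qed

text \<open>Equal images are counted once on the left. The inequality is needed because distinct
  balls of the copied space may come from the same ball of the original one.\<close>

lemma infsum_image_le:
  fixes f :: "'b \<Rightarrow> ennreal"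
  shows "infsum f (g ` A) \<le> (\<Sum>\<^sub>\<infinity>x\<in>A. f (g x))"
proof -
  obtain B where B: "B \<subseteq> A" "inj_on g B" "g ` A = g ` B"
    using subset_image_inj[of "g ` A" g A] by auto
  have "infsum f (g ` A) = (\<Sum>\<^sub>\<infinity>x\<in>B. f (g x))"
    unfolding B(3) infsum_reindex[OF B(2)] by (simp add: comp_def)
  also have "\<dots> \<le> (\<Sum>\<^sub>\<infinity>x\<in>A. f (g x))"
    unfolding nonneg_infsum_complete[OF zero_le]
    by (rule SUP_subset_mono) (use B(1) in auto)
  finally show ?thesis .
qed

text \<open>A copy of the subspace \<open>M\<close> on another type of points. Contents in
  \<open>X\<close> are to be bounded by contents in the copy, so that a decomposition found for the
  copy serves \<open>X\<close>.\<close>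

locale transported =
  fixes X :: "'x metric" and M :: "'x set" and g :: "'x \<Rightarrow> 'y"
  assumes MX: "M \<subseteq> mspace X" and inj: "inj_on g M"
    and closed: "\<forall>x\<in>M. \<forall>r. \<forall>u\<in>mcball_of X x r. \<forall>w\<in>mcball_of X x r.
       \<exists>u'\<in>M \<inter> mcball_of X x r. \<exists>w'\<in>M \<inter> mcball_of X x r. mdist X u w \<le> mdist X u' w'"
begin

abbreviation "gi \<equiv> inv_into M g"

definition Y :: "'y metric" where
  "Y = metric (g ` M, \<lambda>a b. mdist X (gi a) (gi b))"

lemma gi: "x \<in> M \<Longrightarrow> gi (g x) = x"
  using inj by simp

lemma Metric_space_Y: "Metric_space (g ` M) (\<lambda>a b. mdist X (gi a) (gi b))"
proof
  show "0 \<le> mdist X (gi a) (gi b)" for a b by simp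
  show "mdist X (gi a) (gi b) = mdist X (gi b) (gi a)" for a b by (rule mdist_commute)
  show "(mdist X (gi a) (gi b) = 0) = (a = b)" if "a \<in> g ` M" "b \<in> g ` M" for a b
    using that MX gi by (auto simp: mdist_zero subset_iff)
  show "mdist X (gi a) (gi c) \<le> mdist X (gi a) (gi b) + mdist X (gi b) (gi c)"
    if "a \<in> g ` M" "b \<in> g ` M" "c \<in> g ` M" for a b c
    using that MX gi by (intro mdist_triangle) auto
qed

lemma mspace_Y: "mspace Y = g ` M"
  unfolding Y_def by (rule Metric_space.mspace_metric[OF Metric_space_Y])

lemma mdist_Y: "x \<in> M \<Longrightarrow> y \<in> M \<Longrightarrow> mdist Y (g x) (g y) = mdist X x y"
  unfolding Y_def Metric_space.mdist_metric[OF Metric_space_Y] by (simp add: gi)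

text \<open>Passing to the copy removes points from a ball; \<open>closed\<close> guarantees that
  this does not shrink its diameter.\<close>

lemma ediam_ball_le:
  assumes x: "x \<in> M" shows "ediam X (mcball_of X x s) \<le> ediam Y (mcball_of Y (g x) s)"
  unfolding ediam_def[of X]
proof (intro SUP_least)
  fix u w assume uw: "u \<in> mcball_of X x s" "w \<in> mcball_of X x s"
  obtain u' w' where u': "u' \<in> M" "u' \<in> mcball_of X x s" and w': "w' \<in> M" "w' \<in> mcball_of X x s"
    and le: "mdist X u w \<le> mdist X u' w'" using closed x uw by blast
  have "g u' \<in> mcball_of Y (g x) s" "g w' \<in> mcball_of Y (g x) s"
    using x u' w' by (auto simp: mspace_Y mdist_Y)
  then have "ennreal (mdist Y (g u') (g w')) \<le> ediam Y (mcball_of Y (g x) s)"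
    unfolding ediam_def by (meson SUP_upper2 order_refl)
  then show "ennreal (mdist X u w) \<le> ediam Y (mcball_of Y (g x) s)"
    using le mdist_Y[OF u'(1) w'(1)] by (metis ennreal_leI order_trans)
qed

text \<open>Every ball of the copy has its center in the image of \<open>M\<close>. The ball of
  \<open>X\<close> with the same center and radius covers no less of \<open>A\<close>, and its
  diameter is no larger by \<open>ediam_ball_le\<close>.\<close>

lemma hausdorff_content_le:
  assumes A: "A \<subseteq> M" shows "hausdorff_content X k A \<le> hausdorff_content Y k (g ` A)"
  unfolding hausdorff_content_def[of Y]
proof (rule INF_greatest)
  fix \<B> assume "\<B> \<in> {\<B>. \<B> \<subseteq> closed_balls Y \<and> countable \<B> \<and> g ` A \<subseteq> \<Union>\<B>}"
  then have B: "\<B> \<subseteq> closed_balls Y" "countable \<B>" "g ` A \<subseteq> \<Union>\<B>" by auto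
  have "\<forall>B\<in>\<B>. \<exists>x r. x \<in> M \<and> 0 < r \<and> B = mcball_of Y (g x) r"
    using B(1) unfolding closed_balls_def mspace_Y by blast
  then obtain c r where cr: "\<And>B. B \<in> \<B> \<Longrightarrow> c B \<in> M \<and> 0 < r B \<and> B = mcball_of Y (g (c B)) (r B)"
    by metis
  define b where "b B = mcball_of X (c B) (r B)" for B
  have "a \<in> \<Union>(b ` \<B>)" if a: "a \<in> A" for a
  proof -
    obtain B where B': "B \<in> \<B>" "g a \<in> B" using a B(3) by blast
    have "g a \<in> mcball_of Y (g (c B)) (r B)" using B' cr by metis
    then have "mdist Y (g (c B)) (g a) \<le> r B" by simp
    then have "mdist X (c B) a \<le> r B" using mdist_Y[of "c B" a] a A cr[OF B'(1)] by auto
    then have "a \<in> b B" using a A MX cr[OF B'(1)] by (auto simp: b_def)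
    then show ?thesis using B'(1) by blast
  qed
  moreover have "b ` \<B> \<subseteq> closed_balls X" unfolding closed_balls_def b_def using cr MX by blast
  ultimately have "b ` \<B> \<in> {\<B>. \<B> \<subseteq> closed_balls X \<and> countable \<B> \<and> A \<subseteq> \<Union>\<B>}"
    using B(2) by auto
  then have "hausdorff_content X k A \<le> (\<Sum>\<^sub>\<infinity>B\<in>b ` \<B>. ediam X B ^ k)"
    unfolding hausdorff_content_def by (rule INF_lower)
  also have "\<dots> \<le> (\<Sum>\<^sub>\<infinity>B\<in>\<B>. ediam X (b B) ^ k)" by (rule infsum_image_le)
  also have "\<dots> \<le> (\<Sum>\<^sub>\<infinity>B\<in>\<B>. ediam Y B ^ k)"
  proof (rule infsum_mono)
    fix B assume "B \<in> \<B>"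
    then have "ediam X (b B) \<le> ediam Y B" unfolding b_def using cr ediam_ball_le by metis
    then show "ediam X (b B) ^ k \<le> ediam Y B ^ k" by (rule power_mono) simp
  qed (auto intro: nonneg_summable_on_complete)
  finally show "hausdorff_content X k A \<le> (\<Sum>\<^sub>\<infinity>B\<in>\<B>. ediam Y B ^ k)" .
qed

lemma mapping_content_le_Y:
  fixes f :: "(real^'n) \<times> (real^'m) \<Rightarrow> 'x"
  assumes f: "f ` unit_cube \<subseteq> M"
  shows "mapping_content X f E \<le> mapping_content Y (g \<circ> f) E"
  unfolding mapping_content_def
proof (rule INF_mono)
  fix \<Q> :: "((real^'n) \<times> (real^'m)) set set"
  assume Q: "\<Q> \<in> {\<Q>. \<Q> \<subseteq> dyadic_cubes \<and> (\<forall>Q\<in>\<Q>. Q \<subseteq> unit_cube) \<and>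
       pairwise (\<lambda>Q R. interior Q \<inter> interior R = {}) \<Q> \<and> E \<subseteq> \<Union>\<Q>}"
  have "(\<Sum>\<^sub>\<infinity>Q\<in>\<Q>. hausdorff_content X CARD('n) (f ` Q) * ennreal (side Q) ^ CARD('m)) \<le>
    (\<Sum>\<^sub>\<infinity>Q\<in>\<Q>. hausdorff_content Y CARD('n) ((g \<circ> f) ` Q) * ennreal (side Q) ^ CARD('m))"
  proof (rule infsum_mono)
    fix R assume "R \<in> \<Q>"
    then have "f ` R \<subseteq> M" using Q f by blast
    from hausdorff_content_le[OF this] show "hausdorff_content X CARD('n) (f ` R) * ennreal (side R) ^ CARD('m)
        \<le> hausdorff_content Y CARD('n) ((g \<circ> f) ` R) * ennreal (side R) ^ CARD('m)"
      unfolding image_comp[symmetric] by (rule mult_right_mono) simp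
  qed (auto intro: nonneg_summable_on_complete)
  with Q show "\<exists>\<R>\<in>{\<Q>. \<Q> \<subseteq> dyadic_cubes \<and> (\<forall>Q\<in>\<Q>. Q \<subseteq> unit_cube) \<and>
       pairwise (\<lambda>Q R. interior Q \<inter> interior R = {}) \<Q> \<and> E \<subseteq> \<Union>\<Q>}.
     (\<Sum>\<^sub>\<infinity>Q\<in>\<R>. hausdorff_content X CARD('n) (f ` Q) * ennreal (side Q) ^ CARD('m)) \<le>
     (\<Sum>\<^sub>\<infinity>Q\<in>\<Q>. hausdorff_content Y CARD('n) ((g \<circ> f) ` Q) * ennreal (side Q) ^ CARD('m))" by blast
qed

lemma one_lipschitz_Y:
  assumes "one_lipschitz_on S X f" "f ` S \<subseteq> M"
  shows "one_lipschitz_on S Y (g \<circ> f)"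
  using assms unfolding one_lipschitz_on_def by (auto simp: mspace_Y mdist_Y image_subset_iff)

lemma has_decomposition_Y:
  fixes f :: "(real^'n) \<times> (real^'m) \<Rightarrow> 'x"
  assumes f: "f ` unit_cube \<subseteq> M" and dec: "has_decomposition \<alpha> N L Y (g \<circ> f)"
  shows "has_decomposition \<alpha> N L X f"
proof -
  obtain F G where FG: "unit_cube = (\<Union>i\<in>{1..N}. F i) \<union> G" "disjoint_family_on F {1..N}" "\<forall>i\<in>{1..N}. F i \<inter> G = {}"
    "\<forall>i\<in>{1..N}. F i \<in> sets borel" "G \<in> sets borel"
    and bil: "\<forall>i\<in>{1..N}. \<exists>\<phi> :: (real^'n) \<times> (real^'m) \<Rightarrow> (real^'n) \<times> (real^'m).
           \<phi> ` F i \<subseteq> unit_cube \<and> bilipschitz_on L (F i) dist dist \<phi> \<and>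
           bilipschitz_on L (\<phi> ` F i) dist (max_dist (mdist Y) dist)
             (\<lambda>(x, y). ((g \<circ> f) (inv_into (F i) \<phi> (x, y)), y))"
    and mc: "mapping_content Y (g \<circ> f) G < ennreal \<alpha>"
    using dec unfolding has_decomposition_def by blast
  have "bilipschitz_on L (\<phi> ` F i) dist (max_dist (mdist X) dist) (\<lambda>(x, y). (f (inv_into (F i) \<phi> (x, y)), y))"
    if i: "i \<in> {1..N}" and b: "bilipschitz_on L (\<phi> ` F i) dist (max_dist (mdist Y) dist)
             (\<lambda>(x, y). ((g \<circ> f) (inv_into (F i) \<phi> (x, y)), y))" for i and \<phi> :: "(real^'n) \<times> (real^'m) \<Rightarrow> (real^'n) \<times> (real^'m)"
  proof -
    have "f (inv_into (F i) \<phi> z) \<in> M" if "z \<in> \<phi> ` F i" for z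
      using inv_into_into[OF that] FG(1) i f by blast
    then have "max_dist (mdist Y) dist ((\<lambda>(x, y). ((g \<circ> f) (inv_into (F i) \<phi> (x, y)), y)) z) ((\<lambda>(x, y). ((g \<circ> f) (inv_into (F i) \<phi> (x, y)), y)) z')
      = max_dist (mdist X) dist ((\<lambda>(x, y). (f (inv_into (F i) \<phi> (x, y)), y)) z) ((\<lambda>(x, y). (f (inv_into (F i) \<phi> (x, y)), y)) z')"
      if "z \<in> \<phi> ` F i" "z' \<in> \<phi> ` F i" for z z'
      using that by (cases z, cases z') (simp add: max_dist_def mdist_Y)
    then show ?thesis using b unfolding bilipschitz_on_def by simp
  qed
  with bil have "\<forall>i\<in>{1..N}. \<exists>\<phi> :: (real^'n) \<times> (real^'m) \<Rightarrow> (real^'n) \<times> (real^'m).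
           \<phi> ` F i \<subseteq> unit_cube \<and> bilipschitz_on L (F i) dist dist \<phi> \<and>
           bilipschitz_on L (\<phi> ` F i) dist (max_dist (mdist X) dist)
             (\<lambda>(x, y). (f (inv_into (F i) \<phi> (x, y)), y))" by meson
  moreover have "mapping_content X f G < ennreal \<alpha>"
    using mapping_content_le_Y[OF f] mc by (rule le_less_trans)
  ultimately show ?thesis using FG unfolding has_decomposition_def by blast
qed

end

text \<open>The image of the cube has at most the cardinality of the continuum, and so has its
  enlargement by \<open>diameter_closed_subset\<close>, which therefore can be copied into the
  reals. \<open>N\<close> and \<open>L\<close> stay the same.\<close>

proposition has_decomposition_transfer:
  fixes X :: "'x metric" and f :: "(real^'n) \<times> (real^'m) \<Rightarrow> 'x"
  assumes real: "\<forall>(X :: real metric) (f :: (real^'n) \<times> (real^'m) \<Rightarrow> real).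
               one_lipschitz_on unit_cube X f \<longrightarrow> has_decomposition \<alpha> N L X f"
    and f: "one_lipschitz_on unit_cube X f"
  shows "has_decomposition \<alpha> N L X f"
proof -
  have fX: "f ` unit_cube \<subseteq> mspace X" using f by (simp add: one_lipschitz_on_def)
  have card: "|f ` unit_cube| \<le>o |UNIV :: real set|"
    by (rule ordLeq_transitive[OF ordLeq_transitive[OF card_of_image card_of_mono1[OF subset_UNIV]] card_euclidean_real])
  obtain M where M: "f ` unit_cube \<subseteq> M" "M \<subseteq> mspace X" "|M| \<le>o |UNIV :: real set|" and
    closed: "\<forall>x\<in>M. \<forall>r. \<forall>u\<in>mcball_of X x r. \<forall>w\<in>mcball_of X x r.
       \<exists>u'\<in>M \<inter> mcball_of X x r. \<exists>w'\<in>M \<inter> mcball_of X x r. mdist X u w \<le> mdist X u' w'"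
    using diameter_closed_subset[OF fX card] by blast
  obtain g :: "'x \<Rightarrow> real" where g: "inj_on g M" using M(3)[folded card_of_ordLeq] by blast
  interpret transported X M g by unfold_locales (fact M(2), fact g, fact closed)
  show ?thesis
    by (rule has_decomposition_Y[OF M(1)]) (use real one_lipschitz_Y[OF f M(1)] in blast)
qed

subsection \<open>The decomposition\<close>

context coding begin

lemma no_margin_borel: "{p \<in> half_cube. \<exists>k. brk k p \<and> cnt k p < M \<and> \<not> margin s k p} \<in> sets borel"
proof -
  have "{p \<in> half_cube. \<exists>k. brk k p \<and> cnt k p < M \<and> \<not> margin s k p} =
      half_cube \<inter> (\<Union>k. {p. brk k p \<and> cnt k p < M \<and> \<not> margin s k p})" by auto
  also have "\<dots> \<in> sets borel"
  proof (intro sets.Int half_cube_borel sets.countable_UN'')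
    fix k
    show "{p. brk k p \<and> cnt k p < M \<and> \<not> margin s k p} \<in> sets borel"
    proof (rule borel_corner_invariant[of "k + s"])
      fix p q :: 'e assume c: "corner (k + s) p = corner (k + s) q"
      have ck: "corner k p = corner k q" by (rule corner_eq_mono[OF c])
      have "brk k p = brk k q" "cnt k p = cnt k q" using brk_cong[OF ck] cnt_cong[OF ck] by auto
      moreover have "margin s k p = margin s k q"
        using c unfolding corner_eq_iff margin_def slab_def by auto
      ultimately show "(brk k p \<and> cnt k p < M \<and> \<not> margin s k p) = (brk k q \<and> cnt k q < M \<and> \<not> margin s k q)" by simp
    qed
  qed auto
  finally show ?thesis .
qed

end

section \<open>Coordinate projections and isometries\<close>

lemma norm_Basis_sum:
  assumes "finite A" "inj_on \<pi> A" "\<pi> ` A \<subseteq> (Basis :: 'f::euclidean_space set)"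
  shows "(norm (\<Sum>b\<in>A. a b *\<^sub>R \<pi> b))\<^sup>2 = (\<Sum>b\<in>A. (a b)\<^sup>2)"
proof -
  have "pairwise (\<lambda>i j. orthogonal (a i *\<^sub>R \<pi> i) (a j *\<^sub>R \<pi> j)) A"
  proof (rule pairwiseI)
    fix i j assume "i \<in> A" "j \<in> A" "i \<noteq> j"
    then have "\<pi> i \<in> Basis" "\<pi> j \<in> Basis" "\<pi> i \<noteq> \<pi> j" using assms by (auto simp: inj_on_def)
    then show "orthogonal (a i *\<^sub>R \<pi> i) (a j *\<^sub>R \<pi> j)" by (simp add: orthogonal_def inner_Basis)
  qed
  then have "(norm (\<Sum>b\<in>A. a b *\<^sub>R \<pi> b))\<^sup>2 = (\<Sum>b\<in>A. (norm (a b *\<^sub>R \<pi> b))\<^sup>2)"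
    using assms(1) by (rule norm_sum_Pythagorean[rotated])
  also have "\<dots> = (\<Sum>b\<in>A. (a b)\<^sup>2)"
    using assms(3) by (intro sum.cong) (auto simp: power_mult_distrib)
  finally show ?thesis .
qed

text \<open>The component orthogonal to \<open>span S\<close>, for a set \<open>S\<close> of basis
  vectors.\<close>

definition rest :: "'e::euclidean_space set \<Rightarrow> 'e \<Rightarrow> 'e" where
  "rest S v = (\<Sum>b\<in>Basis - S. (v \<bullet> b) *\<^sub>R b)"

lemma rest_scaleR: "rest S (t *\<^sub>R v) = t *\<^sub>R rest S v"
  by (simp add: rest_def scaleR_sum_right)

lemma diff_rest:
  assumes "S \<subseteq> Basis" shows "v - rest S v = (\<Sum>b\<in>S. (v \<bullet> b) *\<^sub>R b)"
proof -
  have "v = (\<Sum>b\<in>Basis. (v \<bullet> b) *\<^sub>R b)" by (simp add: euclidean_representation)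
  also have "\<dots> = (\<Sum>b\<in>Basis - S. (v \<bullet> b) *\<^sub>R b) + (\<Sum>b\<in>S. (v \<bullet> b) *\<^sub>R b)"
    using assms by (intro sum.subset_diff) auto
  finally show ?thesis unfolding rest_def by (simp add: algebra_simps)
qed

lemma diff_rest_span: "S \<subseteq> Basis \<Longrightarrow> v - rest S v \<in> span S"
  unfolding diff_rest by (intro span_sum span_scale span_base)

lemma norm_diff_rest_le:
  assumes "S \<subseteq> Basis" shows "norm (v - rest S v) \<le> norm v"
proof -
  have "(norm (v - rest S v))\<^sup>2 = (\<Sum>b\<in>S. (v \<bullet> b)\<^sup>2)"
    unfolding diff_rest[OF assms] using assms finite_subset[OF assms finite_Basis]
    by (intro norm_Basis_sum) auto
  also have "\<dots> \<le> (\<Sum>b\<in>Basis. (v \<bullet> b)\<^sup>2)" using assms by (intro sum_mono2) auto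
  also have "\<dots> = (norm v)\<^sup>2"
    using norm_Basis_sum[of Basis "\<lambda>b. b" "\<lambda>b. v \<bullet> b"] by (simp add: euclidean_representation)
  finally show ?thesis by (rule power2_le_imp_le) simp
qed

text \<open>A permutation of the coordinates that takes \<open>S\<close> to the basis of the first
  factor; the second component then sees just the remaining coordinates.\<close>

lemma coordinate_isometry:
  fixes S :: "((real^'n) \<times> (real^'m)) set"
  assumes S: "S \<subseteq> Basis" "card S = CARD('n)"
  shows "\<exists>P :: (real^'n) \<times> (real^'m) \<Rightarrow> (real^'n) \<times> (real^'m). linear P \<and> (\<forall>v. norm (P v) = norm v) \<and>
     (\<forall>v. norm (snd (P v)) = norm (rest S v))"
proof -
  let ?B1 = "(\<lambda>u. (u, 0)) ` (Basis :: (real^'n) set) :: ((real^'n) \<times> (real^'m)) set"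
  let ?B2 = "(\<lambda>u. (0, u)) ` (Basis :: (real^'m) set) :: ((real^'n) \<times> (real^'m)) set"
  have B: "(Basis :: ((real^'n) \<times> (real^'m)) set) = ?B1 \<union> ?B2" by (simp add: Basis_prod_def)
  have cB1: "card ?B1 = CARD('n)" by (subst card_image) (auto simp: inj_on_def)
  have cB2: "card ?B2 = CARD('m)" by (subst card_image) (auto simp: inj_on_def)
  have fS: "finite S" by (rule finite_subset[OF S(1) finite_Basis])
  have "card (Basis - S) = CARD('m)" using S fS by (simp add: card_Diff_subset)
  then obtain \<pi>2 where p2: "bij_betw \<pi>2 (Basis - S) ?B2"
    using finite_same_card_bij[of "Basis - S" ?B2] cB2 by auto
  obtain \<pi>1 where p1: "bij_betw \<pi>1 S ?B1" using finite_same_card_bij[of S ?B1] cB1 S(2) fS by auto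
  define \<pi> where "\<pi> b = (if b \<in> S then \<pi>1 b else \<pi>2 b)" for b
  have b1: "bij_betw \<pi> S ?B1" using p1 by (rule bij_betw_cong[THEN iffD1, rotated]) (simp add: \<pi>_def)
  have b2: "bij_betw \<pi> (Basis - S) ?B2" using p2 by (rule bij_betw_cong[THEN iffD1, rotated]) (simp add: \<pi>_def)
  have disj: "?B1 \<inter> ?B2 = {}" by auto
  have "bij_betw \<pi> (S \<union> (Basis - S)) (?B1 \<union> ?B2)" by (rule bij_betw_combine[OF b1 b2 disj])
  then have bb: "bij_betw \<pi> Basis (Basis :: ((real^'n) \<times> (real^'m)) set)" using S(1) B by (simp add: Un_absorb1)
  define P where "P v = (\<Sum>b\<in>Basis. (v \<bullet> b) *\<^sub>R \<pi> b)" for v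
  have "linear P"
    unfolding P_def by (rule linearI) (simp_all add: inner_add_left scaleR_add_left sum.distrib scaleR_sum_right)
  moreover have "norm (P v) = norm v" for v
  proof -
    have "(norm (P v))\<^sup>2 = (\<Sum>b\<in>Basis. (v \<bullet> b)\<^sup>2)"
      unfolding P_def using bb by (intro norm_Basis_sum) (auto simp: bij_betw_def)
    also have "\<dots> = (norm v)\<^sup>2"
      using norm_Basis_sum[of Basis "\<lambda>b. b" "\<lambda>b. v \<bullet> b"] by (simp add: euclidean_representation)
    finally show ?thesis by simp
  qed
  moreover have "norm (snd (P v)) = norm (rest S v)" for v
  proof -
    have Pv: "P v = (\<Sum>b\<in>Basis - S. (v \<bullet> b) *\<^sub>R \<pi> b) + (\<Sum>b\<in>S. (v \<bullet> b) *\<^sub>R \<pi> b)"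
      unfolding P_def using S(1) by (intro sum.subset_diff) auto
    define z where "z = (\<Sum>b\<in>Basis - S. (v \<bullet> b) *\<^sub>R \<pi> b)"
    have "snd (\<pi> b) = 0" if "b \<in> S" for b using bij_betwE[OF b1] that by force
    then have "snd (\<Sum>b\<in>S. (v \<bullet> b) *\<^sub>R \<pi> b) = 0" by (simp add: snd_sum)
    then have s: "snd (P v) = snd z" by (simp add: Pv z_def)
    have "fst (\<pi> b) = 0" if "b \<in> Basis - S" for b using bij_betwE[OF b2] that by force
    then have "fst z = 0" unfolding z_def by (simp add: fst_sum)
    then have "norm (snd z) = norm z" by (simp add: norm_prod_def)
    moreover have "(norm z)\<^sup>2 = (norm (rest S v))\<^sup>2"
    proof -
      have "inj_on \<pi> (Basis - S)" "\<pi> ` (Basis - S) \<subseteq> Basis" using b2 B by (auto simp: bij_betw_def)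
      then have "(norm z)\<^sup>2 = (\<Sum>b\<in>Basis - S. (v \<bullet> b)\<^sup>2)" unfolding z_def by (intro norm_Basis_sum) auto
      also have "\<dots> = (norm (rest S v))\<^sup>2" unfolding rest_def
        by (rule norm_Basis_sum[of _ "\<lambda>b. b", symmetric]) auto
      finally show ?thesis .
    qed
    ultimately show ?thesis by (simp add: s)
  qed
  ultimately show ?thesis by blast
qed

text \<open>Rescale \<open>y - x\<close> to a vector \<open>v\<close> of length between
  \<open>d\<close> and \<open>2 d\<close>. If its part in \<open>span S\<close> has length at least
  \<open>d / 2\<close>, steepness applies to that part, and moving its end to \<open>y\<close> costs
  the norm of the rest. If not, the rest alone has length at least
  \<open>d / 2 \<ge> 1/2 \<ge> c\<close>.\<close>

lemma steep_lower_bound: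
  fixes x y :: "'e::euclidean_space"
  assumes r: "pm r" and st: "steep c S r l (corner l x)" and S: "S \<subseteq> Basis" and c: "c \<le> 1/2"
    and d: "real DIM('e) * (1/2) ^ l \<le> dist x y" "dist x y < 2 * real DIM('e) * (1/2) ^ l"
  shows "c * (1/2) ^ l \<le> r x y + norm (rest S (y - x))"
proof -
  let ?d = "real DIM('e)"
  have d1: "?d \<ge> 1" by (simp add: Suc_leI)
  define v where "v = 2 ^ l *\<^sub>R (y - x)"
  have y: "y - x = (1/2) ^ l *\<^sub>R v"
  proof -
    have "(1/2::real) ^ l * 2 ^ l = 1" by (simp add: power_one_over)
    then show ?thesis unfolding v_def scaleR_scaleR by simp
  qed
  have h: "(2::real) ^ l * (1/2) ^ l = 1" by (simp add: power_one_over)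
  have nv: "norm v = 2 ^ l * dist x y" by (simp add: v_def dist_norm norm_minus_commute)
  have "2 ^ l * (?d * (1/2) ^ l) \<le> 2 ^ l * dist x y" using d(1) by (rule mult_left_mono) simp
  then have nv1: "?d \<le> norm v" unfolding nv using h by (metis mult.left_commute mult.right_neutral)
  have "2 ^ l * dist x y \<le> 2 ^ l * (2 * ?d * (1/2) ^ l)" using d(2) by (intro mult_left_mono) auto
  then have nv2: "norm v \<le> 2 * ?d" unfolding nv using h by (metis mult.left_commute mult.right_neutral)
  define v1 where "v1 = v - rest S v"
  have n1: "norm v1 \<le> 2 * ?d" unfolding v1_def using norm_diff_rest_le[OF S, of v] nv2 by linarith
  have main: "c \<le> 2 ^ l * r x y + norm (rest S v)"
  proof (cases "?d / 2 \<le> norm v1")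
    case True
    then have "v1 \<in> annulus S" unfolding annulus_def using n1 diff_rest_span[OF S, of v] by (simp add: v1_def)
    then have "c \<le> dq r l x v1" using st mem_cell_corner unfolding steep_def by blast
    also have "dq r l x v1 = 2 ^ l * r x (x + (1/2) ^ l *\<^sub>R v1)" by (simp add: dq_def)
    also have "\<dots> \<le> 2 ^ l * (r x y + (1/2) ^ l * norm (rest S v))"
    proof (rule mult_left_mono)
      have "x + (1/2) ^ l *\<^sub>R v1 - y = (1/2) ^ l *\<^sub>R v1 - (y - x)" by simp
      also have "\<dots> = - ((1/2) ^ l *\<^sub>R rest S v)" unfolding y v1_def by (simp add: scaleR_diff_right)
      finally have "dist y (x + (1/2) ^ l *\<^sub>R v1) = (1/2) ^ l * norm (rest S v)"
        by (simp add: dist_norm norm_minus_commute[of y])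
      then show "r x (x + (1/2) ^ l *\<^sub>R v1) \<le> r x y + (1/2) ^ l * norm (rest S v)"
        using pm_lip[OF r, of x "x + (1/2) ^ l *\<^sub>R v1" x y] by (simp add: dist_commute)
    qed simp
    also have "\<dots> = 2 ^ l * r x y + (2 ^ l * (1/2) ^ l) * norm (rest S v)" by (simp add: distrib_left mult.assoc)
    finally show ?thesis by (simp only: h mult_1)
  next
    case False
    have "norm v \<le> norm v1 + norm (rest S v)" using norm_triangle_ineq[of v1 "rest S v"] by (simp add: v1_def)
    moreover have "0 \<le> 2 ^ l * r x y" using pm_nonneg[OF r] by simp
    ultimately show ?thesis using False nv1 d1 c by linarith
  qed
  have "(1/2) ^ l * c \<le> (1/2) ^ l * (2 ^ l * r x y + norm (rest S v))" by (rule mult_left_mono[OF main]) simp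
  also have "\<dots> = (2 ^ l * (1/2) ^ l) * r x y + (1/2) ^ l * norm (rest S v)" by (simp add: distrib_left)
  also have "\<dots> = r x y + norm (rest S (y - x))" unfolding h y rest_scaleR by simp
  finally show ?thesis by (simp add: mult.commute)
qed

text \<open>An affine rescaling brings the image of \<phi> into the unit cube. \<open>L\<close> is
  the product of \<open>4 d / c\<close>, from the lower bound \<open>key\<close>, and
  \<open>20 d\<close>, the factor lost by the rescaled map.\<close>

lemma bilipschitz_piece:
  fixes X :: "'x metric" and f :: "(real^'n) \<times> (real^'m) \<Rightarrow> 'x"
    and A :: "((real^'n) \<times> (real^'m)) set" and \<phi> :: "(real^'n) \<times> (real^'m) \<Rightarrow> (real^'n) \<times> (real^'m)"
  assumes c: "0 < c" "c \<le> 1/2" and d: "d \<ge> 1"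
    and f: "\<And>p q. p \<in> A \<Longrightarrow> q \<in> A \<Longrightarrow> mdist X (f p) (f q) \<le> dist p q"
    and bd: "\<And>p. p \<in> A \<Longrightarrow> norm (\<phi> p) \<le> 5 * d"
    and up: "\<And>p q. p \<in> A \<Longrightarrow> q \<in> A \<Longrightarrow> dist (\<phi> p) (\<phi> q) \<le> 2 * dist p q"
    and low: "\<And>p q. p \<in> A \<Longrightarrow> q \<in> A \<Longrightarrow> dist p q / 2 \<le> dist (\<phi> p) (\<phi> q)"
    and key: "\<And>p q. p \<in> A \<Longrightarrow> q \<in> A \<Longrightarrow> c / (4 * d) * dist p q \<le> mdist X (f p) (f q) + dist (snd (\<phi> p)) (snd (\<phi> q))"
    and L: "L = 80 * d\<^sup>2 / c"
  shows "\<exists>\<psi> :: (real^'n) \<times> (real^'m) \<Rightarrow> (real^'n) \<times> (real^'m). \<psi> ` A \<subseteq> unit_cube \<and> bilipschitz_on L A dist dist \<psi> \<and>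
     bilipschitz_on L (\<psi> ` A) dist (max_dist (mdist X) dist) (\<lambda>(x, y). (f (inv_into A \<psi> (x, y)), y))"
proof -
  \<comment> \<open>Since \<phi> is bounded by \<open>5 d\<close>, division by \<open>10 d\<close>
    leaves coordinates of absolute value at most \<open>1/2\<close> around the center of the
    cube.\<close>
  define \<psi> where "\<psi> p = (1/2) *\<^sub>R One + (1 / (10 * d)) *\<^sub>R \<phi> p" for p
  have dd: "dist (\<psi> p) (\<psi> q) = dist (\<phi> p) (\<phi> q) / (10 * d)" for p q
  proof -
    have "\<psi> p - \<psi> q = (1 / (10 * d)) *\<^sub>R (\<phi> p - \<phi> q)" by (simp add: \<psi>_def scaleR_diff_right)
    then have "norm (\<psi> p - \<psi> q) = \<bar>1 / (10 * d)\<bar> * norm (\<phi> p - \<phi> q)" by (simp only: norm_scaleR)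
    then show ?thesis using d by (simp add: dist_norm)
  qed
  have ds: "dist (snd (\<psi> p)) (snd (\<psi> q)) = dist (snd (\<phi> p)) (snd (\<phi> q)) / (10 * d)" for p q
  proof -
    have "snd (\<psi> p) - snd (\<psi> q) = (1 / (10 * d)) *\<^sub>R (snd (\<phi> p) - snd (\<phi> q))" by (simp add: \<psi>_def scaleR_diff_right)
    then have "norm (snd (\<psi> p) - snd (\<psi> q)) = \<bar>1 / (10 * d)\<bar> * norm (snd (\<phi> p) - snd (\<phi> q))" by (simp only: norm_scaleR)
    then show ?thesis using d by (simp add: dist_norm)
  qed
  have L20: "20 * d \<le> L"
  proof -
    have "20 * d * c \<le> 80 * d\<^sup>2"
    proof -
      have "20 * d * c \<le> 20 * d * 1" using c d by (intro mult_left_mono) auto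
      also have "\<dots> \<le> 80 * d * d" using d by simp
      finally show ?thesis by (simp add: power2_eq_square)
    qed
    then show ?thesis unfolding L using c by (simp add: pos_le_divide_eq)
  qed
  have L1: "L \<ge> 1" "L > 0" using L20 d by linarith+
  have cube: "\<psi> ` A \<subseteq> unit_cube"
  proof
    fix z assume "z \<in> \<psi> ` A"
    then obtain p where p: "p \<in> A" "z = \<psi> p" by blast
    show "z \<in> unit_cube" unfolding unit_cube_def mem_box
    proof
      fix b :: "(real^'n) \<times> (real^'m)" assume b: "b \<in> Basis"
      have "\<bar>\<phi> p \<bullet> b\<bar> \<le> 5 * d" using Basis_le_norm[OF b, of "\<phi> p"] bd[OF p(1)] by linarith
      then have "\<bar>\<phi> p \<bullet> b\<bar> / (10 * d) \<le> 1 / 2" using d by (simp add: field_simps)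
      then have "\<bar>\<phi> p \<bullet> b / (10 * d)\<bar> \<le> 1 / 2" using d by (simp add: abs_divide)
      moreover have "\<psi> p \<bullet> b = 1 / 2 + \<phi> p \<bullet> b / (10 * d)" using b by (simp add: \<psi>_def inner_simps)
      ultimately show "0 \<bullet> b \<le> z \<bullet> b \<and> z \<bullet> b \<le> One \<bullet> b" using b p(2) by (simp add: abs_le_iff; linarith)
    qed
  qed
  have lower: "dist p q \<le> 20 * d * dist (\<psi> p) (\<psi> q)" if "p \<in> A" "q \<in> A" for p q
    using low[OF that] d unfolding dd by (simp add: field_simps)
  have upper: "dist (\<psi> p) (\<psi> q) \<le> dist p q" if "p \<in> A" "q \<in> A" for p q
  proof -
    have "dist (\<psi> p) (\<psi> q) \<le> 2 * dist p q / (10 * d)" unfolding dd using up[OF that] d by (intro divide_right_mono) auto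
    also have "\<dots> \<le> 2 * dist p q / 2" using d by (intro divide_left_mono) auto
    finally show ?thesis by simp
  qed
  have b1: "bilipschitz_on L A dist dist \<psi>"
    unfolding bilipschitz_on_def
  proof (intro ballI conjI)
    fix p q assume pq: "p \<in> A" "q \<in> A"
    have "dist p q \<le> L * dist (\<psi> p) (\<psi> q)"
      using lower[OF pq] mult_right_mono[OF L20, of "dist (\<psi> p) (\<psi> q)"] by simp
    then show "dist p q / L \<le> dist (\<psi> p) (\<psi> q)" using L1 by (simp add: divide_le_eq mult.commute)
    show "dist (\<psi> p) (\<psi> q) \<le> L * dist p q"
      using upper[OF pq] mult_right_mono[OF L1(1), of "dist p q"] by simp
  qed
  have inj: "inj_on \<psi> A"
  proof (rule inj_onI)
    fix p q assume pq: "p \<in> A" "q \<in> A" "\<psi> p = \<psi> q"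
    then have "dist p q \<le> 0" using lower[OF pq(1,2)] by simp
    then show "p = q" by simp
  qed
  have b2: "bilipschitz_on L (\<psi> ` A) dist (max_dist (mdist X) dist) (\<lambda>(x, y). (f (inv_into A \<psi> (x, y)), y))"
    unfolding bilipschitz_on_def
  proof (intro ballI)
    fix z z' assume "z \<in> \<psi> ` A" "z' \<in> \<psi> ` A"
    then obtain p q where p: "p \<in> A" "z = \<psi> p" and q: "q \<in> A" "z' = \<psi> q" by blast
    have ev: "(\<lambda>(x, y). (f (inv_into A \<psi> (x, y)), y)) (\<psi> p) = (f p, snd (\<psi> p))" if "p \<in> A" for p
      using that inj by (simp add: case_prod_beta)
    define R s D where "R = mdist X (f p) (f q)" and "s = dist (snd (\<phi> p)) (snd (\<phi> q))" and "D = dist p q"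
    have R0: "R \<ge> 0" "s \<ge> 0" "D \<ge> 0" by (auto simp: R_def s_def D_def)
    have e: "max_dist (mdist X) dist ((\<lambda>(x, y). (f (inv_into A \<psi> (x, y)), y)) z) ((\<lambda>(x, y). (f (inv_into A \<psi> (x, y)), y)) z')
      = max R (s / (10 * d))"
      unfolding p(2) q(2) ev[OF p(1)] ev[OF q(1)] by (simp add: max_dist_def R_def s_def ds)
    have lo: "dist z z' / L \<le> max R (s / (10 * d))"
    proof -
      have "dist z z' / L \<le> D / L" using upper[OF p(1) q(1)] L1 unfolding p(2) q(2) D_def by (intro divide_right_mono) auto
      also have "\<dots> = (c / (4 * d) * D) / (20 * d)" using d c by (simp add: L power2_eq_square)
      also have "\<dots> \<le> (R + s) / (20 * d)"
        using key[OF p(1) q(1)] d unfolding R_def s_def D_def by (intro divide_right_mono) auto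
      \<comment> \<open>Half of \<open>R\<close> plus half of \<open>s / (10 d)\<close> is at most
        their maximum.\<close>
      also have "\<dots> = R / (20 * d) + (s / (10 * d)) / 2" using d by (simp add: field_simps)
      also have "R / (20 * d) \<le> R / 2" using R0 d by (intro divide_left_mono) auto
      finally show ?thesis by (simp add: max_def; linarith)
    qed
    have "R \<le> D" unfolding R_def D_def by (rule f[OF p(1) q(1)])
    also have "D \<le> 20 * d * dist z z'" unfolding D_def p(2) q(2) by (rule lower[OF p(1) q(1)])
    also have "\<dots> \<le> L * dist z z'" by (rule mult_right_mono[OF L20]) simp
    finally have hi1: "R \<le> L * dist z z'" .
    have "s / (10 * d) = dist (snd z) (snd z')" unfolding p(2) q(2) ds s_def ..
    also have "\<dots> \<le> dist z z'" by (rule dist_snd_le)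
    also have "\<dots> \<le> L * dist z z'" using mult_right_mono[OF L1(1), of "dist z z'"] by simp
    finally have hi2: "s / (10 * d) \<le> L * dist z z'" .
    show "dist z z' / L \<le> max_dist (mdist X) dist ((\<lambda>(x, y). (f (inv_into A \<psi> (x, y)), y)) z) ((\<lambda>(x, y). (f (inv_into A \<psi> (x, y)), y)) z')
      \<and> max_dist (mdist X) dist ((\<lambda>(x, y). (f (inv_into A \<psi> (x, y)), y)) z) ((\<lambda>(x, y). (f (inv_into A \<psi> (x, y)), y)) z') \<le> L * dist z z'"
      unfolding e using lo hi1 hi2 by simp
  qed
  show ?thesis by (rule exI[of _ \<psi>]) (rule conjI[OF cube conjI[OF b1 b2]])
qed

text \<open>Blow-ups and translates leave the cube, so the pseudometric has to live on the whole
  space. The closest-point projection is 1-Lipschitz and fixes the cube.\<close>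

lemma pm_pullback:
  fixes f :: "'e::euclidean_space \<Rightarrow> 'x"
  assumes f: "one_lipschitz_on unit_cube X f"
  defines "r \<equiv> \<lambda>x y. mdist X (f (closest_point unit_cube x)) (f (closest_point unit_cube y))"
  shows "pm r" "\<And>x y. x \<in> unit_cube \<Longrightarrow> y \<in> unit_cube \<Longrightarrow> r x y = mdist X (f x) (f y)"
    "\<And>x. f (closest_point unit_cube x) \<in> mspace X"
proof -
  have uc: "closed (unit_cube :: 'e set)" "convex (unit_cube :: 'e set)" "(unit_cube :: 'e set) \<noteq> {}"
    unfolding unit_cube_def by (auto simp: box_ne_empty)
  have cp: "closest_point unit_cube x \<in> unit_cube" for x :: 'e
    by (rule closest_point_in_set[OF uc(1,3)])
  show ms: "\<And>x. f (closest_point unit_cube x) \<in> mspace X"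
    using f cp unfolding one_lipschitz_on_def by blast
  show "r x y = mdist X (f x) (f y)" if "x \<in> unit_cube" "y \<in> unit_cube" for x y
    using that by (simp add: r_def closest_point_self)
  show "pm r"
    unfolding pm_def
  proof (intro conjI allI)
    fix x y z :: 'e
    show "0 \<le> r x y" by (simp add: r_def)
    show "r x y = r y x" unfolding r_def by (rule mdist_commute)
    show "r x z \<le> r x y + r y z" unfolding r_def by (rule mdist_triangle[OF ms ms ms])
    have "r x y \<le> dist (closest_point unit_cube x) (closest_point unit_cube y)"
      using f cp unfolding one_lipschitz_on_def r_def by blast
    also have "\<dots> \<le> dist x y" by (rule closest_point_lipschitz[OF uc(2,1,3)])
    finally show "r x y \<le> dist x y" .
  qed
qed

lemma emeasure_unit_minus_half: "emeasure lborel (unit_cube - half_cube :: 'e::euclidean_space set) = 0"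
proof -
  have "emeasure lborel (unit_cube - half_cube :: 'e set) \<le> emeasure lborel (cbox 0 One - box 0 (One :: 'e))"
    unfolding unit_cube_def by (rule emeasure_mono) (auto simp: half_cube_def mem_box less_imp_le)
  also have "\<dots> = emeasure lborel (cbox 0 (One :: 'e)) - emeasure lborel (box 0 (One :: 'e))"
    by (rule emeasure_Diff) (auto simp: emeasure_lborel_box_eq box_subset_cbox)
  also have "\<dots> = 0" by (simp add: emeasure_lborel_box_eq emeasure_lborel_cbox_eq)
  finally show ?thesis by simp
qed

lemma disjoint_refinement:
  fixes A :: "nat \<Rightarrow> 'a set"
  defines "F \<equiv> \<lambda>i. A i - (\<Union>j\<in>{1..<i}. A j)"
  shows "(\<Union>i\<in>{1..N}. F i) = (\<Union>i\<in>{1..N}. A i)" "disjoint_family_on F {1..N}"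
proof -
  show "(\<Union>i\<in>{1..N}. F i) = (\<Union>i\<in>{1..N}. A i)"
  proof
    show "(\<Union>i\<in>{1..N}. A i) \<subseteq> (\<Union>i\<in>{1..N}. F i)"
    proof
      fix x assume "x \<in> (\<Union>i\<in>{1..N}. A i)"
      then obtain i where i: "i \<in> {1..N}" "x \<in> A i" by blast
      define k where "k = (LEAST k. 1 \<le> k \<and> x \<in> A k)"
      have k: "1 \<le> k" "x \<in> A k" using LeastI[of "\<lambda>k. 1 \<le> k \<and> x \<in> A k" i] i by (auto simp: k_def)
      have "k \<le> i" unfolding k_def by (rule Least_le) (use i in auto)
      moreover have "x \<notin> A j" if "j \<in> {1..<k}" for j
        using not_less_Least[of j "\<lambda>k. 1 \<le> k \<and> x \<in> A k"] that by (auto simp: k_def)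
      ultimately show "x \<in> (\<Union>i\<in>{1..N}. F i)" using k i unfolding F_def by fastforce
    qed
  qed (auto simp: F_def)
  have "F i \<inter> F j = {}" if "i < j" "i \<in> {1..N}" for i j using that unfolding F_def by auto
  then show "disjoint_family_on F {1..N}"
    unfolding disjoint_family_on_def by (metis Int_commute linorder_neqE_nat)
qed

text \<open>All constants are fixed before \<open>X\<close> and \<open>f\<close>: \<open>c\<close>
  and \<open>M\<close> control steepness and breaks, \<open>s\<close> makes the strips removed at
  breaks small, and \<open>J\<close> makes the gluing error small compared with \<open>c\<close>. A
  point of \<open>G\<close> either lies in an open set of small measure or has a thin cell, which
  are the two cases of \<open>mapping_content_le\<close>.\<close>

proposition decomposition_exists:
  fixes \<alpha> :: real
  assumes \<alpha>: "\<alpha> > 0"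
  shows "\<exists>(N::nat) (L::real). L \<ge> 1 \<and>
            (\<forall>(X :: 'x metric) (f :: (real^'n) \<times> (real^'m) \<Rightarrow> 'x).
               one_lipschitz_on unit_cube X f \<longrightarrow> has_decomposition \<alpha> N L X f)"
proof -
  define n where "n = CARD('n)"
  define d where "d = real DIM((real^'n) \<times> (real^'m))"
  have d1: "d \<ge> 1" using DIM_positive[where 'a = "(real^'n) \<times> (real^'m)"] unfolding d_def by linarith
  have nd: "n \<le> DIM((real^'n) \<times> (real^'m))" by (simp add: n_def)
  \<comment> \<open>A single ball of radius \<open>d 2^-k\<close> covers the image of a cell of
    level \<open>k\<close>.\<close>
  define C where "C = (2 * d) ^ n"
  have C: "C > 0" using d1 by (simp add: C_def)
  \<comment> \<open>\<open>H\<close>, the strips and outer regularity contribute \<epsilon> each to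
    the measure of the open set, which thus costs at most
    \<open>3 \<epsilon> C = \<alpha> / 4\<close>. The thin cells cost as much again, and the sum
    stays strictly below \<alpha>.\<close>
  define \<epsilon> where "\<epsilon> = \<alpha> / (12 * C)"
  have eps: "\<epsilon> > 0" using \<alpha> C by (simp add: \<epsilon>_def)
  have al4: "\<alpha> / 4 > 0" using \<alpha> by simp
  obtain S0 :: "((real^'n) \<times> (real^'m)) set" where S0: "S0 \<subseteq> Basis" "card S0 = n"
    using nd by (meson obtain_subset_with_card_n)
  obtain c M where c: "0 < c" "c \<le> 1/2" and few:
    "\<And>r. pm (r :: (real^'n) \<times> (real^'m) \<Rightarrow> (real^'n) \<times> (real^'m) \<Rightarrow> real) \<Longrightarrow> \<exists>nxt H. (\<forall>k x. nxt k x \<subseteq> Basis \<and> card (nxt k x) = n) \<and>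
       H \<in> sets borel \<and> emeasure lborel H \<le> ennreal \<epsilon> \<and>
       (\<forall>p\<in>half_cube - H. (\<forall>k. \<not> thin (\<alpha> / 4) n r k (corner k p)) \<longrightarrow>
          (\<forall>K. coding.cnt (\<lambda>S k x. steep c S r k x) nxt S0 K p \<le> M))"
    using few_breaks[OF al4 eps nd S0(1)] by blast
  obtain s where s: "2 * d * real M / \<epsilon> < 2 ^ s" using real_arch_pow[of 2] by auto
  \<comment> \<open>The relative error of \<open>pair_scale\<close> becomes at most
    \<open>c / (4 d)\<close>, which is half of the \<open>c / (2 d)\<close> that steepness yields
    per unit of distance.\<close>
  obtain J where J: "32 * d * d * 2 ^ s / c < 2 ^ J" using real_arch_pow[of 2] by auto
  define L where "L = 80 * d\<^sup>2 / c"
  define N where "N = ((s + DIM((real^'n) \<times> (real^'m))) * ((2 * DIM((real^'n) \<times> (real^'m)) + 1) * 2 ^ J) ^ DIM((real^'n) \<times> (real^'m))) ^ M"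
  have L1: "L \<ge> 1"
  proof -
    have "1 * 1 \<le> d * d" using d1 by (intro mult_mono) auto
    then have "c \<le> 80 * d\<^sup>2" using c by (simp add: power2_eq_square)
    then show ?thesis using c by (simp add: L_def)
  qed
  have main: "has_decomposition \<alpha> N L X f" if f: "one_lipschitz_on unit_cube X f" for X :: "'x metric" and f :: "(real^'n) \<times> (real^'m) \<Rightarrow> 'x"
  proof -
    define ft where "ft x = f (closest_point unit_cube x)" for x
    define r where "r x y = mdist X (ft x) (ft y)" for x y
    have r: "pm r" and req: "\<And>x y. x \<in> unit_cube \<Longrightarrow> y \<in> unit_cube \<Longrightarrow> r x y = mdist X (f x) (f y)"
      and ms: "\<And>x. ft x \<in> mspace X"
      using pm_pullback[OF f] unfolding r_def ft_def by blast+
    have fts: "ft x = f x" if "x \<in> unit_cube" for x using that by (simp add: ft_def closest_point_self)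
    obtain nxt H where nxt: "\<And>k x. nxt k x \<subseteq> Basis \<and> card (nxt k x) = n" and H: "H \<in> sets borel" "emeasure lborel H \<le> ennreal \<epsilon>"
      and cntM: "\<And>p K. p \<in> half_cube - H \<Longrightarrow> (\<And>k. \<not> thin (\<alpha> / 4) n r k (corner k p)) \<Longrightarrow>
          coding.cnt (\<lambda>S k x. steep c S r k x) nxt S0 K p \<le> M"
      using few[OF r] by blast
    have "\<forall>S. \<exists>Q :: (real^'n) \<times> (real^'m) \<Rightarrow> (real^'n) \<times> (real^'m). linear Q \<and> (\<forall>v. norm (Q v) = norm v) \<and>
       (S \<subseteq> Basis \<and> card S = n \<longrightarrow> (\<forall>v. norm (snd (Q v)) = norm (rest S v)))"
    proof
      fix S :: "((real^'n) \<times> (real^'m)) set"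
      show "\<exists>Q :: (real^'n) \<times> (real^'m) \<Rightarrow> (real^'n) \<times> (real^'m). linear Q \<and> (\<forall>v. norm (Q v) = norm v) \<and>
       (S \<subseteq> Basis \<and> card S = n \<longrightarrow> (\<forall>v. norm (snd (Q v)) = norm (rest S v)))"
      proof (cases "S \<subseteq> Basis \<and> card S = n")
        case True
        then show ?thesis using coordinate_isometry[of S] unfolding n_def by blast
      next
        case False
        then show ?thesis by (intro exI[of _ id]) (auto simp: linear_id)
      qed
    qed
    from choice[OF this] obtain P :: "((real^'n) \<times> (real^'m)) set \<Rightarrow> (real^'n) \<times> (real^'m) \<Rightarrow> (real^'n) \<times> (real^'m)"
      where P: "\<And>S. linear (P S)" "\<And>S v. norm (P S v) = norm v"
        "\<And>S v. S \<subseteq> Basis \<Longrightarrow> card S = n \<Longrightarrow> norm (snd (P S v)) = norm (rest S v)" by blast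
    interpret gluing "\<lambda>S k x. steep c S r k x" nxt S0 P J s M
      by (rule gluing.intro) (rule P(1), rule P(2))
    have stv: "st k p \<subseteq> Basis \<and> card (st k p) = n" for k p by (induction k) (use S0 nxt in auto)
    have err: "8 * d * 2 ^ s / 2 ^ J \<le> c / (4 * d)" using J c d1 by (simp add: field_simps)
    have c4: "c / (4 * d) \<le> 1/2"
    proof -
      have "c / (4 * d) \<le> c / 1" using c d1 by (intro divide_left_mono) auto
      then show ?thesis using c by simp
    qed
    have pair: "dist (\<phi> p) (\<phi> q) \<le> 2 * dist p q \<and> dist p q / 2 \<le> dist (\<phi> p) (\<phi> q) \<and>
        c / (4 * d) * dist p q \<le> r p q + dist (snd (\<phi> p)) (snd (\<phi> q))"
      if p: "p \<in> piece w" and q: "q \<in> piece w" for p q w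
    proof (cases "p = q")
      case True
      then show ?thesis by (simp add: pm_refl[OF r])
    next
      case False
      from pair_scale[OF p q False] obtain l x where x: "x \<in> {p, q}" "\<not> brk l x"
        and dl: "d * (1/2) ^ l \<le> dist p q" "dist p q < 2 * d * (1/2) ^ l"
        and dphi0: "norm (\<phi> p - \<phi> q - P (st l x) (p - q)) \<le> 8 * d * 2 ^ s / 2 ^ J * dist p q"
        unfolding d_def by blast
      define S where "S = st l x"
      have S: "S \<subseteq> Basis" "card S = n" using stv by (auto simp: S_def)
      have dphi: "norm (\<phi> p - \<phi> q - P S (p - q)) \<le> c / (4 * d) * dist p q"
        using dphi0 mult_right_mono[OF err, of "dist p q"] by (simp add: S_def)
      have nP: "norm (P S (p - q)) = dist p q" by (simp add: P(2) dist_norm)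
      have half: "c / (4 * d) * dist p q \<le> dist p q / 2" using mult_right_mono[OF c4, of "dist p q"] by simp
      have u: "dist (\<phi> p) (\<phi> q) \<le> 2 * dist p q"
      proof -
        have "norm (\<phi> p - \<phi> q) \<le> norm (\<phi> p - \<phi> q - P S (p - q)) + norm (P S (p - q))"
          using norm_triangle_ineq[of "\<phi> p - \<phi> q - P S (p - q)" "P S (p - q)"] by simp
        then show ?thesis using dphi nP half zero_le_dist[of p q] unfolding dist_norm[of "\<phi> p"] by linarith
      qed
      have lo: "dist p q / 2 \<le> dist (\<phi> p) (\<phi> q)"
        using norm_triangle_ineq3[of "\<phi> p - \<phi> q" "P S (p - q)"] dphi nP half unfolding dist_norm[of "\<phi> p"] by linarith
      \<comment> \<open>The absence of a break at level \<open>l\<close> says just this.\<close>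
      have "steep c S r l (corner l x)" using x(2) by (simp add: brk_def S_def)
      moreover obtain y where y: "{x, y} = {p, q}" using x(1) by blast
      ultimately have sl: "c * (1/2) ^ l \<le> r x y + norm (rest S (y - x))"
        using steep_lower_bound[OF r _ S(1) c(2), of l x y] dl unfolding d_def
        by (metis dist_commute doubleton_eq_iff)
      have "r x y = r p q" using y pm_sym[OF r] by (metis doubleton_eq_iff)
      moreover have "norm (rest S (y - x)) = norm (snd (P S (p - q)))"
      proof -
        have "y - x = p - q \<or> y - x = (-1) *\<^sub>R (p - q)" using y by (auto simp: doubleton_eq_iff)
        then have "norm (rest S (y - x)) = norm (rest S (p - q))"
          using rest_scaleR[of S "-1" "p - q"] by (metis norm_minus_cancel scaleR_minus1_left)
        then show ?thesis using P(3)[OF S] by simp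
      qed
      moreover have "norm (snd (P S (p - q))) \<le> dist (snd (\<phi> p)) (snd (\<phi> q)) + c / (4 * d) * dist p q"
      proof -
        define e where "e = \<phi> p - \<phi> q - P S (p - q)"
        have "snd (P S (p - q)) = (snd (\<phi> p) - snd (\<phi> q)) - snd e" by (simp add: e_def)
        then have "norm (snd (P S (p - q))) \<le> norm (snd (\<phi> p) - snd (\<phi> q)) + norm (snd e)"
          by (metis norm_triangle_ineq4)
        moreover have "norm (snd e) \<le> norm e" using dist_snd_le[of e 0] by simp
        ultimately show ?thesis using dphi unfolding e_def dist_norm by linarith
      qed
      moreover have "c / (2 * d) * dist p q \<le> c * (1/2) ^ l"
      proof -
        have "c / (2 * d) * dist p q \<le> c / (2 * d) * (2 * d * (1/2) ^ l)" using dl(2) c d1 by (intro mult_left_mono) auto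
        also have "\<dots> = c * (1/2) ^ l" using d1 by simp
        finally show ?thesis .
      qed
      moreover have "c / (2 * d) * dist p q = c / (4 * d) * dist p q + c / (4 * d) * dist p q" using d1 by (simp add: field_simps)
      ultimately show ?thesis using u lo sl by linarith
    qed
    have pieceU: "piece w \<subseteq> unit_cube" for w
      using half_cube_subset_cbox unfolding piece_def unit_cube_def by blast
    have cardN: "card codes = N" by (simp add: card_codes N_def)
    obtain e where e: "bij_betw e {1..N} codes"
      using ex_bij_betw_nat_finite_1[OF finite_codes] cardN by metis
    define A where "A i = piece (e i)" for i
    define F where "F i = A i - (\<Union>j\<in>{1..<i}. A j)" for i
    define G where "G = unit_cube - (\<Union>i\<in>{1..N}. F i)"
    have UF: "(\<Union>i\<in>{1..N}. F i) = (\<Union>i\<in>{1..N}. A i)" and dF: "disjoint_family_on F {1..N}"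
      unfolding F_def by (rule disjoint_refinement)+
    have Fm: "F i \<in> sets borel" for i unfolding F_def A_def by (intro sets.Diff sets.finite_UN piece_borel) auto
    have FA: "F i \<subseteq> piece (e i)" for i by (auto simp: F_def A_def)
    have Gm: "G \<in> sets borel" unfolding G_def unit_cube_def using Fm by (intro sets.Diff sets.finite_UN) auto
    have bil: "\<exists>\<psi> :: (real^'n) \<times> (real^'m) \<Rightarrow> (real^'n) \<times> (real^'m). \<psi> ` F i \<subseteq> unit_cube \<and> bilipschitz_on L (F i) dist dist \<psi> \<and>
       bilipschitz_on L (\<psi> ` F i) dist (max_dist (mdist X) dist) (\<lambda>(x, y). (f (inv_into (F i) \<psi> (x, y)), y))" for i
    proof (rule bilipschitz_piece[OF c d1, where \<phi> = \<phi>])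
      show "L = 80 * d\<^sup>2 / c" by (rule L_def)
      fix p assume p: "p \<in> F i"
      have pp: "p \<in> piece (e i)" using p FA by blast
      show "norm (\<phi> p) \<le> 5 * d" unfolding d_def by (rule norm_\<phi>_le[OF pp])
      fix q assume q: "q \<in> F i"
      have qq: "q \<in> piece (e i)" using q FA by blast
      have pu: "p \<in> unit_cube" "q \<in> unit_cube" using pp qq pieceU by blast+
      show "mdist X (f p) (f q) \<le> dist p q" using f pu unfolding one_lipschitz_on_def by blast
      show "dist (\<phi> p) (\<phi> q) \<le> 2 * dist p q" "dist p q / 2 \<le> dist (\<phi> p) (\<phi> q)"
        "c / (4 * d) * dist p q \<le> mdist X (f p) (f q) + dist (snd (\<phi> p)) (snd (\<phi> q))"
        using pair[OF pp qq] req[OF pu] by auto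
    qed
    define T where "T = {p \<in> half_cube. \<exists>k. brk k p \<and> cnt k p < M \<and> \<not> margin s k p}"
    have T: "T \<in> sets borel" "emeasure lborel T \<le> ennreal \<epsilon>"
    proof -
      show "T \<in> sets borel" unfolding T_def by (rule no_margin_borel)
      have "emeasure lborel T \<le> ennreal (2 * d * real M / 2 ^ s)" unfolding T_def d_def by (rule emeasure_no_margin)
      also have "\<dots> \<le> ennreal \<epsilon>" using s eps by (intro ennreal_leI) (simp add: field_simps)
      finally show "emeasure lborel T \<le> ennreal \<epsilon>" .
    qed
    define W where "W = H \<union> T \<union> (unit_cube - half_cube)"
    have Wm: "W \<in> sets borel" unfolding W_def unit_cube_def using H(1) T(1) by auto
    have We: "emeasure lborel W \<le> ennreal \<epsilon> + ennreal \<epsilon>"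
    proof -
      have "emeasure lborel W \<le> emeasure lborel (H \<union> T) + emeasure lborel (unit_cube - half_cube :: ((real^'n) \<times> (real^'m)) set)"
        unfolding W_def using H(1) T(1) by (intro emeasure_subadditive) (auto simp: unit_cube_def)
      also have "\<dots> = emeasure lborel (H \<union> T)" by (simp add: emeasure_unit_minus_half)
      also have "\<dots> \<le> emeasure lborel H + emeasure lborel T" using H(1) T(1) by (intro emeasure_subadditive) auto
      also have "\<dots> \<le> ennreal \<epsilon> + ennreal \<epsilon>" by (rule add_mono[OF H(2) T(2)])
      finally show ?thesis .
    qed
    obtain U where U: "open U" "W \<subseteq> U" "emeasure lborel (U - W) < ennreal \<epsilon>"
      using outer_regular_lborel[OF Wm eps] by blast
    have Ue: "emeasure lborel U \<le> ennreal (3 * \<epsilon>)"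
    proof -
      have "emeasure lborel U = emeasure lborel (W \<union> (U - W))" using U(2) by (simp add: Un_absorb1)
      also have "\<dots> \<le> emeasure lborel W + emeasure lborel (U - W)" using Wm U(1) by (intro emeasure_subadditive) auto
      also have "\<dots> \<le> (ennreal \<epsilon> + ennreal \<epsilon>) + ennreal \<epsilon>" using We U(3) by (intro add_mono) auto
      also have "\<dots> = ennreal (3 * \<epsilon>)" using eps by (simp flip: ennreal_plus)
      finally show ?thesis .
    qed
    have thinc: "hausdorff_content X CARD('n) (f ` cell k (corner k p)) \<le> ennreal (\<alpha> / 4 * ((1/2) ^ k) ^ CARD('n))"
      if th: "thin (\<alpha> / 4) n r k (corner k p)" and p: "p \<in> half_cube" for k p
    proof -
      obtain Y t where Y: "finite Y" "t > 0" "real (card Y) * (2 * t) ^ n \<le> \<alpha> / 4"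
        "\<And>x. x \<in> cell k (corner k p) \<Longrightarrow> \<exists>y\<in>Y. r x y \<le> t * (1/2) ^ k"
        using th unfolding thin_def by blast
      have "hausdorff_content X CARD('n) (f ` cell k (corner k p)) \<le> ennreal (real (card (ft ` Y)) * (2 * (t * (1/2) ^ k)) ^ CARD('n))"
      proof (rule hausdorff_content_le_card)
        show "finite (ft ` Y)" "ft ` Y \<subseteq> mspace X" "t * (1/2) ^ k > 0" using Y ms by auto
        fix a assume "a \<in> f ` cell k (corner k p)"
        then obtain x where x: "x \<in> cell k (corner k p)" "a = f x" by blast
        have xu: "x \<in> unit_cube" using x(1) cell_subset_unit[OF p] by blast
        obtain y where y: "y \<in> Y" "r x y \<le> t * (1/2) ^ k" using Y(4)[OF x(1)] by blast
        have "mdist X (ft y) a \<le> t * (1/2) ^ k" using y(2) unfolding r_def fts[OF xu] x(2) by (simp add: mdist_commute)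
        moreover have "a \<in> mspace X" using ms[of x] fts[OF xu] x(2) by simp
        ultimately show "\<exists>z\<in>ft ` Y. a \<in> mspace X \<and> mdist X z a \<le> t * (1/2) ^ k" using y(1) by blast
      qed
      also have "\<dots> \<le> ennreal (\<alpha> / 4 * ((1/2) ^ k) ^ CARD('n))"
      proof (rule ennreal_leI)
        have "real (card (ft ` Y)) * (2 * (t * (1/2) ^ k)) ^ CARD('n) = real (card (ft ` Y)) * (2 * t) ^ n * ((1/2) ^ k) ^ n"
          by (simp add: n_def power_mult_distrib)
        also have "\<dots> \<le> real (card Y) * (2 * t) ^ n * ((1/2) ^ k) ^ n"
          using card_image_le[OF Y(1), of ft] Y(2) by (intro mult_right_mono) auto
        also have "\<dots> \<le> \<alpha> / 4 * ((1/2) ^ k) ^ n" using Y(3) by (rule mult_right_mono) simp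
        finally show "real (card (ft ` Y)) * (2 * (t * (1/2) ^ k)) ^ CARD('n) \<le> \<alpha> / 4 * ((1/2) ^ k) ^ CARD('n)"
          by (simp add: n_def)
      qed
      finally show ?thesis .
    qed
    have "mapping_content X f G \<le> ennreal (\<alpha> / 4) + ennreal C * emeasure lborel U"
    proof (rule mapping_content_le)
      show "0 \<le> C" "0 \<le> \<alpha> / 4" using C \<alpha> by auto
      show "open U" by (rule U(1))
      show "G \<subseteq> unit_cube" by (auto simp: G_def)
    next
      fix k and x :: "(real^'n) \<times> (real^'m)" assume x: "x \<in> half_cube"
      have cu: "cell k (corner k x) \<subseteq> unit_cube" by (rule cell_subset_unit[OF x])
      have cc: "corner k x \<in> cell k (corner k x)" using mem_cell_corner[of "corner k x" k] by (simp add: corner_idem)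
      have fX: "f ` unit_cube \<subseteq> mspace X" using f by (simp add: one_lipschitz_on_def)
      have "hausdorff_content X CARD('n) (f ` cell k (corner k x)) \<le> ennreal (real (card {f (corner k x)}) * (2 * (d * (1/2) ^ k)) ^ CARD('n))"
      proof (rule hausdorff_content_le_card)
        show "{f (corner k x)} \<subseteq> mspace X" using fX cu cc by blast
        show "d * (1/2) ^ k > 0" using d1 by simp
        fix a assume "a \<in> f ` cell k (corner k x)"
        then obtain y where y: "y \<in> cell k (corner k x)" "a = f y" by blast
        have "mdist X (f (corner k x)) (f y) \<le> dist (corner k x) y" using f cu cc y(1) unfolding one_lipschitz_on_def by blast
        also have "\<dots> \<le> d * (1/2) ^ k" unfolding d_def by (rule dist_cell[OF cc y(1)])
        finally show "\<exists>z\<in>{f (corner k x)}. a \<in> mspace X \<and> mdist X z a \<le> d * (1/2) ^ k" using fX cu y by blast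
      qed simp
      also have "real (card {f (corner k x)}) * (2 * (d * (1/2) ^ k)) ^ CARD('n) = C * ((1/2) ^ k) ^ CARD('n)"
        by (simp add: C_def n_def power_mult_distrib)
      finally show "hausdorff_content X CARD('n) (f ` cell k (corner k x)) \<le> ennreal (C * ((1/2) ^ k) ^ CARD('n))" .
    next
      fix p assume p: "p \<in> G"
      show "p \<in> U \<or> (\<exists>k. \<exists>x\<in>half_cube. p \<in> cell k (corner k x) \<and>
        hausdorff_content X CARD('n) (f ` cell k (corner k x)) \<le> ennreal (\<alpha> / 4 * ((1/2) ^ k) ^ CARD('n)))"
      proof (cases "p \<in> W")
        case True
        then show ?thesis using U(2) by blast
      next
        case False
        have ph: "p \<in> half_cube" "p \<notin> H" "p \<notin> T" using False p by (auto simp: W_def G_def)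
        \<comment> \<open>Otherwise \<open>p\<close> has at most \<open>M\<close> breaks, all with a
          margin, and so belongs to one of the pieces.\<close>
        have "\<exists>k. thin (\<alpha> / 4) n r k (corner k p)"
        proof (rule ccontr)
          assume "\<not> ?thesis"
          then have cM: "cnt K p \<le> M" for K using cntM[of p K] ph by blast
          have "margin s k p" if "brk k p" for k
          proof -
            have "cnt k p < M" using cM[of "Suc k"] that by (simp add: cnt_Suc)
            then show ?thesis using ph(1,3) that by (auto simp: T_def)
          qed
          from pieces_cover[OF ph(1) cM this] obtain w where w: "w \<in> codes" "p \<in> piece w" by blast
          obtain i where "i \<in> {1..N}" "w = e i"
            using w(1) unfolding bij_betw_imp_surj_on[OF e, symmetric] by blast
          then have "p \<in> (\<Union>i\<in>{1..N}. A i)" using w(2) by (auto simp: A_def)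
          then show False using p UF by (auto simp: G_def)
        qed
        then obtain k where "thin (\<alpha> / 4) n r k (corner k p)" by blast
        from thinc[OF this ph(1)] ph(1) mem_cell_corner show ?thesis by blast
      qed
    qed
    also have "\<dots> \<le> ennreal (\<alpha> / 4) + ennreal C * ennreal (3 * \<epsilon>)" by (intro add_left_mono mult_left_mono Ue) simp
    also have "ennreal C * ennreal (3 * \<epsilon>) = ennreal (\<alpha> / 4)"
    proof -
      have "C * (3 * \<epsilon>) = \<alpha> / 4" using C by (simp add: \<epsilon>_def)
      moreover have "ennreal C * ennreal (3 * \<epsilon>) = ennreal (C * (3 * \<epsilon>))"
        by (rule ennreal_mult[symmetric]) (use C eps in auto)
      ultimately show ?thesis by (simp only:)
    qed
    also have "ennreal (\<alpha> / 4) + ennreal (\<alpha> / 4) = ennreal (\<alpha> / 2)" using \<alpha> by (simp flip: ennreal_plus)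
    also have "\<dots> < ennreal \<alpha>" using \<alpha> by (simp add: ennreal_lessI)
    finally have mc: "mapping_content X f G < ennreal \<alpha>" .
    have "unit_cube = (\<Union>i\<in>{1..N}. F i) \<union> G" using FA pieceU by (auto simp: G_def)
    moreover have "F i \<inter> G = {}" if "i \<in> {1..N}" for i using that by (auto simp: G_def)
    ultimately show ?thesis unfolding has_decomposition_def
      by (intro exI[of _ F] exI[of _ G] conjI ballI dF Fm Gm bil mc)
  qed
  show ?thesis using L1 main by blast
qed

text \<open>\<open>decomposition_exists\<close> gives constants for one type of points at a time; by
  the transfer those for the reals serve every type.\<close>

theorem propositionD:
  fixes \<alpha> :: real
  assumes "\<alpha> > 0"
  shows "(\<exists>(N::nat) (L::real). L \<ge> 1 \<and>
            (\<forall>(X :: real metric) (f :: (real^'n) \<times> (real^'m) \<Rightarrow> real).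
               one_lipschitz_on unit_cube X f \<longrightarrow> has_decomposition \<alpha> N L X f)) \<and>
         (\<forall>(N::nat) (L::real). L \<ge> 1 \<longrightarrow>
            (\<forall>(X :: real metric) (f :: (real^'n) \<times> (real^'m) \<Rightarrow> real).
               one_lipschitz_on unit_cube X f \<longrightarrow> has_decomposition \<alpha> N L X f) \<longrightarrow>
            (\<forall>(X :: 'x metric) (f :: (real^'n) \<times> (real^'m) \<Rightarrow> 'x).
               one_lipschitz_on unit_cube X f \<longrightarrow> has_decomposition \<alpha> N L X f))"
  using decomposition_exists[OF assms] has_decomposition_transfer by blast

end
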